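(* Let $r,d\ge 1$, let $G_1,\dots,G_r\subseteq\mathbb{C}$ and $\Omega_1,\dots,\Omega_d\subseteq\mathbb{C}$ be simply connected domains, and set $G=\prod_{i=1}^r G_i$, $\Omega=\prod_{i=1}^d\Omega_i$. Let $\zeta_0\in\Omega$, let $(N_k)_{k\ge 0}$ be an enumeration of $\mathbb{N}^d$ and let $\mu$ be an infinite subset of $\mathbb{N}$. Then the set $U^\mu_H(G,\Omega,\zeta_0)$ is a $G_\delta$ and dense subset of $H(G\times\Omega)$, and it contains a vector space except $0$ that is dense in $H(G\times\Omega)$; that is, there is a linear subspace $E$ of $H(G\times\Omega)$, dense in $H(G\times\Omega)$, with $E\setminus\{0\}\subseteq U^\mu_H(G,\Omega,\zeta_0)$.
   Context: $\mathbb{N}=\{0,1,2,\dots\}$. $H(G\times\Omega)$ is the space of holomorphic functions on $G\times\Omega$ with the topology of uniform convergence on compact subsets. Points of $G\times\Omega$ are written $(w,z)$. Suprema of nonnegative quantities over the empty set are $0$. Partial sums: for $f\in H(G\times\Omega)$, $w\in G$, $\zeta\in\Omega$ and $m=(m_1,\dots,m_d)\in\mathbb{N}^d$, let $\gamma_m(f,w,\zeta)=\frac{1}{m_1!\cdots m_d!}\frac{\partial^{m_1+\dots+m_d}}{\partial u_1^{m_1}\cdots\partial u_d^{m_d}}f(w,u)\big|_{u=\zeta}$, and for $n\ge0$ let $S_n(f,w,\zeta)(z)=\sum_{k=0}^n\gamma_{N_k}(f,w,\zeta)(z-\zeta)^{N_k}$ for $z\in\mathbb{C}^d$, where $z^m=z_1^{m_1}\cdots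 z_d^{m_d}$. A differential operator of mixed partial derivatives in $(w,z)$ is an operator $D=\frac{\partial^{m_1+\dots+m_{r+d}}}{\partial w_1^{m_1}\cdots\partial w_r^{m_r}\partial z_1^{m_{r+1}}\cdots\partial z_d^{m_{r+d}}}$ with $(m_1,\dots,m_{r+d})\in\mathbb{N}^{r+d}$ (the identity included). The class $U^\mu_H(G,\Omega,\zeta_0)$ is the set of $f\in H(G\times\Omega)$ such that: for every $K=\prod_{i=1}^dK_i$ with each $K_i\subseteq\mathbb{C}$ compact and $\mathbb{C}\setminus K_i$ connected, and with $\Omega_{i_0}\cap K_{i_0}=\emptyset$ for at least one $i_0\in\{1,\dots,d\}$, and for every holomorphic function $h:G\times V\to\mathbb{C}$, where $V\subseteq\mathbb{C}^d$ is an open set containing $K$, there exists a strictly increasing sequence $(\lambda_n)_{n\ge1}$ in $\mu$ such that, as $n\to\infty$, $\sup_{w\in L}\sup_{z\in K}|D(S_{\lambda_n}(f,w,\zeta_0)(z)-h(w,z))|\to0$ and $\sup_{w\in L}\sup_{z\in M}|S_{\lambda_n}(f,w,\zeta_0)(z)-f(w,z)|\to0$ for every compact $L\subseteq G$, every compact $M\subseteq\Omega$ and every differential operator $D$ of mixed partial derivatives in $(w,z)$. *)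

theory Defs
  imports "HOL-Analysis.Analysis" "HOL-Library.Function_Algebras"
begin

text \<open>
  Points of \<open>\<complex>\<^sup>r \<times> \<complex>\<^sup>d\<close> are pairs \<open>(w, z)\<close> of type \<open>('r, 'd) cpoint\<close>, and
  multi-indices in \<open>\<nat>\<^sup>d\<close> have type \<open>'d mindex\<close>. The index types carry a linear order, which plays
  the role of the order \<open>1 < \<dots> < d\<close> on the coordinates.
\<close>

type_synonym 'n cspace = "(complex, 'n) vec"
type_synonym ('r, 'd) cpoint = "'r cspace \<times> 'd cspace"
type_synonym 'n mindex = "(nat, 'n) vec"

definition box_prod :: "('n::finite \<Rightarrow> complex set) \<Rightarrow> 'n cspace set" where
  "box_prod A = {x. \<forall>i. x $ i \<in> A i}"

definition simply_connected_domain :: "complex set \<Rightarrow> bool" where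
  "simply_connected_domain S \<longleftrightarrow> S \<noteq> {} \<and> open S \<and> connected S \<and> simply_connected S"


subsection \<open>Holomorphic functions of several complex variables\<close>

text \<open>
  The derivative is taken at the full point (not within \<open>S\<close>); only open \<open>S\<close> are used.
  The second conjunct says that the real-linear map \<open>f'\<close> is complex-linear.
\<close>

definition holomorphic_several ::
    "(('r::finite, 'd::finite) cpoint \<Rightarrow> complex) \<Rightarrow> ('r, 'd) cpoint set \<Rightarrow> bool" where
  "holomorphic_several f S \<longleftrightarrow>
     (\<forall>p\<in>S. \<exists>f'. (f has_derivative f') (at p) \<and>
                 (\<forall>c u v. f' (c *s u, c *s v) = c * f' (u, v)))"

text \<open>
  The elements of \<open>H(S)\<close> are represented by total functions that vanish outside \<open>S\<close>, so that
  equality of functions is equality on \<open>S\<close> and the pointwise operations make \<open>H(S)\<close> a complex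
  vector space.
\<close>

definition Hol ::
    "('r::finite, 'd::finite) cpoint set \<Rightarrow> (('r, 'd) cpoint \<Rightarrow> complex) set" where
  "Hol S = {f. holomorphic_several f S \<and> (\<forall>p. p \<notin> S \<longrightarrow> f p = 0)}"

text \<open>The topology of uniform convergence on the compact subsets of \<open>S\<close>.\<close>

definition Hol_top ::
    "('r::finite, 'd::finite) cpoint set \<Rightarrow> (('r, 'd) cpoint \<Rightarrow> complex) topology" where
  "Hol_top S = topology (\<lambda>A. A \<subseteq> Hol S \<and>
     (\<forall>f\<in>A. \<exists>C e. compact C \<and> C \<subseteq> S \<and> e > 0 \<and> {g \<in> Hol S. \<forall>p\<in>C. cmod (g p - f p) < e} \<subseteq> A))"

lemma openin_Hol_top:
  "openin (Hol_top S) A \<longleftrightarrow> A \<subseteq> Hol S \<and>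
     (\<forall>f\<in>A. \<exists>C e. compact C \<and> C \<subseteq> S \<and> e > 0 \<and> {g \<in> Hol S. \<forall>p\<in>C. cmod (g p - f p) < e} \<subseteq> A)"
proof -
  define B where "B f C e = {g \<in> Hol S. \<forall>p\<in>C. cmod (g p - f p) < e}" for f C and e :: real
  define Q where "Q A f \<longleftrightarrow> (\<exists>C e. compact C \<and> C \<subseteq> S \<and> e > 0 \<and> B f C e \<subseteq> A)" for A f
  have Q_Int: "Q (A \<inter> A') f" if A: "Q A f" and A': "Q A' f" for A A' f
  proof -
    obtain C e where 1: "compact C" "C \<subseteq> S" "e > 0" "B f C e \<subseteq> A"
      using A unfolding Q_def by blast
    obtain C' e' where 2: "compact C'" "C' \<subseteq> S" "e' > 0" "B f C' e' \<subseteq> A'"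
      using A' unfolding Q_def by blast
    have "B f (C \<union> C') (min e e') \<subseteq> B f C e \<inter> B f C' e'"
      unfolding B_def by auto
    then have "B f (C \<union> C') (min e e') \<subseteq> A \<inter> A'"
      using 1(4) 2(4) by blast
    moreover have "compact (C \<union> C')" "C \<union> C' \<subseteq> S" "min e e' > 0"
      using 1 2 by auto
    ultimately show ?thesis
      unfolding Q_def by blast
  qed
  have Q_mono: "Q A' f" if "Q A f" "A \<subseteq> A'" for A A' f
    using that unfolding Q_def by (meson subset_trans)
  have "istopology (\<lambda>A. A \<subseteq> Hol S \<and> (\<forall>f\<in>A. Q A f))"
    unfolding istopology_def
  proof (intro conjI allI impI ballI)
    fix K f assume K: "\<forall>A\<in>K. A \<subseteq> Hol S \<and> (\<forall>f\<in>A. Q A f)" and "f \<in> \<Union>K"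
    then show "Q (\<Union>K) f" by (meson Q_mono Union_iff Union_upper)
  qed (use Q_Int in blast)+
  then have "openin (Hol_top S) A \<longleftrightarrow> A \<subseteq> Hol S \<and> (\<forall>f\<in>A. Q A f)"
    unfolding Hol_top_def Q_def B_def by (simp only: topology_inverse')
  then show ?thesis
    unfolding Q_def B_def .
qed

lemma topspace_Hol_top [simp]: "topspace (Hol_top S) = Hol S"
proof
  show "topspace (Hol_top S) \<subseteq> Hol S"
    using openin_Hol_top openin_topspace by blast
  have "openin (Hol_top S) (Hol S)"
    unfolding openin_Hol_top
    by (intro conjI ballI exI[of _ "{}"] exI[of _ "1::real"]) auto
  then show "Hol S \<subseteq> topspace (Hol_top S)"
    by (rule openin_subset)
qed

global_interpretation cfun: vector_space "\<lambda>(c::complex) (f::'a \<Rightarrow> complex) x. c * f x"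
  by standard (auto simp: fun_eq_iff algebra_simps)


subsection \<open>Mixed partial derivatives and partial sums\<close>

definition partial_deriv :: "'n::finite \<Rightarrow> ('n cspace \<Rightarrow> complex) \<Rightarrow> 'n cspace \<Rightarrow> complex" where
  "partial_deriv i F u = deriv (\<lambda>t. F (\<chi> j. if j = i then t else u $ j)) (u $ i)"

text \<open>
  \<open>multi_deriv m F\<close> is \<open>\<partial>\<^sub>1\<^bsup>m\<^sub>1\<^esup> \<cdots> \<partial>\<^sub>d\<^bsup>m\<^sub>d\<^esup> F\<close>, the derivative in the last variable being taken first.
\<close>

definition multi_deriv ::
    "('n::{finite,linorder}) mindex \<Rightarrow> ('n cspace \<Rightarrow> complex) \<Rightarrow> 'n cspace \<Rightarrow> complex" where
  "multi_deriv m F = foldr (\<lambda>i. partial_deriv i ^^ (m $ i)) (sorted_list_of_set UNIV) F"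

definition mixed_deriv ::
    "('r::{finite,linorder}) mindex \<Rightarrow> ('d::{finite,linorder}) mindex \<Rightarrow>
     (('r, 'd) cpoint \<Rightarrow> complex) \<Rightarrow> ('r, 'd) cpoint \<Rightarrow> complex" where
  "mixed_deriv a b F = (\<lambda>(w, z). multi_deriv a (\<lambda>w'. multi_deriv b (\<lambda>z'. F (w', z')) z) w)"

definition taylor_coeff ::
    "('d::{finite,linorder}) mindex \<Rightarrow> (('r, 'd) cpoint \<Rightarrow> complex) \<Rightarrow>
     'r cspace \<Rightarrow> 'd cspace \<Rightarrow> complex" where
  "taylor_coeff m f w \<zeta> = multi_deriv m (\<lambda>u. f (w, u)) \<zeta> / (\<Prod>i\<in>UNIV. fact (m $ i))"

definition partial_sum ::
    "(nat \<Rightarrow> ('d::{finite,linorder}) mindex) \<Rightarrow> nat \<Rightarrow> (('r, 'd) cpoint \<Rightarrow> complex) \<Rightarrow>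
     'r cspace \<Rightarrow> 'd cspace \<Rightarrow> 'd cspace \<Rightarrow> complex" where
  "partial_sum N n f w \<zeta> z =
     (\<Sum>k\<le>n. taylor_coeff (N k) f w \<zeta> * (\<Prod>i\<in>UNIV. (z $ i - \<zeta> $ i) ^ (N k $ i)))"


subsection \<open>The universality class\<close>

text \<open>
  The suprema are taken in \<^typ>\<open>ennreal\<close>, where the supremum of the empty set is \<open>0\<close>.
\<close>

definition universal_class ::
    "(nat \<Rightarrow> ('d::{finite,linorder}) mindex) \<Rightarrow> nat set \<Rightarrow> ('r::{finite,linorder}) cspace set \<Rightarrow>
     ('d \<Rightarrow> complex set) \<Rightarrow> 'd cspace \<Rightarrow> (('r, 'd) cpoint \<Rightarrow> complex) set" where
  "universal_class N \<mu> G \<Omega> \<zeta>\<^sub>0 = {f \<in> Hol (G \<times> box_prod \<Omega>).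
     \<forall>K V h.
       (\<forall>i. compact (K i) \<and> connected (- K i)) \<and> (\<exists>i\<^sub>0. \<Omega> i\<^sub>0 \<inter> K i\<^sub>0 = {}) \<and>
       open V \<and> box_prod K \<subseteq> V \<and> holomorphic_several h (G \<times> V) \<longrightarrow>
       (\<exists>l :: nat \<Rightarrow> nat. strict_mono l \<and> range l \<subseteq> \<mu> \<and>
          (\<forall>L M a b. compact L \<and> L \<subseteq> G \<and> compact M \<and> M \<subseteq> box_prod \<Omega> \<longrightarrow>
             (\<lambda>n. SUP w\<in>L. SUP z\<in>box_prod K. ennreal (cmod
                (mixed_deriv a b (\<lambda>(w', z'). partial_sum N (l n) f w' \<zeta>\<^sub>0 z' - h (w', z')) (w, z))))
               \<longlonglongrightarrow> 0 \<and>
             (\<lambda>n. SUP w\<in>L. SUP z\<in>M. ennreal (cmod (partial_sum N (l n) f w \<zeta>\<^sub>0 z - f (w, z))))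
               \<longlonglongrightarrow> 0))}"

end

theory Submission
  imports Defs "HOL-Complex_Analysis.Complex_Analysis"
begin

text \<open>
  Since a Taylor sum \<open>S\<^sub>n(P)\<close> of a polynomial \<open>P\<close> equals
    \<open>P\<close> for all large \<open>n\<close>, the conditions that
  define the class are dense as soon as polynomials are: given \<open>f\<close>, a target polynomial
    \<open>p\<close> and a
  compact set \<open>K\<close> with \<open>\<Omega>\<^sub>i \<inter> K\<^sub>i =
    {}\<close>, approximate \<open>f\<close> by a polynomial \<open>g\<close> and take
  \<open>P = p + q(z\<^sub>i) (g - p)\<close>,
    where the polynomial \<open>q\<close> of one variable is close to 1 on a compact part of
  \<open>\<Omega>\<^sub>i\<close> and close to 0 near \<open>K\<^sub>i\<close>. Both approximations
    are instances of Runge's theorem, whose product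
  version follows from the one-variable theorem with parameters by replacing one coordinate at a
  time. Convergence of all derivatives comes for free from Cauchy's estimates. A countable cofinal
  family of compact sets reduces the class to countably many open dense conditions, and Baire's
  theorem applies. For the vector space, universal functions \<open>Y\<^sub>0, Y\<^sub>1,
    \<dots>\<close> are chosen one after the
  other, each universal with indices from sets along which the Taylor sums of its predecessors tend
  to 0 on the given compact set; in a linear combination the last term then decides.
\<close>

subsection \<open>Holomorphic functions of several variables\<close>

text \<open>The class asks for one sequence of indices that serves all compact sets and all
  derivatives at once, for uncountably many \<open>K\<close>, \<open>V\<close> and \<open>h\<close>.
  Targets are reduced to polynomials with coefficients in a countable dense set, and the sequence is
  recovered by a diagonal choice over levels \<open>s\<close>, where level \<open>s\<close> fixes
  the compact sets, the order of the derivatives and the precision. Derivatives force a margin: a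
  bound on values controls derivatives only on a smaller set, so \<open>K\<close> has to lie in the
  interior of the set on which Runge's theorem is applied. But \<open>K\<^sub>i\<close> may touch
  the boundary of \<open>\<Omega>\<^sub>i\<close>, so this larger set cannot be kept off
  \<open>\<Omega>\<^sub>i\<close>. It is only kept off a compact \<open>R\<^sub>i\<close> inside
  \<open>\<Omega>\<^sub>i\<close>, and this is enough because a neighbourhood of \<open>f\<close> in
  the topology of compact convergence only sees a compact set. Simple connectivity enters here: it
  allows a compact subset of a factor to be enlarged, within the factor, to a compact set with
  connected complement.\<close>

definition cscale :: "complex \<Rightarrow> ('r::finite, 'd::finite) cpoint \<Rightarrow> ('r, 'd)
  cpoint" where
  "cscale c p = (c *s fst p, c *s snd p)"

lemma norm_vector_smult_complex: "norm (c *s (x::'n::finite cspace)) = cmod c * norm x"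
  by (simp add: norm_vec_def L2_set_def norm_mult power_mult_distrib
      sum_distrib_left[symmetric] real_sqrt_mult)

lemma norm_cscale [simp]: "norm (cscale c p) = cmod c * norm p"
proof -
  have "sqrt ((cmod c * norm (fst p))\<^sup>2 + (cmod c * norm (snd p))\<^sup>2) =
    sqrt ((cmod c)\<^sup>2 * ((norm (fst p))\<^sup>2 + (norm (snd p))\<^sup>2))"
    by (simp add: power_mult_distrib algebra_simps)
  also have "\<dots> = cmod c * norm p"
    by (simp add: real_sqrt_mult norm_prod_def)
  finally show ?thesis
    by (simp add: cscale_def norm_Pair norm_vector_smult_complex)
qed

lemma cscale_simps [simp]:
  "cscale 0 p = 0" "cscale 1 p = p" "cscale c 0 = 0" "cscale a (cscale b p) = cscale (a * b) p"
  by (auto simp: cscale_def vec_eq_iff prod_eq_iff mult.assoc)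

lemma cscale_add_left: "cscale (a + b) p = cscale a p + cscale b p"
  by (auto simp: cscale_def vec_eq_iff prod_eq_iff algebra_simps)

lemma scaleR_cscale: "a *\<^sub>R cscale c p = cscale (a *\<^sub>R c) p"
  by (auto simp: cscale_def vec_eq_iff prod_eq_iff)

lemma bounded_linear_cscale_left: "bounded_linear (\<lambda>c. cscale c p)"
  by (rule bounded_linear_intro[where K="norm p"])
    (auto simp: cscale_add_left scaleR_cscale)

lemma holomorphic_several_iff:
  "holomorphic_several f S \<longleftrightarrow>
     (\<forall>p\<in>S. \<exists>f'. (f has_derivative f') (at p) \<and>
       (\<forall>c q. f' (cscale c q) = c * f' q))"
  unfolding holomorphic_several_def cscale_def by simp

lemma holomorphic_several_subset:
  "holomorphic_several f S \<Longrightarrow> T \<subseteq> S \<Longrightarrow> holomorphic_several f T"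
  unfolding holomorphic_several_def by blast

lemma holomorphic_several_cong:
  assumes "holomorphic_several f S" "open S" "\<And>p. p \<in> S \<Longrightarrow> f p = g p"
  shows "holomorphic_several g S"
  unfolding holomorphic_several_def
proof
  fix p assume p: "p \<in> S"
  then obtain f' where f': "(f has_derivative f') (at p)" "\<forall>c u v. f' (c *s u, c *s v) =
    c * f' (u, v)"
    using assms(1) unfolding holomorphic_several_def by blast
  have "(g has_derivative f') (at p)"
    using has_derivative_transform_within_open[OF f'(1) assms(2) p] assms(3) by blast
  then show "\<exists>f'. (g has_derivative f') (at p) \<and> (\<forall>c u v. f' (c *s u, c *s v) =
    c * f' (u, v))"
    using f'(2) by blast
qed

lemma holomorphic_several_continuous: "holomorphic_several f S \<Longrightarrow> continuous_on S f"
  unfolding holomorphic_several_def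
  by (meson continuous_at_imp_continuous_on has_derivative_continuous)

lemma holomorphic_several_const [intro]: "holomorphic_several (\<lambda>_. c) S"
  unfolding holomorphic_several_iff
  by (intro ballI exI[of _ "\<lambda>_. 0"]) auto

lemma holomorphic_several_add:
  assumes "holomorphic_several f S" "holomorphic_several g S"
  shows "holomorphic_several (\<lambda>p. f p + g p) S"
  unfolding holomorphic_several_iff
proof
  fix p assume "p \<in> S"
  then obtain f' g' where 1: "(f has_derivative f') (at p)" "\<forall>c q. f' (cscale c q) = c * f' q"
      "(g has_derivative g') (at p)" "\<forall>c q. g' (cscale c q) = c * g' q"
    using assms unfolding holomorphic_several_iff by blast
  show "\<exists>h. ((\<lambda>p. f p + g p) has_derivative h) (at p) \<and>
    (\<forall>c q. h (cscale c q) = c * h q)"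
    using 1 by (intro exI[of _ "\<lambda>q. f' q + g' q"]) (auto intro: derivative_intros simp:
      algebra_simps)
qed

lemma holomorphic_several_mult:
  assumes "holomorphic_several f S" "holomorphic_several g S"
  shows "holomorphic_several (\<lambda>p. f p * g p) S"
  unfolding holomorphic_several_iff
proof
  fix p assume "p \<in> S"
  then obtain f' g' where 1: "(f has_derivative f') (at p)" "\<forall>c q. f' (cscale c q) = c * f' q"
      "(g has_derivative g') (at p)" "\<forall>c q. g' (cscale c q) = c * g' q"
    using assms unfolding holomorphic_several_iff by blast
  show "\<exists>h. ((\<lambda>p. f p * g p) has_derivative h) (at p) \<and>
    (\<forall>c q. h (cscale c q) = c * h q)"
    using 1 by (intro exI[of _ "\<lambda>q. f p * g' q + f' q * g p"])
      (auto intro!: has_derivative_mult simp: algebra_simps)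
qed

lemma holomorphic_several_cmult:
  "holomorphic_several f S \<Longrightarrow> holomorphic_several (\<lambda>p. c * f p) S"
  by (intro holomorphic_several_mult holomorphic_several_const)

lemma holomorphic_several_diff:
  assumes "holomorphic_several f S" "holomorphic_several g S"
  shows "holomorphic_several (\<lambda>p. f p - g p) S"
  using holomorphic_several_add[OF assms(1) holomorphic_several_cmult[OF assms(2), of "-1"]] by simp

lemma holomorphic_several_sum:
  "(\<And>i. i \<in> I \<Longrightarrow> holomorphic_several (f i) S) \<Longrightarrow>
    holomorphic_several (\<lambda>p. \<Sum>i\<in>I. f i p) S"
  by (induction I rule: infinite_finite_induct) (auto intro: holomorphic_several_add)

lemma holomorphic_several_prod:
  "(\<And>i. i \<in> I \<Longrightarrow> holomorphic_several (f i) S) \<Longrightarrow>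
    holomorphic_several (\<lambda>p. \<Prod>i\<in>I. f i p) S"
  by (induction I rule: infinite_finite_induct) (auto intro: holomorphic_several_mult)

lemma holomorphic_several_power:
  "holomorphic_several f S \<Longrightarrow> holomorphic_several (\<lambda>p. f p ^ n) S"
  by (induction n) (auto intro: holomorphic_several_mult)

lemma holomorphic_several_fst_nth: "holomorphic_several (\<lambda>p. fst p $ i) S"
  unfolding holomorphic_several_def
  by (intro ballI exI[of _ "\<lambda>p. fst p $ i"])
     (auto intro!: bounded_linear_imp_has_derivative bounded_linear_compose[OF
       bounded_linear_vec_nth bounded_linear_fst])

lemma holomorphic_several_snd_nth: "holomorphic_several (\<lambda>p. snd p $ i) S"
  unfolding holomorphic_several_def
  by (intro ballI exI[of _ "\<lambda>p. snd p $ i"])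
     (auto intro!: bounded_linear_imp_has_derivative bounded_linear_compose[OF
       bounded_linear_vec_nth bounded_linear_snd])

section \<open>Derivatives along complex lines, Cauchy's estimates and locally uniform
  limits\<close>

definition dir_deriv ::
    "('r::finite, 'd::finite) cpoint \<Rightarrow> (('r, 'd) cpoint \<Rightarrow> complex)
      \<Rightarrow> ('r, 'd) cpoint \<Rightarrow> complex" where
  "dir_deriv v f p = deriv (\<lambda>t. f (p + cscale t v)) 0"

lemma line_has_field_derivative:
  assumes "(f has_derivative f') (at (p + cscale t v))" "\<And>c q. f' (cscale c q) = c * f' q"
  shows "((\<lambda>t. f (p + cscale t v)) has_field_derivative f' v) (at t)"
proof -
  have "((\<lambda>t. p + cscale t v) has_derivative (\<lambda>h. cscale h v)) (at t)"
    by (auto intro!: derivative_eq_intros bounded_linear_imp_has_derivative bounded_linear_cscale_left)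
  from has_derivative_compose[OF this assms(1)]
  show ?thesis
    unfolding has_field_derivative_def using assms(2) by (simp add: mult.commute[of _ "f' v"])
qed

lemma dir_deriv_eq:
  assumes "(f has_derivative f') (at p)" "\<And>c q. f' (cscale c q) = c * f' q"
  shows "dir_deriv v f p = f' v"
  unfolding dir_deriv_def
  by (rule DERIV_imp_deriv, rule line_has_field_derivative) (use assms in auto)

lemma holomorphic_on_line:
  assumes "holomorphic_several f S" "\<And>t. t \<in> T \<Longrightarrow> p + cscale t v \<in> S"
  shows "(\<lambda>t. f (p + cscale t v)) holomorphic_on T"
proof (rule holomorphic_onI)
  fix t assume "t \<in> T"
  then obtain f' where "(f has_derivative f') (at (p + cscale t v))" "\<forall>c q. f' (cscale c q) =
    c * f' q"
    using assms unfolding holomorphic_several_iff by blast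
  from line_has_field_derivative[OF this(1)] this(2)
  show "(\<lambda>t. f (p + cscale t v)) field_differentiable at t within T"
    using field_differentiable_at_within field_differentiable_def by blast
qed

text \<open>Since \<open>norm v \<le> 1\<close>, the disc of radius \<open>r\<close> in the complex
  line through \<open>p\<close> stays inside \<open>cball p r\<close>, and the inequality of one
  variable applies to the restriction of \<open>f\<close>.\<close>

lemma Cauchy_estimate_line:
  assumes f: "holomorphic_several f S" and r: "r > 0" "cball p r \<subseteq> S" and v: "norm v \<le> 1"
    and B: "\<And>q. q \<in> cball p r \<Longrightarrow> cmod (f q) \<le> B"
  shows "cmod ((deriv ^^ n) (\<lambda>t. f (p + cscale t v)) 0) \<le> fact n * B / r ^ n"
proof -
  have in_ball: "p + cscale t v \<in> cball p r" if "t \<in> cball 0 r" for t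
    using that v mult_mono[of "cmod t" r "norm v" 1] r by (auto simp: dist_norm)
  then have *: "(\<lambda>t. f (p + cscale t v)) holomorphic_on cball 0 r"
    using r by (intro holomorphic_on_line[OF f]) blast
  show ?thesis
  proof (rule Cauchy_inequality[of "\<lambda>t. f (p + cscale t v)" 0 r B n])
    show "(\<lambda>t. f (p + cscale t v)) holomorphic_on ball 0 r"
      using * holomorphic_on_subset by (metis ball_subset_cball)
    show "continuous_on (cball 0 r) (\<lambda>t. f (p + cscale t v))"
      using * holomorphic_on_imp_continuous_on by blast
  qed (use r B in_ball in auto)
qed

lemma Cauchy_estimate:
  assumes "holomorphic_several f S" "r > 0" "cball p r \<subseteq> S" "norm v \<le> 1"
    and "\<And>q. q \<in> cball p r \<Longrightarrow> cmod (f q) \<le> B"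
  shows "cmod (dir_deriv v f p) \<le> B / r"
  using Cauchy_estimate_line[OF assms, of 1] by (simp add: dir_deriv_def)

lemma dir_deriv_lincomb:
  assumes "holomorphic_several f S" "holomorphic_several g S" "p \<in> S"
  shows "dir_deriv v (\<lambda>p. c * f p + g p) p = c * dir_deriv v f p + dir_deriv v g p"
proof -
  obtain f' g' where 1: "(f has_derivative f') (at p)" "\<And>c q. f' (cscale c q) = c * f' q"
      "(g has_derivative g') (at p)" "\<And>c q. g' (cscale c q) = c * g' q"
    using assms unfolding holomorphic_several_iff by meson
  have "dir_deriv v (\<lambda>p. c * f p + g p) p = c * f' v + g' v"
  proof (rule dir_deriv_eq[of _ "\<lambda>q. c * f' q + g' q"])
    show "((\<lambda>p. c * f p + g p) has_derivative (\<lambda>q. c * f' q + g' q)) (at p)"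
      by (intro has_derivative_add has_derivative_mult_right 1)
  qed (simp add: 1(2,4) algebra_simps)
  then show ?thesis
    using dir_deriv_eq[OF 1(1,2)] dir_deriv_eq[OF 1(3,4)] by simp
qed

lemma dir_deriv_cong:
  assumes "open S" "p \<in> S" "\<And>q. q \<in> S \<Longrightarrow> f q = g q"
  shows "dir_deriv v f p = dir_deriv v g p"
  unfolding dir_deriv_def
proof (rule deriv_cong_ev)
  have "isCont (\<lambda>t. p + cscale t v) 0"
    by (intro continuous_intros linear_continuous_at bounded_linear_cscale_left)
  then have "((\<lambda>t. p + cscale t v) \<longlongrightarrow> p) (nhds 0)"
    using tendsto_at_iff_tendsto_nhds[of "\<lambda>t. p + cscale t v" 0] by (simp add: isCont_def)
  then have "\<forall>\<^sub>F t in nhds 0. p + cscale t v \<in> S"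
    using assms(1,2) topological_tendstoD by blast
  then show "\<forall>\<^sub>F t in nhds 0. f (p + cscale t v) = g (p + cscale t v)"
    by eventually_elim (use assms in auto)
qed simp

text \<open>
  Applying Cauchy's estimate on complex lines makes the derivatives a Cauchy sequence as soon as
  the functions converge locally uniformly.
\<close>

lemma holomorphic_several_uniform_limit:
  assumes hol: "\<And>n::nat. holomorphic_several (F n) S"
    and lim: "\<And>p. p \<in> S \<Longrightarrow> \<exists>r>0. cball p r \<subseteq> S \<and>
      uniform_limit (cball p r) F g sequentially"
  shows "holomorphic_several g S"
  unfolding holomorphic_several_iff
proof
  fix p assume "p \<in> S"
  then obtain r where r: "r > 0" "cball p r \<subseteq> S"
    and ul: "uniform_limit (cball p r) F g sequentially"
    using lim by blast
  \<comment> \<open>Half the radius: around each point of \<open>X\<close> a ball of radius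
    \<open>r/2\<close> is still available for Cauchy's estimate.\<close>
  define X where "X = ball p (r/2)"
  have X: "convex X" "p \<in> X" "open X" "X \<subseteq> S" "\<And>x. x \<in> X \<Longrightarrow>
    cball x (r/2) \<subseteq> cball p r"
    using r by (auto simp: X_def cball_subset_cball_iff dist_commute)
  have "\<forall>n. \<exists>f'. \<forall>x\<in>X. (F n has_derivative f' x) (at x) \<and>
    (\<forall>c q. f' x (cscale c q) = c * f' x q)"
    using hol X unfolding holomorphic_several_iff by (intro allI bchoice) (meson subsetD)
  then obtain F' where F': "\<And>n x. x \<in> X \<Longrightarrow> (F n has_derivative F' n x) (at x)"
     "\<And>n x c q. x \<in> X \<Longrightarrow> F' n x (cscale c q) = c * F' n x q"
    by metis
  have Cauchy1: "cmod (F' m x h - F' n x h) \<le> B / (r/2) * norm h"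
    if "x \<in> X" and B: "\<And>y. y \<in> cball p r \<Longrightarrow> cmod (F m y - F n y) \<le>
      B" for x h m n B
  proof (cases "h = 0")
    case True
    moreover have "F' k x 0 = 0" for k
      using F'(2)[OF that(1), of k 0 0] by simp
    ultimately show ?thesis by simp
  next
    case False
    \<comment> \<open>Cauchy's estimate covers directions of norm at most 1; complex linearity of
      the derivatives extends the bound to every \<open>h\<close>.\<close>
    define u where "u = cscale (of_real (1 / norm h)) h"
    have nu: "norm u \<le> 1" and hu: "h = cscale (of_real (norm h)) u"
      using False by (auto simp: u_def norm_divide)
    have "dir_deriv u (\<lambda>y. F m y - F n y) x = F' m x u - F' n x u"
      by (rule dir_deriv_eq[of _ "\<lambda>q. F' m x q - F' n x q"])
         (use that(1) in \<open>auto intro: derivative_intros F' simp: F' algebra_simps\<close>)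
    moreover have "cmod (dir_deriv u (\<lambda>y. F m y - F n y) x) \<le> B / (r/2)"
    proof (rule Cauchy_estimate)
      show "holomorphic_several (\<lambda>y. F m y - F n y) S"
        by (intro holomorphic_several_diff hol)
    qed (use r X(5)[OF that(1)] nu B in auto)
    moreover have "F' m x h - F' n x h = norm h * (F' m x u - F' n x u)"
    proof -
      have "F' k x h = norm h * F' k x u" for k
        using F'(2)[OF that(1), of k "of_real (norm h)" u] hu[symmetric] by simp
      then show ?thesis by (simp add: algebra_simps)
    qed
    ultimately show ?thesis
      using mult_left_mono[of "cmod (F' m x u - F' n x u)" "B / (r/2)" "norm h"]
      by (simp add: norm_mult mult.commute)
  qed
  have Cauchy2: "\<exists>M. \<forall>m\<ge>M. \<forall>n\<ge>M. \<forall>x\<in>X. \<forall>h. cmod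
    (F' m x h - F' n x h) \<le> e * norm h" if "e > 0" for e
  proof -
    have UC: "uniformly_Cauchy_on (cball p r) F"
      using ul uniformly_convergent_Cauchy uniformly_convergent_on_def by blast
    have "e * (r/2) > 0" using \<open>e > 0\<close> r by simp
    from UC[unfolded uniformly_Cauchy_on_def, rule_format, OF this] obtain M
      where M: "\<forall>x\<in>cball p r. \<forall>m\<ge>M. \<forall>n\<ge>M. dist (F m x) (F n x) <
      e * (r/2)"
      by blast
    have "cmod (F' m x h - F' n x h) \<le> e * norm h" if "m \<ge> M" "n \<ge> M" "x \<in> X" for m n x h
      using Cauchy1[of x m n "e * (r/2)" h] that M r by (auto simp: dist_norm less_imp_le)
    then show ?thesis by blast
  qed
  define g' where "g' x h = lim (\<lambda>n. F' n x h)" for x h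
  have g': "(\<lambda>n. F' n x h) \<longlonglongrightarrow> g' x h" if "x \<in> X" for x h
  proof -
    have "Cauchy (\<lambda>n. F' n x h)"
    proof (rule metric_CauchyI)
      fix e :: real assume "e > 0"
      \<comment> \<open>The summand 1 keeps the quotient meaningful for \<open>h = 0\<close> and
        makes \<open>c * norm h\<close> strictly smaller than \<open>e\<close>.\<close>
      define c where "c = e / (norm h + 1)"
      have "norm h + 1 > 0" by (simp add: add_nonneg_pos)
      then have c: "c > 0" "c * norm h < e"
        using \<open>e > 0\<close> by (auto simp: c_def field_simps)
      obtain M where M: "\<forall>m\<ge>M. \<forall>n\<ge>M. \<forall>x\<in>X. \<forall>h. cmod (F'
        m x h - F' n x h) \<le> c * norm h"
        using Cauchy2[OF c(1)] by blast
      have "dist (F' m x h) (F' n x h) < e" if "m \<ge> M" "n \<ge> M" for m n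
        unfolding dist_norm by (rule order_le_less_trans[OF _ c(2)]) (use M that \<open>x \<in>
          X\<close> in blast)
      then show "\<exists>M. \<forall>m\<ge>M. \<forall>n\<ge>M. dist (F' m x h) (F' n x h) < e"
        by blast
    qed
    then show ?thesis unfolding g'_def using Cauchy_convergent_iff convergent_LIMSEQ_iff by blast
  qed
  \<comment> \<open>The theorem on sequences of derivatives works within the convex set
    \<open>X\<close> and produces a limit \<open>k\<close> of its own. It is identified with
    \<open>g\<close> below, and openness of \<open>X\<close> turns the derivative within
    \<open>X\<close> into one at \<open>p\<close>.\<close>
  have "\<exists>k. \<forall>x\<in>X. (\<lambda>n. F n x) \<longlonglongrightarrow> k x \<and>
    (k has_derivative g' x) (at x within X)"
  proof (rule has_derivative_sequence)
    show "\<forall>\<^sub>F n in sequentially. \<forall>x\<in>X. \<forall>h. cmod (F' n x h - g' x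
      h) \<le> e * norm h" if "e > 0" for e
    proof -
      obtain M where M: "\<forall>m\<ge>M. \<forall>n\<ge>M. \<forall>x\<in>X. \<forall>h. cmod (F'
        m x h - F' n x h) \<le> e * norm h"
        using Cauchy2[OF \<open>e > 0\<close>] by blast
      have "cmod (F' n x h - g' x h) \<le> e * norm h" if "n \<ge> M" "x \<in> X" for n x h
      proof (rule LIMSEQ_le_const2)
        show "(\<lambda>m. cmod (F' n x h - F' m x h)) \<longlonglongrightarrow> cmod (F' n x h - g' x h)"
          by (intro tendsto_intros g' that)
        show "\<exists>N. \<forall>m\<ge>N. cmod (F' n x h - F' m x h) \<le> e * norm h"
          using M that by blast
      qed
      then show ?thesis using eventually_sequentially by blast
    qed
    show "(\<lambda>n. F n p) \<longlonglongrightarrow> g p"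
      using ul r by (auto intro: tendsto_uniform_limitI)
  qed (use X F'(1) in \<open>auto intro: has_derivative_at_withinI\<close>)
  then obtain k where k: "\<And>x. x \<in> X \<Longrightarrow> (\<lambda>n. F n x)
    \<longlonglongrightarrow> k x"
       "\<And>x. x \<in> X \<Longrightarrow> (k has_derivative g' x) (at x within X)"
    by blast
  have kg: "k x = g x" if "x \<in> X" for x
  proof -
    have "x \<in> cball p r" using that r by (auto simp: X_def)
    then have "(\<lambda>n. F n x) \<longlonglongrightarrow> g x" by (rule tendsto_uniform_limitI[OF ul])
    then show ?thesis using k(1)[OF that] LIMSEQ_unique by blast
  qed
  have "(k has_derivative g' p) (at p)"
    using k(2)[OF X(2)] by (simp only: at_within_open[OF X(2,3)])
  then have 1: "(g has_derivative g' p) (at p)"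
    by (rule has_derivative_transform_within_open[OF _ X(3,2)]) (rule kg)
  have "g' p (cscale c q) = c * g' p q" for c q
  proof (rule LIMSEQ_unique)
    show "(\<lambda>n. F' n p (cscale c q)) \<longlonglongrightarrow> g' p (cscale c q)"
      by (rule g'[OF X(2)])
    show "(\<lambda>n. F' n p (cscale c q)) \<longlonglongrightarrow> c * g' p q"
      unfolding F'(2)[OF X(2)] by (intro tendsto_intros g' X)
  qed
  with 1 show "\<exists>f'. (g has_derivative f') (at p) \<and> (\<forall>c q. f' (cscale c q) = c * f' q)"
    by blast
qed

lemma holomorphic_several_translate:
  assumes "holomorphic_several f S" "\<And>p. p \<in> T \<Longrightarrow> p + a \<in> S"
  shows "holomorphic_several (\<lambda>p. f (p + a)) T"
  unfolding holomorphic_several_iff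
proof
  fix p assume "p \<in> T"
  then obtain f' where f': "(f has_derivative f') (at (p + a))" "\<forall>c q. f' (cscale c q) = c * f' q"
    using assms unfolding holomorphic_several_iff by blast
  have "((\<lambda>p. p + a) has_derivative (\<lambda>h. h)) (at p)"
    by (auto intro!: derivative_eq_intros)
  from has_derivative_compose[OF this f'(1)] f'(2)
  show "\<exists>f'. ((\<lambda>p. f (p + a)) has_derivative f') (at p) \<and>
    (\<forall>c q. f' (cscale c q) = c * f' q)"
    by blast
qed

text \<open>Taylor coefficients are derivatives evaluated at \<open>(w, \<zeta>)\<close>. This makes
  them holomorphic as functions on \<open>G \<times> UNIV\<close>, although \<open>f\<close> itself
  lives on a smaller set.\<close>

lemma holomorphic_several_freeze:
  assumes "holomorphic_several f S" "\<And>p. p \<in> T \<Longrightarrow> (fst p, \<zeta>) \<in> S"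
  shows "holomorphic_several (\<lambda>p. f (fst p, \<zeta>)) T"
  unfolding holomorphic_several_iff
proof
  fix p assume "p \<in> T"
  then obtain f' where f': "(f has_derivative f') (at (fst p, \<zeta>))" "\<forall>c q. f' (cscale c
    q) = c * f' q"
    using assms unfolding holomorphic_several_iff by blast
  have "((\<lambda>p. (fst p, \<zeta>)) has_derivative (\<lambda>h. (fst h, 0))) (at p)"
    by (auto intro!: derivative_eq_intros)
  from has_derivative_compose[OF this f'(1)]
  have 1: "((\<lambda>p. f (fst p, \<zeta>)) has_derivative (\<lambda>h. f' (fst h, 0))) (at p)" .
  have 2: "f' (fst (cscale c h), 0) = c * f' (fst h, 0)" for c h
    using f'(2)[rule_format, of c "(fst h, 0)"] by (simp add: cscale_def)
  show "\<exists>f'. ((\<lambda>p. f (fst p, \<zeta>)) has_derivative f') (at p) \<and>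
    (\<forall>c q. f' (cscale c q) = c * f' q)"
    using 1 2 by (intro exI[of _ "\<lambda>h. f' (fst h, 0)"]) blast
qed

text \<open>Taylor's formula of order 1. Discs of radius \<open>r/3\<close> about points of
  \<open>ball 0 (r/2)\<close> stay in \<open>ball 0 r\<close>, so Cauchy's inequality bounds the
  second derivative by \<open>2 * B / (r/3)\<^sup>2\<close>, which is the constant
  \<open>18 * B / r\<^sup>2\<close>. The bound depends on \<open>g\<close> only through
  \<open>B\<close>, hence is uniform over many lines.\<close>

lemma difference_quotient_bound:
  assumes hol: "g holomorphic_on ball 0 r" and r: "r > 0"
    and B: "\<And>t. t \<in> ball 0 r \<Longrightarrow> cmod (g t) \<le> B"
      and h: "h \<noteq> 0" "cmod h < r / 2"
  shows "cmod ((g h - g 0) / h - deriv g 0) \<le> 18 * B / r\<^sup>2 * cmod h"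
proof -
  have der: "((deriv ^^ i) g has_field_derivative (deriv ^^ Suc i) g x) (at x within ball 0 (r / 2))"
    if "x \<in> ball 0 (r/2)" for i x
  proof -
    have "(deriv ^^ i) g holomorphic_on ball 0 r"
      by (rule holomorphic_higher_deriv[OF hol]) simp
    then show ?thesis
      unfolding funpow.simps o_apply using that r
      by (intro has_field_derivative_at_within[OF holomorphic_derivI[of _ "ball 0 r"]]) auto
  qed
  have bd: "cmod ((deriv ^^ Suc 1) g x) \<le> 18 * B / r\<^sup>2" if x: "x \<in> ball 0 (r / 2)" for x
  proof -
    have sub: "cball x (r/3) \<subseteq> ball 0 r"
      using x r by (auto simp: cball_subset_ball_iff)
    have bd_eq: "fact 2 * B / (r/3)^2 = 18 * B / r\<^sup>2"
      by (simp add: power_divide)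
    have "cmod ((deriv ^^ 2) g x) \<le> fact 2 * B / (r/3)^2"
    proof (rule Cauchy_inequality)
      show "g holomorphic_on ball x (r/3)"
        using hol sub by (meson ball_subset_cball holomorphic_on_subset order_trans)
      show "continuous_on (cball x (r/3)) g"
        using hol sub holomorphic_on_imp_continuous_on holomorphic_on_subset by blast
      show "cmod (g t) \<le> B" if "cmod (x - t) = r / 3" for t
        using that sub by (intro B) (auto simp: dist_norm)
    qed (use r in auto)
    moreover have "(deriv ^^ 2) g x = (deriv ^^ Suc 1) g x"
      by (simp only: numeral_2_eq_2 One_nat_def)
    ultimately show ?thesis unfolding bd_eq by (simp only:)
  qed
  have "cmod ((deriv ^^ 0) g h - (\<Sum>i\<le>1. (deriv ^^ i) g 0 * (h - 0) ^ i / fact i))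
          \<le> 18 * B / r\<^sup>2 * cmod (h - 0) ^ Suc 1 / fact 1"
    by (rule complex_Taylor[of "ball 0 (r/2)", OF _ der bd]) (use h r in auto)
  then have *: "cmod (g h - (g 0 + deriv g 0 * h)) \<le> 18 * B / r\<^sup>2 * (cmod h)\<^sup>2"
    by (simp add: power2_eq_square)
  have "(g h - g 0) / h - deriv g 0 = (g h - (g 0 + deriv g 0 * h)) / h"
    using h by (simp add: field_simps)
  then have "cmod ((g h - g 0) / h - deriv g 0) = cmod (g h - (g 0 + deriv g 0 * h)) / cmod h"
    by (simp add: norm_divide)
  also have "\<dots> \<le> 18 * B / r\<^sup>2 * (cmod h)\<^sup>2 / cmod h"
    by (rule divide_right_mono[OF *]) simp
  also have "\<dots> = 18 * B / r\<^sup>2 * cmod h"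
    by (simp add: power2_eq_square)
  finally show ?thesis .
qed

text \<open>The difference quotients in direction \<open>v\<close> are holomorphic and converge
  uniformly near each point, so the theorem on uniform limits applies. No second derivatives in
  several variables are needed.\<close>

lemma holomorphic_several_dir_deriv:
  assumes f: "holomorphic_several f S" and S: "open S" and v: "norm v \<le> 1"
  shows "holomorphic_several (dir_deriv v f) S"
proof -
  have "\<exists>r>0. holomorphic_several (dir_deriv v f) (ball p0 r)" if p0: "p0 \<in> S" for p0
  proof -
    obtain R where R: "R > 0" "cball p0 R \<subseteq> S"
      using S p0 open_contains_cball by blast
    define r where "r = R / 2"
    have r: "r > 0" "cball p0 (2*r) \<subseteq> S" using R by (auto simp: r_def)
    have "compact (f ` cball p0 (2*r))"
      by (intro compact_continuous_image holomorphic_several_continuous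
        holomorphic_several_subset[OF f] r) auto
    then obtain B where B: "\<And>q. q \<in> cball p0 (2*r) \<Longrightarrow> cmod (f q) \<le> B"
      using compact_imp_bounded bounded_iff by (metis imageI)
    \<comment> \<open>Shifting the sequence of steps by \<open>N\<close> makes every
      \<open>h n\<close>, not only the late ones, small enough for the estimate of the difference
      quotient.\<close>
    obtain N where N: "inverse (real (Suc N)) < r / 2"
      using r(1) reals_Archimedean[of "r/2"] by auto
    define h where "h n = complex_of_real (inverse (real (Suc (n + N))))" for n
    have h0: "h n \<noteq> 0" "cmod (h n) = inverse (real (Suc (n + N)))" for n
      by (simp_all add: h_def norm_inverse del: of_nat_Suc of_nat_add)
    have h1: "cmod (h n) < r / 2" for n
    proof -
      have "inverse (real (Suc (n + N))) \<le> inverse (real (Suc N))"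
        by (rule le_imp_inverse_le) auto
      with N show ?thesis unfolding h0(2) by (rule order_le_less_trans[rotated])
    qed
    define F where "F n p = (f (p + cscale (h n) v) - f p) / h n" for n p
    have hv: "norm (cscale t v) \<le> cmod t" for t
      using v by (simp add: mult_left_le)
    have mem: "p + cscale t v \<in> cball p0 (2*r)" if "p \<in> ball p0 r" "cmod t < r" for p t
      using that hv[of t] norm_triangle_ineq[of "p - p0" "cscale t v"]
      by (auto simp: dist_norm norm_minus_commute algebra_simps)
    have err: "cmod (F n p - dir_deriv v f p) \<le> 18 * B / r\<^sup>2 * cmod (h n)"
      if p: "p \<in> ball p0 r" for n p
    proof -
      have "cmod ((f (p + cscale (h n) v) - f (p + cscale 0 v)) / h n - deriv (\<lambda>t. f (p +
        cscale t v)) 0)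
             \<le> 18 * B / r\<^sup>2 * cmod (h n)"
      proof (rule difference_quotient_bound)
        show "(\<lambda>t. f (p + cscale t v)) holomorphic_on ball 0 r"
          by (rule holomorphic_on_line[OF f]) (use mem[OF p] r in auto)
        show "cmod (f (p + cscale t v)) \<le> B" if "t \<in> ball 0 r" for t
          using mem[OF p, of t] that by (intro B) auto
      qed (fact r h0 h1)+
      then show ?thesis by (simp add: F_def dir_deriv_def)
    qed
    have lim0: "(\<lambda>n. 18 * B / r\<^sup>2 * cmod (h n)) \<longlonglongrightarrow> 0"
    proof -
      have "(\<lambda>n. inverse (real (Suc (n + N)))) \<longlonglongrightarrow> 0"
        using LIMSEQ_inverse_real_of_nat LIMSEQ_ignore_initial_segment by blast
      then show ?thesis unfolding h0(2) using tendsto_mult_right_zero by blast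
    qed
    have ul: "uniform_limit (ball p0 r) F (dir_deriv v f) sequentially"
    proof (rule uniform_limitI)
      fix e :: real assume "e > 0"
      with lim0 have "\<forall>\<^sub>F n in sequentially. 18 * B / r\<^sup>2 * cmod (h n) < e"
        by (simp add: order_tendstoD)
      then show "\<forall>\<^sub>F n in sequentially. \<forall>x\<in>ball p0 r. dist (F n x)
        (dir_deriv v f x) < e"
        by (rule eventually_mono) (unfold dist_norm, blast intro: order_le_less_trans err)
    qed
    have "holomorphic_several (dir_deriv v f) (ball p0 r)"
    proof (rule holomorphic_several_uniform_limit)
      show "holomorphic_several (F n) (ball p0 r)" for n
      proof -
        have mem_h: "p + cscale (h n) v \<in> S" if "p \<in> ball p0 r" for p
          using mem[OF that, of "h n"] h1[of n] r by auto
        have mem_0: "ball p0 r \<subseteq> S"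
          using r by (auto simp: subset_iff)
        have "holomorphic_several (\<lambda>p. inverse (h n) * (f (p + cscale (h n) v) - f p)) (ball p0 r)"
          by (intro holomorphic_several_cmult holomorphic_several_diff
              holomorphic_several_translate[OF f] holomorphic_several_subset[OF f])
             (use mem_h mem_0 r in auto)
        then show ?thesis by (simp add: F_def[abs_def] divide_inverse mult.commute)
      qed
      show "\<exists>\<rho>>0. cball q \<rho> \<subseteq> ball p0 r \<and>
        uniform_limit (cball q \<rho>) F (dir_deriv v f) sequentially"
        if q: "q \<in> ball p0 r" for q
      proof -
        obtain \<rho> where "\<rho> > 0" "cball q \<rho> \<subseteq> ball p0 r"
          using q open_contains_cball open_ball by blast
        then show ?thesis using ul uniform_limit_on_subset by blast
      qed
    qed
    then show ?thesis using r by blast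
  qed
  then show ?thesis
    unfolding holomorphic_several_def by (meson centre_in_ball)
qed

subsection \<open>Mixed derivatives as iterated directional derivatives\<close>

text \<open>\<open>foldr\<close> applies the last entry of the list first, so the derivatives in
  \<open>z\<close> precede those in \<open>w\<close>, and within each group the last variable comes
  first, as in \<open>mixed_deriv\<close>.\<close>

definition mixed_dirs ::
    "('r::{finite,linorder}) mindex \<Rightarrow> ('d::{finite,linorder}) mindex \<Rightarrow> ('r,
      'd) cpoint list" where
  "mixed_dirs a b =
     concat (map (\<lambda>i. replicate (a $ i) (axis i 1, 0)) (sorted_list_of_set UNIV)) @
     concat (map (\<lambda>i. replicate (b $ i) (0, axis i 1)) (sorted_list_of_set UNIV))"

lemma norm_mixed_dirs: "v \<in> set (mixed_dirs a b) \<Longrightarrow> norm v \<le> 1"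
  by (auto simp: mixed_dirs_def norm_Pair)

lemma foldr_concat_replicate:
  "foldr g (concat (map (\<lambda>i. replicate (m i) (e i)) xs)) F =
    foldr (\<lambda>i. g (e i) ^^ m i) xs F"
proof -
  have *: "foldr g (replicate n x) F = (g x ^^ n) F" for n x F
    by (induction n) auto
  show ?thesis by (induction xs) (auto simp: *)
qed

lemma partial_deriv_snd: "partial_deriv i (\<lambda>z. F (w, z)) z = dir_deriv (0, axis i 1) F (w, z)"
proof -
  have "(\<chi> j. if j = i then z $ i + t else z $ j) = z + t *s axis i 1" for t
    by (auto simp: vec_eq_iff axis_def)
  then show ?thesis
    unfolding partial_deriv_def dir_deriv_def
    by (subst deriv_shift_0) (simp add: o_def cscale_def)
qed

lemma partial_deriv_fst: "partial_deriv i (\<lambda>w. F (w, z)) w = dir_deriv (axis i 1, 0) F (w, z)"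
proof -
  have "(\<chi> j. if j = i then w $ i + t else w $ j) = w + t *s axis i 1" for t
    by (auto simp: vec_eq_iff axis_def)
  then show ?thesis
    unfolding partial_deriv_def dir_deriv_def
    by (subst deriv_shift_0) (simp add: o_def cscale_def)
qed

lemma foldr_partial_deriv_snd:
  "foldr (\<lambda>i. partial_deriv i ^^ m i) xs (\<lambda>z. F (w, z)) =
     (\<lambda>z. foldr (\<lambda>i. dir_deriv (0, axis i 1) ^^ m i) xs F (w, z))"
proof -
  have *: "(partial_deriv i ^^ n) (\<lambda>z. F (w, z)) =
    (\<lambda>z. (dir_deriv (0, axis i 1) ^^ n) F (w, z))" for i n F
    by (induction n) (auto simp: partial_deriv_snd)
  show ?thesis by (induction xs) (auto simp: *)
qed

lemma foldr_partial_deriv_fst: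
  "foldr (\<lambda>i. partial_deriv i ^^ m i) xs (\<lambda>w. F (w, z)) =
     (\<lambda>w. foldr (\<lambda>i. dir_deriv (axis i 1, 0) ^^ m i) xs F (w, z))"
proof -
  have *: "(partial_deriv i ^^ n) (\<lambda>w. F (w, z)) =
    (\<lambda>w. (dir_deriv (axis i 1, 0) ^^ n) F (w, z))" for i n F
    by (induction n) (auto simp: partial_deriv_fst)
  show ?thesis by (induction xs) (auto simp: *)
qed

text \<open>Writing all partial derivatives, in \<open>w\<close> and in \<open>z\<close>, as
  instances of one operator allows induction over the list of directions. Derivatives therefore
  never have to be interchanged.\<close>

lemma mixed_deriv_eq_foldr: "mixed_deriv a b F = foldr dir_deriv (mixed_dirs a b) F"
  unfolding mixed_deriv_def multi_deriv_def mixed_dirs_def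
  by (auto simp: fun_eq_iff foldr_concat_replicate foldr_partial_deriv_snd foldr_partial_deriv_fst)

lemma multi_deriv_zero [simp]: "multi_deriv 0 F = F"
proof -
  have "foldr (\<lambda>i. partial_deriv i ^^ ((0 :: 'n mindex) $ i)) xs F = F" for xs
    and F :: "'n::{finite,linorder} cspace \<Rightarrow> complex"
    by (induction xs) auto
  then show ?thesis by (simp add: multi_deriv_def)
qed

lemma multi_deriv_eq_mixed_deriv: "multi_deriv m (\<lambda>u. f (w, u)) z = mixed_deriv 0 m f (w, z)"
  by (simp add: mixed_deriv_def)

lemma holomorphic_several_mixed_deriv:
  assumes "holomorphic_several f S" "open S"
  shows "holomorphic_several (mixed_deriv a b f) S"
proof -
  have "holomorphic_several (foldr dir_deriv vs f) S"
    if "\<And>v. v \<in> set vs \<Longrightarrow> norm v \<le> 1" for vs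
    using that by (induction vs) (auto intro: assms holomorphic_several_dir_deriv)
  then show ?thesis by (simp add: mixed_deriv_eq_foldr norm_mixed_dirs)
qed

lemma mixed_deriv_cong:
  assumes "open S" "p \<in> S" "\<And>q. q \<in> S \<Longrightarrow> f q = g q"
  shows "mixed_deriv a b f p = mixed_deriv a b g p"
proof -
  have "\<forall>p\<in>S. foldr dir_deriv vs f p = foldr dir_deriv vs g p" for vs
    by (induction vs) (use assms in \<open>auto intro: dir_deriv_cong\<close>)
  then show ?thesis by (simp add: mixed_deriv_eq_foldr assms)
qed

lemma mixed_deriv_lincomb:
  assumes "holomorphic_several f S" "holomorphic_several g S" "open S" "p \<in> S"
  shows "mixed_deriv a b (\<lambda>p. c * f p + g p) p = c * mixed_deriv a b f p + mixed_deriv a b g p"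
proof -
  \<comment> \<open>Holomorphy of both iterated derivatives is carried through the induction,
    because \<open>dir_deriv\<close> is known to be linear only on holomorphic functions.\<close>
  have "(\<forall>p\<in>S. foldr dir_deriv vs (\<lambda>p. c * f p + g p) p =
    c * foldr dir_deriv vs f p + foldr dir_deriv vs g p) \<and>
    holomorphic_several (foldr dir_deriv vs f) S \<and> holomorphic_several (foldr dir_deriv vs g) S"
    if "\<And>v. v \<in> set vs \<Longrightarrow> norm v \<le> 1" for vs
    using that
  proof (induction vs)
    case (Cons v vs)
    then have IH: "\<forall>p\<in>S. foldr dir_deriv vs (\<lambda>p. c * f p + g p) p =
      c * foldr dir_deriv vs f p + foldr dir_deriv vs g p"
      "holomorphic_several (foldr dir_deriv vs f) S" "holomorphic_several (foldr dir_deriv vs g) S"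
        "norm v \<le> 1"
      by auto
    have "dir_deriv v (foldr dir_deriv vs (\<lambda>p. c * f p + g p)) p =
        dir_deriv v (\<lambda>p. c * foldr dir_deriv vs f p + foldr dir_deriv vs g p) p" if "p \<in>
          S" for p
      by (rule dir_deriv_cong[OF assms(3) that]) (use IH in auto)
    with IH show ?case by (auto simp: dir_deriv_lincomb intro: holomorphic_several_dir_deriv assms)
  qed (use assms in auto)
  then show ?thesis by (simp add: mixed_deriv_eq_foldr norm_mixed_dirs assms)
qed

lemma mixed_deriv_diff:
  assumes "holomorphic_several f S" "holomorphic_several g S" "open S" "p \<in> S"
  shows "mixed_deriv a b (\<lambda>p. f p - g p) p = mixed_deriv a b f p - mixed_deriv a b g p"
  using mixed_deriv_lincomb[OF assms(2,1,3,4), of a b "-1"] by simp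

section \<open>Bounds for derivatives on compact sets\<close>

lemma compact_thickening:
  fixes C :: "'a::euclidean_space set"
  assumes "compact C" "open S" "C \<subseteq> S"
  obtains e D where "e > 0" "compact D" "D \<subseteq> S" "\<And>x. x \<in> C \<Longrightarrow>
    cball x e \<subseteq> D"
proof -
  obtain e where e: "e > 0" "(\<Union>x\<in>C. cball x e) \<subseteq> S"
    using compact_subset_open_imp_cball_epsilon_subset[OF assms] by blast
  \<comment> \<open>The union of the closed balls, written as the image of a compact product under
    addition, is visibly compact.\<close>
  define D where "D = (\<lambda>(x, y). x + y) ` (C \<times> cball 0 e)"
  have "compact D"
    unfolding D_def by (intro compact_continuous_image compact_Times assms(1) compact_cball)
      (auto simp: case_prod_beta intro!: continuous_intros)
  moreover have "D = (\<Union>x\<in>C. cball x e)"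
  proof (intro set_eqI iffI)
    fix y assume "y \<in> D"
    then obtain x u where "x \<in> C" "norm u \<le> e" "y = x + u" unfolding D_def by auto
    then show "y \<in> (\<Union>x\<in>C. cball x e)" by (auto simp: dist_norm intro!: bexI[of _ x])
  next
    fix y assume "y \<in> (\<Union>x\<in>C. cball x e)"
    then obtain x where "x \<in> C" "y = x + (y - x)" "y - x \<in> cball 0 e"
      by (auto simp: dist_norm norm_minus_commute)
    then show "y \<in> D" unfolding D_def by (metis (mono_tags, lifting) SigmaI case_prod_conv image_eqI)
  qed
  ultimately show ?thesis using that[of e D] e by blast
qed

text \<open>Each directional derivative costs one thickening of the compact set and a factor
  \<open>1 / e\<close>. The order of the quantifiers matters: \<open>C'\<close> and \<open>A\<close>
  do not depend on \<open>f\<close>, so uniform smallness on compact sets passes to all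
  derivatives.\<close>

lemma mixed_deriv_bound:
  fixes C :: "('r::{finite,linorder}, 'd::{finite,linorder}) cpoint set"
  assumes "open S" "compact C" "C \<subseteq> S"
  shows "\<exists>C' A. compact C' \<and> C' \<subseteq> S \<and> A > 0 \<and>
    (\<forall>f B. holomorphic_several f S \<longrightarrow> (\<forall>q\<in>C'. cmod (f q) \<le>
      B) \<longrightarrow>
       (\<forall>p\<in>C. cmod (mixed_deriv a b f p) \<le> A * B))"
proof -
  have "\<exists>C' A. compact C' \<and> C' \<subseteq> S \<and> A > 0 \<and>
     (\<forall>f B p. holomorphic_several f S \<longrightarrow> (\<forall>q\<in>C'. cmod (f q) \<le>
       B) \<longrightarrow> p \<in> C \<longrightarrow>
       cmod (foldr dir_deriv vs f p) \<le> A * B)"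
    if "compact C" "C \<subseteq> S" "\<And>v. v \<in> set vs \<Longrightarrow> norm v \<le> 1" for vs C
    using that
  proof (induction vs arbitrary: C)
    case Nil
    then show ?case by (intro exI[of _ C] exI[of _ "1::real"]) auto
  next
    case (Cons v vs)
    obtain e D where e: "e > 0" and D: "compact D" "D \<subseteq> S"
      and sub: "\<And>x. x \<in> C \<Longrightarrow> cball x e \<subseteq> D"
      using compact_thickening[OF Cons.prems(1) assms(1) Cons.prems(2)] by blast
    then obtain C' A where C': "compact C'" "C' \<subseteq> S" "A > 0"
      and *: "\<And>f B p. \<lbrakk>holomorphic_several f S; \<forall>q\<in>C'. cmod (f q) \<le>
        B; p \<in> D\<rbrakk> \<Longrightarrow>
         cmod (foldr dir_deriv vs f p) \<le> A * B"
      using Cons.IH[of D] Cons.prems(3) by auto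
    have "cmod (foldr dir_deriv (v # vs) f p) \<le> (A / e) * B"
      if f: "holomorphic_several f S" and B: "\<forall>q\<in>C'. cmod (f q) \<le> B"
        and p: "p \<in> C" for f B p
    proof -
      have hol: "holomorphic_several (foldr dir_deriv vs f) S"
        using Cons.prems(3) by (induction vs) (auto intro: f assms holomorphic_several_dir_deriv)
      have "cmod (dir_deriv v (foldr dir_deriv vs f) p) \<le> (A * B) / e"
      proof (rule Cauchy_estimate[OF hol e])
        show "cball p e \<subseteq> S" using sub[OF p] D(2) by blast
        show "norm v \<le> 1" using Cons.prems(3) by simp
        show "cmod (foldr dir_deriv vs f q) \<le> A * B" if "q \<in> cball p e" for q
          using *[OF f B] sub[OF p] that by blast
      qed
      then show ?thesis by simp
    qed
    then show ?case using C' e by (intro exI[of _ C'] exI[of _ "A / e"]) auto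
  qed
  from this[OF assms(2,3), of "mixed_dirs a b"] norm_mixed_dirs show ?thesis
    unfolding mixed_deriv_eq_foldr[symmetric] by metis
qed

subsection \<open>Uniformly closed function algebras\<close>

text \<open>Stands for the uniform limits of polynomials on a compact \<open>X\<close>. Pushing
  poles uses only closure properties of this kind, and since members may depend on all coordinates
  of \<open>x\<close>, Runge's theorem is obtained with parameters.\<close>

locale closed_function_algebra =
  fixes X :: "'a::metric_space set" and C :: "('a \<Rightarrow> complex) set"
  assumes const: "(\<lambda>_. c) \<in> C"
    and add: "\<lbrakk>f \<in> C; g \<in> C\<rbrakk> \<Longrightarrow> (\<lambda>x. f x + g x) \<in> C"
    and mult: "\<lbrakk>f \<in> C; g \<in> C\<rbrakk> \<Longrightarrow> (\<lambda>x. f x * g x) \<in> C"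
    and bounded: "f \<in> C \<Longrightarrow> bounded (f ` X)"
    and uniformly_closed: "(\<And>e::real. e > 0 \<Longrightarrow> \<exists>g\<in>C.
      \<forall>x\<in>X. cmod (f x - g x) \<le> e) \<Longrightarrow> f \<in> C"
begin

lemma cong: "f \<in> C \<Longrightarrow> (\<And>x. x \<in> X \<Longrightarrow> f x = g x) \<Longrightarrow>
  g \<in> C"
  by (rule uniformly_closed) (auto intro!: bexI[of _ f])

lemma cmult: "f \<in> C \<Longrightarrow> (\<lambda>x. c * f x) \<in> C"
  by (rule mult[OF const])

lemma power: "f \<in> C \<Longrightarrow> (\<lambda>x. f x ^ n) \<in> C"
  by (induction n) (auto intro: const mult)

lemma sum: "(\<And>i. i \<in> I \<Longrightarrow> f i \<in> C) \<Longrightarrow>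
  (\<lambda>x. \<Sum>i\<in>I. f i x) \<in> C"
  by (induction I rule: infinite_finite_induct) (auto intro: const add)

lemma sum_list: "(\<And>i. i \<in> set xs \<Longrightarrow> f i \<in> C) \<Longrightarrow>
  (\<lambda>x. \<Sum>i\<leftarrow>xs. f i x) \<in> C"
  by (induction xs) (auto intro: const add)

text \<open>Geometric series: the tail after \<open>n\<close> terms is
  \<open>u x ^ n / (1 - u x)\<close>, at most twice \<open>(1/2) ^ n\<close>.\<close>

lemma inverse_one_minus:
  assumes u: "u \<in> C" and small: "\<And>x. x \<in> X \<Longrightarrow> cmod (u x) \<le> 1/2"
  shows "(\<lambda>x. 1 / (1 - u x)) \<in> C"
proof (rule uniformly_closed)
  fix e :: real assume e: "e > 0"
  obtain n where n: "(1/2) ^ n < e / 2"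
    using real_arch_pow_inv[of "e/2" "1/2"] e by auto
  have "cmod (1 / (1 - u x) - (\<Sum>k<n. u x ^ k)) \<le> e" if x: "x \<in> X" for x
  proof -
    have "1 = cmod (1 - u x + u x)" by simp
    also have "\<dots> \<le> cmod (1 - u x) + cmod (u x)" by (rule norm_triangle_ineq)
    finally have ge: "cmod (1 - u x) \<ge> 1/2" using small[OF x] by simp
    then have ne: "1 - u x \<noteq> 0" "u x \<noteq> 1" by auto
    have "1 / (1 - u x) - (\<Sum>k<n. u x ^ k) = u x ^ n / (1 - u x)"
    proof -
      have "(\<Sum>k<n. u x ^ k) = (1 - u x ^ n) / (1 - u x)"
        using ne(2) by (simp add: sum_gp_strict)
      then show ?thesis using ne(1) by (simp add: diff_divide_distrib)
    qed
    then have "cmod (1 / (1 - u x) - (\<Sum>k<n. u x ^ k)) = cmod (u x) ^ n / cmod (1 - u x)"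
      by (simp add: norm_divide norm_power)
    also have "\<dots> \<le> (1/2) ^ n / (1/2)"
      by (intro frac_le power_mono small x ge) auto
    also have "\<dots> \<le> e" using n by simp
    finally show ?thesis .
  qed
  moreover have "(\<lambda>x. \<Sum>k<n. u x ^ k) \<in> C"
    by (intro sum power u)
  ultimately show "\<exists>g\<in>C. \<forall>x\<in>X. cmod (1 / (1 - u x) - g x) \<le> e"
    by (intro bexI[of _ "\<lambda>x. \<Sum>k<n. u x ^ k"]) auto
qed

text \<open>Factor \<open>b - p x = (a - p x) * (1 - (a - b) / (a - p x))\<close>; the quotient has
  modulus at most 1/2, so the second factor is inverted by the geometric series.\<close>

lemma pole_step:
  assumes p: "p \<in> C" and a: "(\<lambda>x. 1 / (a - p x)) \<in> C"
    and ab: "\<And>x. x \<in> X \<Longrightarrow> a \<noteq> p x \<and> 2 * cmod (b - a) \<le>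
      cmod (a - p x)"
  shows "(\<lambda>x. 1 / (b - p x)) \<in> C"
proof -
  have "(\<lambda>x. 1 / (1 - (a - b) * (1 / (a - p x)))) \<in> C"
  proof (rule inverse_one_minus)
    show "(\<lambda>x. (a - b) * (1 / (a - p x))) \<in> C" by (rule cmult[OF a])
    show "cmod ((a - b) * (1 / (a - p x))) \<le> 1/2" if "x \<in> X" for x
      using ab[OF that] by (simp add: norm_mult norm_divide norm_minus_commute divide_le_eq)
  qed
  from mult[OF a this] show ?thesis
  proof (rule cong)
    fix x assume x: "x \<in> X"
    then have "a - p x \<noteq> 0" using ab by auto
    then have "(a - p x) * ((a - b) * (1 / (a - p x))) = a - b"
      by simp
    then have "(a - p x) * (1 - (a - b) * (1 / (a - p x))) = b - p x"
      by (simp only: right_diff_distrib[of _ 1]) simp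
    then show "1 / (a - p x) * (1 / (1 - (a - b) * (1 / (a - p x)))) = 1 / (b - p x)"
      by (metis mult.right_neutral times_divide_times_eq)
  qed
qed

text \<open>A pole far from \<open>K\<close> is harmless. A pole can be moved by half its distance
  to \<open>K\<close>, and connectedness of \<open>- K\<close> leads from the far pole to any
  \<open>b\<close>.\<close>

lemma pole:
  assumes p: "p \<in> C" "p ` X \<subseteq> K" and K: "compact K" "connected (- K)" and b: "b \<notin> K"
  shows "(\<lambda>x. 1 / (b - p x)) \<in> C"
proof -
  obtain R where R: "R > 0" "\<And>z. z \<in> K \<Longrightarrow> cmod z \<le> R"
    using compact_imp_bounded[OF K(1)] bounded_pos by metis
  \<comment> \<open>Modulus \<open>2 * R\<close> gives \<open>p x / a0\<close> modulus at most 1/2,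
    as the geometric series requires.\<close>
  define a0 where "a0 = complex_of_real (2 * R)"
  have a0: "cmod a0 = 2 * R" "a0 \<noteq> 0" using R by (auto simp: a0_def)
  define P where "P a \<longleftrightarrow> (\<lambda>x. 1 / (a - p x)) \<in> C" for a
  have "P a0"
  proof -
    have "(\<lambda>x. 1 / (1 - (1 / a0) * p x)) \<in> C"
    proof (rule inverse_one_minus)
      show "cmod (1 / a0 * p x) \<le> 1/2" if "x \<in> X" for x
        using R(2)[of "p x"] p(2) that R(1) a0 by (auto simp: norm_mult norm_divide divide_le_eq)
    qed (intro cmult p)
    from cmult[OF this, of "1 / a0"] show ?thesis
      unfolding P_def
    proof (rule cong)
      fix x
      have "a0 * (1 - 1 / a0 * p x) = a0 - p x" using a0 by (simp add: right_diff_distrib)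
      then show "1 / a0 * (1 / (1 - 1 / a0 * p x)) = 1 / (a0 - p x)"
        by (metis mult.right_neutral times_divide_times_eq)
    qed
  qed
  have step: "P a'" if "P a" "a \<notin> K" "2 * dist a' a \<le> infdist a K" for a a'
    unfolding P_def
  proof (rule pole_step[OF p(1)])
    fix x assume "x \<in> X"
    then have "p x \<in> K" using p by auto
    then show "a \<noteq> p x \<and> 2 * cmod (a' - a) \<le> cmod (a - p x)"
      using that(2,3) infdist_le[of "p x" K a] by (auto simp: dist_norm)
  qed (use that P_def in auto)
  show ?thesis
  proof (cases "K = {}")
    \<comment> \<open>\<open>infdist\<close> to the empty set is 0 by convention, so no step would
      be possible; but then \<open>X\<close> is empty and every function is a member.\<close>
    case True
    then have "X = {}" using p(2) by auto
    then show ?thesis by (intro uniformly_closed bexI[OF _ const[of 0]]) auto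
  next
    case False
    have pos: "infdist a K > 0" if "a \<notin> K" for a
      using that K(1) False by (simp add: compact_imp_closed infdist_pos_not_in_closed)
    \<comment> \<open>A point \<open>x\<close> within a quarter of \<open>infdist a K\<close> from
      \<open>a\<close> still has at least three quarters of that distance to \<open>K\<close>. Hence
      the step is allowed in both directions, and membership is locally constant on
      \<open>- K\<close>.\<close>
    have nbhd: "\<exists>T. open T \<and> a \<in> T \<and> (\<forall>x\<in>T \<inter> - K. P x =
      P a)" if a: "a \<in> - K" for a
    proof (intro exI[of _ "ball a (infdist a K / 4)"] conjI ballI)
      show "a \<in> ball a (infdist a K / 4)" using pos a by auto
      fix x assume x: "x \<in> ball a (infdist a K / 4) \<inter> - K"
      then have 1: "dist a x < infdist a K / 4" by auto
      have "infdist a K \<le> infdist x K + dist a x" by (rule infdist_triangle)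
      then show "P x = P a"
        using step[of a x] step[of x a] 1 a x infdist_nonneg[of a K] by (auto simp: dist_commute)
    qed simp
    have "P b = P a0"
    proof (rule connected_induction_simple[OF K(2), where P="\<lambda>x. P x = P a0"])
      show "\<exists>T. openin (top_of_set (- K)) T \<and> a \<in> T \<and>
        (\<forall>x\<in>T. \<forall>y\<in>T. (P x = P a0) \<longrightarrow> (P y = P a0))"
        if a: "a \<in> - K" for a
      proof -
        obtain T where T: "open T" "a \<in> T" "\<forall>x\<in>T \<inter> - K. P x = P a"
          using nbhd[OF a] by blast
        show ?thesis
        proof (intro exI[of _ "- K \<inter> T"] conjI)
          show "openin (top_of_set (- K)) (- K \<inter> T)" by (rule openin_open_Int[OF T(1)])
        qed (use a T in blast)+
      qed
      show "a0 \<in> - K" using R a0 by force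
    qed (use b in auto)
    with \<open>P a0\<close> show ?thesis by (simp add: P_def)
  qed
qed

end

section \<open>Integrals of families in a closed function algebra\<close>

lemma Riemann_sum_bound:
  fixes f :: "real \<Rightarrow> complex"
  assumes cont: "continuous_on {0..1} f" and n: "n > 0"
    and mod: "\<And>s t. \<lbrakk>s \<in> {0..1}; t \<in> {0..1}; \<bar>s - t\<bar> \<le>
      1 / real n\<rbrakk> \<Longrightarrow> cmod (f s - f t) \<le> e"
  shows "cmod (integral {0..1} f - (\<Sum>k<n. f (real k / real n) / of_nat n)) \<le> e"
proof -
  have "cmod (integral {0..real m / real n} f - (\<Sum>k<m. f (real k / real n) / of_nat n)) \<le>
    real m / real n * e"
    if "m \<le> n" for m
    using that
  proof (induction m)
    case (Suc m)
    define a b where "a = real m / real n" and "b = real (Suc m) / real n"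
    have ab: "0 \<le> a" "a \<le> b" "b \<le> 1" "b - a = 1 / real n"
      using Suc.prems n by (auto simp: a_def b_def divide_simps)
    have int: "f integrable_on {s..t}" if "0 \<le> s" "t \<le> 1" for s t
      by (rule integrable_continuous_interval, rule continuous_on_subset[OF cont]) (use that in auto)
    have "integral {0..b} f = integral {0..a} f + integral {a..b} f"
      using Henstock_Kurzweil_Integration.integral_combine[OF ab(1,2), of f] int[of 0 b] ab by simp
    moreover have "cmod (integral {a..b} f - f a / of_nat n) \<le> e / real n"
    proof -
      have "integral {a..b} (\<lambda>t. f t - f a) = integral {a..b} f - integral {a..b} (\<lambda>_. f a)"
        by (rule Henstock_Kurzweil_Integration.integral_diff) (use int ab in auto)
      also have "integral {a..b} (\<lambda>_. f a) = f a / of_nat n"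
        using ab by (simp add: scaleR_conv_of_real)
      finally have "cmod (integral {a..b} f - f a / of_nat n) =
        cmod (integral {a..b} (\<lambda>t. f t - f a))"
        by simp
      also have "\<dots> \<le> e * (b - a)"
      proof (rule integral_bound)
        show "continuous_on {a..b} (\<lambda>t. f t - f a)"
          by (intro continuous_intros continuous_on_subset[OF cont]) (use ab in auto)
        show "cmod (f t - f a) \<le> e" if "t \<in> {a..b}" for t
          by (rule mod) (use that ab in auto)
      qed (use ab in auto)
      finally show ?thesis using ab by simp
    qed
    moreover have "cmod (integral {0..a} f - (\<Sum>k<m. f (real k / real n) / of_nat n)) \<le>
      real m / real n * e"
      using Suc by (simp add: a_def)
    ultimately have "cmod (integral {0..b} f - ((\<Sum>k<m. f (real k / real n) / of_nat n) + f a /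
      of_nat n))
        \<le> real m / real n * e + e / real n"
      using norm_triangle_ineq[of "integral {0..a} f - (\<Sum>k<m. f (real k / real n) / of_nat n)"
        "integral {a..b} f - f a / of_nat n"]
      by (simp add: algebra_simps)
    moreover have "real m / real n * e + e / real n = b * e"
      by (simp add: b_def add_divide_distrib distrib_right)
    ultimately show ?case unfolding sum.lessThan_Suc a_def[symmetric] b_def[symmetric] by (simp only:)
  qed simp
  from this[of n] show ?thesis using n by simp
qed

text \<open>Uniform continuity on the compact product makes one mesh size work for all
  \<open>x\<close>, so the integral is a uniform limit of Riemann sums, which are finite linear
  combinations of members.\<close>

lemma (in closed_function_algebra) integral:
  assumes C: "\<And>t. t \<in> {0..1} \<Longrightarrow> \<psi> t \<in> C"
    and cont: "continuous_on ({0..1::real} \<times> X) (\<lambda>(t, x). \<psi> t x)" and X: "compact X"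
  shows "(\<lambda>x. integral {0..1} (\<lambda>t. \<psi> t x)) \<in> C"
proof (rule uniformly_closed)
  fix e :: real assume e: "e > 0"
  have "uniformly_continuous_on ({0..1} \<times> X) (\<lambda>(t, x). \<psi> t x)"
    by (intro compact_uniformly_continuous cont compact_Times X) auto
  then obtain d where d: "d > 0" "\<And>p q. \<lbrakk>p \<in> {0..1} \<times> X; q \<in> {0..1}
    \<times> X; dist q p < d\<rbrakk> \<Longrightarrow>
      dist ((\<lambda>(t, x). \<psi> t x) q) ((\<lambda>(t, x). \<psi> t x) p) < e"
    unfolding uniformly_continuous_on_def using e by metis
  obtain n where n: "n > 0" "1 / real n < d"
    using reals_Archimedean[OF d(1)] by (metis inverse_eq_divide zero_less_Suc)
  have "cmod (integral {0..1} (\<lambda>t. \<psi> t x) - (\<Sum>k<n. \<psi> (real k / real n) x /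
    of_nat n)) \<le> e" if x: "x \<in> X" for x
  proof (rule Riemann_sum_bound[OF _ n(1)])
    show "continuous_on {0..1} (\<lambda>t. \<psi> t x)"
    proof -
      have "continuous_on {0..1} (\<lambda>t. (\<lambda>(t, x). \<psi> t x) (t, x))"
        by (rule continuous_on_compose2[OF cont]) (use x in \<open>auto intro!: continuous_intros\<close>)
      then show ?thesis by simp
    qed
    show "cmod (\<psi> s x - \<psi> t x) \<le> e"
      if "s \<in> {0..1}" "t \<in> {0..1}" "\<bar>s - t\<bar> \<le> 1 / real n" for s t
      using d(2)[of "(t, x)" "(s, x)"] that x n by (auto simp: dist_Pair_Pair dist_norm)
  qed
  moreover have "(\<lambda>x. \<Sum>k<n. \<psi> (real k / real n) x / of_nat n) \<in> C"
  proof (rule sum)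
    fix k assume "k \<in> {..<n}"
    then have "\<psi> (real k / real n) \<in> C" by (intro C) (auto simp: divide_le_eq)
    from cmult[OF this, of "1 / of_nat n"] show "(\<lambda>x. \<psi> (real k / real n) x / of_nat n)
      \<in> C" by simp
  qed
  ultimately show "\<exists>g\<in>C. \<forall>x\<in>X. cmod (integral {0..1} (\<lambda>t. \<psi> t
    x) - g x) \<le> e"
    by (intro bexI[of _ "\<lambda>x. \<Sum>k<n. \<psi> (real k / real n) x / of_nat n"] ballI)
qed

subsection \<open>Cauchy's formula on a grid\<close>

text \<open>The terms over \<open>A \<inter> B\<close> cancel; in the grid these belong to the edges
  shared by two squares.\<close>

lemma sum_minus_sum:
  fixes f :: "'b \<Rightarrow> 'c::ab_group_add"
  assumes "finite A" "finite B"
  shows "sum f A - sum f B = sum f (A - B) - sum f (B - A)"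
  using sum.Int_Diff[OF assms(1), of f B] sum.Int_Diff[OF assms(2), of f A]
  by (simp add: Int_commute)

lemma isCont_Cauchy_transform_linepath:
  assumes f: "continuous_on (closed_segment a b) f" and z: "z \<notin> closed_segment a b"
  shows "isCont (\<lambda>y. contour_integral (linepath a b) (\<lambda>\<zeta>. f \<zeta> / (\<zeta>
    - y))) z"
proof -
  have "((\<lambda>y. contour_integral (linepath a b) (\<lambda>\<zeta>. f \<zeta> / (\<zeta> - y)))
    has_field_derivative
      of_nat 1 * contour_integral (linepath a b) (\<lambda>u. f u / (u - z) ^ Suc 1)) (at z)"
  proof (rule Cauchy_next_derivative(2)[where S = UNIV and B = "cmod (b - a)"])
    show "((\<lambda>u. f u / (u - w) ^ 1) has_contour_integral
         contour_integral (linepath a b) (\<lambda>\<zeta>. f \<zeta> / (\<zeta> - w))) (linepath a b)"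
      if "w \<in> UNIV - path_image (linepath a b)" for w
    proof -
      have "(\<lambda>\<zeta>. f \<zeta> / (\<zeta> - w)) contour_integrable_on linepath a b"
        by (rule contour_integrable_continuous_linepath) (use that in \<open>auto intro!:
          continuous_intros f\<close>)
      then show ?thesis by (simp add: has_contour_integral_integral)
    qed
  qed (use f z in auto)
  then show ?thesis by (rule DERIV_isCont)
qed

text \<open>The upper and left edges are traversed in the positive coordinate direction and
  subtracted. An edge common to two neighbouring squares is then the same segment for both, with
  opposite signs.\<close>

lemma contour_integral_rectpath:
  assumes "continuous_on (path_image (rectpath a c)) f" "Re a \<le> Re c" "Im a \<le> Im c"
  shows "contour_integral (rectpath a c) f =
    contour_integral (linepath a (Complex (Re c) (Im a))) f +
    contour_integral (linepath (Complex (Re c) (Im a)) c) f -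
    contour_integral (linepath (Complex (Re a) (Im c)) c) f -
    contour_integral (linepath a (Complex (Re a) (Im c))) f"
proof -
  define b d where "b = Complex (Re c) (Im a)" and "d = Complex (Re a) (Im c)"
  have img: "path_image (rectpath a c) = closed_segment a b \<union> closed_segment b c \<union>
    closed_segment c d \<union> closed_segment d a"
    by (auto simp: rectpath_def Let_def path_image_join b_def d_def)
  have c: "continuous_on (closed_segment a b) f" "continuous_on (closed_segment b c) f"
    "continuous_on (closed_segment c d) f" "continuous_on (closed_segment d a) f"
    by (rule continuous_on_subset[OF assms(1)], use img in blast)+
  note i = c[THEN contour_integrable_continuous_linepath]
  have "contour_integral (rectpath a c) f = contour_integral (linepath a b) f + (contour_integral
    (linepath b c) f +
     (contour_integral (linepath c d) f + contour_integral (linepath d a) f))"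
    unfolding rectpath_def Let_def b_def[symmetric] d_def[symmetric]
    using i by (simp add: contour_integral_join valid_path_join)
  moreover have "contour_integral (linepath c d) f = - contour_integral (linepath d c) f"
    by (rule contour_integral_reverse_linepath[OF c(3)])
  moreover have "contour_integral (linepath d a) f = - contour_integral (linepath a d) f"
    by (rule contour_integral_reverse_linepath[OF c(4)])
  ultimately show ?thesis by (simp add: b_def d_def)
qed

text \<open>
  Summing Cauchy's formula over the grid squares that meet \<open>K\<close>, every edge that meets
    \<open>K\<close> belongs
  to two such squares and cancels. Points of \<open>K\<close> on grid lines are reached by continuity.
\<close>

lemma Cauchy_formula_segments:
  assumes K: "compact K" and U: "open U" "K \<subseteq> U"
  obtains ps where "\<And>c a b. (c, a, b) \<in> set ps \<Longrightarrow> closed_segment a b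
    \<subseteq> U - K"
    "\<And>f z. \<lbrakk>f holomorphic_on U; z \<in> K\<rbrakk> \<Longrightarrow>
      f z = (\<Sum>(c, a, b)\<leftarrow>ps. c * contour_integral (linepath a b) (\<lambda>\<zeta>. f
        \<zeta> / (\<zeta> - z)))"
proof -
  obtain e where e: "e > 0" "(\<Union>x\<in>K. cball x e) \<subseteq> U"
    using compact_subset_open_imp_cball_epsilon_subset[OF K U] by blast
  \<comment> \<open>Two points of a closed square differ by at most \<open>d\<close> in each
    coordinate, hence by at most \<open>d + d = e\<close>; so a square that meets \<open>K\<close>
    lies in \<open>U\<close>.\<close>
  define d where "d = e / 2"
  have d: "d > 0" using e by (simp add: d_def)
  define g where "g j k = Complex (of_int j * d) (of_int k * d)" for j k :: int
  define Sq where "Sq p = cbox (g (fst p) (snd p)) (g (fst p + 1) (snd p + 1))" for p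
  define Bx where "Bx p = box (g (fst p) (snd p)) (g (fst p + 1) (snd p + 1))" for p
  define F where "F = {p. Sq p \<inter> K \<noteq> {}}"
  have in_Sq: "z \<in> Sq (j, k) \<longleftrightarrow> of_int j * d \<le> Re z \<and> Re z \<le>
    (of_int j + 1) * d \<and>
      of_int k * d \<le> Im z \<and> Im z \<le> (of_int k + 1) * d" for z j k
    by (auto simp: Sq_def g_def in_cbox_complex_iff)
  have in_Bx: "z \<in> Bx (j, k) \<longleftrightarrow> of_int j * d < Re z \<and> Re z <
    (of_int j + 1) * d \<and>
      of_int k * d < Im z \<and> Im z < (of_int k + 1) * d" for z j k
    by (auto simp: Bx_def g_def in_box_complex_iff)
  have F_U: "Sq p \<subseteq> U" if pF: "p \<in> F" for p
  proof
    fix y assume y: "y \<in> Sq p"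
    obtain x where x: "x \<in> Sq p" "x \<in> K" using pF unfolding F_def by blast
    obtain j k where p: "p = (j, k)" by force
    have "cmod (x - y) \<le> \<bar>Re (x - y)\<bar> + \<bar>Im (x - y)\<bar>" by (rule cmod_le)
    also have "\<dots> \<le> d + d"
      using x(1) y unfolding p in_Sq by (intro add_mono) (auto simp: algebra_simps abs_le_iff)
    finally have "dist x y \<le> e" by (simp add: dist_norm d_def)
    then have "y \<in> cball x e" by simp
    then show "y \<in> U" using e(2) x(2) by blast
  qed
  have finF: "finite F"
  proof -
    obtain R where R: "\<And>z. z \<in> K \<Longrightarrow> cmod z \<le> R"
      using compact_imp_bounded[OF K] bounded_pos by metis
    define n where "n = \<lceil>R / d\<rceil> + 1"
    have *: "i \<in> {-n..n}" if "of_int i * d \<le> x" "x \<le> (of_int i + 1) * d" "\<bar>x\<bar> \<le>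
      R" for i x
    proof -
      have "of_int i * d \<le> R" "- R \<le> (of_int i + 1) * d" using that by auto
      then have "of_int i \<le> R / d" "- (R / d) \<le> of_int i + 1" using d by (auto simp: field_simps)
      then show ?thesis unfolding n_def by (simp add: ceiling_le_iff) linarith
    qed
    have "F \<subseteq> {-n..n} \<times> {-n..n}"
    proof
      fix p assume "p \<in> F"
      then obtain x where x: "x \<in> Sq p" "x \<in> K" unfolding F_def by blast
      obtain j k where p: "p = (j, k)" by force
      have "\<bar>Re x\<bar> \<le> R" "\<bar>Im x\<bar> \<le> R"
        using R[OF x(2)] abs_Re_le_cmod[of x] abs_Im_le_cmod[of x] by auto
      then show "p \<in> {-n..n} \<times> {-n..n}" using *[of j "Re x"] *[of k "Im x"] x(1)
        unfolding p in_Sq by auto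
    qed
    then show ?thesis by (rule finite_subset) auto
  qed
  \<comment> \<open>Only the lower edge \<open>hs p\<close> and the left edge \<open>vs p\<close> of
    a square get names; its upper edge is \<open>hs (up p)\<close> and its right edge is
    \<open>vs (rt p)\<close>.\<close>
  define hs where "hs p = (g (fst p) (snd p), g (fst p + 1) (snd p))" for p
  define vs where "vs p = (g (fst p) (snd p), g (fst p) (snd p + 1))" for p
  define up where "up p = (fst p, snd p + 1)" for p :: "int \<times> int"
  define rt where "rt p = (fst p + 1, snd p)" for p :: "int \<times> int"
  have cvx: "closed_segment a b \<subseteq> Sq p" if "a \<in> Sq p" "b \<in> Sq p" for a b p
    using that by (intro closed_segment_subset) (auto simp: Sq_def convex_box)
  have hsub: "closed_segment (fst (hs p)) (snd (hs p)) \<subseteq> Sq p"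
             "closed_segment (fst (hs (up p))) (snd (hs (up p))) \<subseteq> Sq p"
             "closed_segment (fst (vs p)) (snd (vs p)) \<subseteq> Sq p"
             "closed_segment (fst (vs (rt p))) (snd (vs (rt p))) \<subseteq> Sq p" for p
    using d by (cases p; intro cvx; simp add: in_Sq hs_def vs_def up_def rt_def g_def algebra_simps)+
  have surj: "\<exists>q. p = up q" "\<exists>q. p = rt q" for p
    using exI[of "\<lambda>q. p = up q" "(fst p, snd p - 1)"] exI[of "\<lambda>q. p =
      rt q" "(fst p - 1, snd p)"]
    by (simp_all add: up_def rt_def)
  have inj: "inj up" "inj rt"
    by (auto simp: inj_def up_def rt_def prod_eq_iff)
  have disj: "Sq p \<inter> K = {}" if "p \<notin> F" for p using that by (auto simp: F_def)
  \<comment> \<open>An edge that survives cancellation lies in two closed squares, exactly one of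
    which is in \<open>F\<close>. That one puts the edge inside \<open>U\<close>, the other one
    keeps it off \<open>K\<close>.\<close>
  have good_h: "closed_segment (fst (hs p)) (snd (hs p)) \<subseteq> U - K"
    if p: "p \<in> (F - up ` F) \<union> (up ` F - F)" for p
  proof -
    obtain q where q: "p = up q" using surj by blast
    have "q \<in> F \<longleftrightarrow> p \<in> up ` F" using inj q by (simp add: inj_image_mem_iff)
    with p consider "p \<in> F" "q \<notin> F" | "p \<notin> F" "q \<in> F" by blast
    then show ?thesis
    proof cases
      case 1
      then show ?thesis using hsub(1)[of p] hsub(2)[of q, folded q] F_U[OF 1(1)] disj[OF 1(2)] by blast
    next
      case 2
      then show ?thesis using hsub(1)[of p] hsub(2)[of q, folded q] F_U[OF 2(2)] disj[OF 2(1)] by blast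
    qed
  qed
  have good_v: "closed_segment (fst (vs p)) (snd (vs p)) \<subseteq> U - K"
    if p: "p \<in> (F - rt ` F) \<union> (rt ` F - F)" for p
  proof -
    obtain q where q: "p = rt q" using surj by blast
    have "q \<in> F \<longleftrightarrow> p \<in> rt ` F" using inj q by (simp add: inj_image_mem_iff)
    with p consider "p \<in> F" "q \<notin> F" | "p \<notin> F" "q \<in> F" by blast
    then show ?thesis
    proof cases
      case 1
      then show ?thesis using hsub(3)[of p] hsub(4)[of q, folded q] F_U[OF 1(1)] disj[OF 1(2)] by blast
    next
      case 2
      then show ?thesis using hsub(3)[of p] hsub(4)[of q, folded q] F_U[OF 2(2)] disj[OF 2(1)] by blast
    qed
  qed
  have fin: "finite (F - up ` F)" "finite (up ` F - F)" "finite (rt ` F - F)" "finite (F - rt ` F)"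
    using finF by auto
  obtain A1 A2 B1 B2 where lists: "set A1 = F - up ` F" "distinct A1" "set A2 = up ` F - F" "distinct A2"
     "set B1 = rt ` F - F" "distinct B1" "set B2 = F - rt ` F" "distinct B2"
    using finite_distinct_list[OF fin(1)] finite_distinct_list[OF fin(2)]
      finite_distinct_list[OF fin(3)] finite_distinct_list[OF fin(4)] by metis
  define w where "w = 1 / (2 * of_real pi * \<i>)"
  \<comment> \<open>Signs of the surviving edges: lower edges (\<open>A1\<close>) and right edges
    (\<open>B1\<close>) count positively, upper edges (\<open>A2\<close>) and left edges
    (\<open>B2\<close>) negatively.\<close>
  define ps where "ps = map (\<lambda>p. (w, hs p)) A1 @ map (\<lambda>p. (- w, hs p)) A2 @ map
    (\<lambda>p. (w, vs p)) B1 @ map (\<lambda>p. (- w, vs p)) B2"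
  have ps_good: "closed_segment a b \<subseteq> U - K" if "(c, a, b) \<in> set ps" for c a b
  proof -
    have "(\<exists>p \<in> (F - up ` F) \<union> (up ` F - F). (a, b) = hs p) \<or>
      (\<exists>p \<in> (F - rt ` F) \<union> (rt ` F - F). (a, b) = vs p)"
      using that unfolding ps_def lists(1,3,5,7)[symmetric] by auto
    then show ?thesis using good_h good_v by (metis fst_conv snd_conv)
  qed
  define T where "T f y = (\<Sum>(c, a, b)\<leftarrow>ps. c * contour_integral (linepath a b)
    (\<lambda>\<zeta>. f \<zeta> / (\<zeta> - y)))" for f y
  \<comment> \<open>A point of an open square lies on no edge. Only the square around
    \<open>y\<close> contributes, with winding number 1; on every other square the integrand is
    holomorphic.\<close>
  have formula: "f y = T f y" if f: "f holomorphic_on U" and q: "q \<in> F" and y: "y \<in> Bx q" for f y q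
  proof -
    define J where "J s = contour_integral (linepath (fst s) (snd s)) (\<lambda>\<zeta>. f \<zeta> /
      (\<zeta> - y))" for s
    define RP where "RP p = rectpath (g (fst p) (snd p)) (g (fst p + 1) (snd p + 1))" for p
    have leg: "Re (g (fst p) (snd p)) \<le> Re (g (fst p + 1) (snd p + 1))" "Im (g (fst p) (snd p)) \<le>
      Im (g (fst p + 1) (snd p + 1))" for p
      using d by (auto simp: g_def algebra_simps)
    have RP_sub: "path_image (RP p) \<subseteq> Sq p" for p
      unfolding RP_def Sq_def by (rule path_image_rectpath_subset_cbox[OF leg])
    have y_notin: "y \<notin> Sq p" if "p \<noteq> q" for p
    proof
      assume "y \<in> Sq p"
      obtain j k j' k' where pq: "p = (j, k)" "q = (j', k')" by fastforce
      have "of_int j * d < (of_int j' + 1) * d" "of_int j' * d < (of_int j + 1) * d"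
           "of_int k * d < (of_int k' + 1) * d" "of_int k' * d < (of_int k + 1) * d"
        using y \<open>y \<in> Sq p\<close> unfolding pq in_Sq in_Bx by linarith+
      then have "j = j'" "k = k'" using d by (simp_all add: mult_less_cancel_right)
      with that pq show False by simp
    qed
    have y_path: "y \<notin> path_image (RP p)" for p
    proof (cases "p = q")
      case True
      then show ?thesis using y path_image_rectpath_inter_box[OF leg[of q]] unfolding RP_def Bx_def by blast
    next
      case False then show ?thesis using y_notin RP_sub by blast
    qed
    have fhol: "f holomorphic_on Sq p" if "p \<in> F" for p
      using f F_U[OF that] holomorphic_on_subset by blast
    have int: "contour_integral (RP p) (\<lambda>\<zeta>. f \<zeta> / (\<zeta> - y)) = (if p =
      q then 2 * pi * \<i> * f y else 0)" if p: "p \<in> F" for p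
    proof (cases "p = q")
      case True
      have "((\<lambda>\<zeta>. f \<zeta> / (\<zeta> - y)) has_contour_integral (2 * pi * \<i> *
        winding_number (RP p) y * f y)) (RP p)"
      proof (rule Cauchy_integral_formula_convex_simple[OF _ fhol[OF p]])
        show "convex (Sq p)" by (simp add: Sq_def convex_box)
        show "y \<in> interior (Sq p)" using y True by (simp add: Sq_def Bx_def interior_cbox)
        show "path_image (RP p) \<subseteq> Sq p - {y}" using RP_sub y_path by blast
      qed (auto simp: RP_def)
      moreover have "winding_number (RP p) y = 1"
        unfolding RP_def by (rule winding_number_rectpath) (use y True in \<open>simp add: Bx_def\<close>)
      ultimately show ?thesis using True by (simp add: contour_integral_unique)
    next
      case False
      have "((\<lambda>\<zeta>. f \<zeta> / (\<zeta> - y)) has_contour_integral 0) (RP p)"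
      proof (rule Cauchy_theorem_convex_simple)
        show "(\<lambda>\<zeta>. f \<zeta> / (\<zeta> - y)) holomorphic_on Sq p"
          using y_notin[OF False] by (intro holomorphic_intros fhol p) auto
        show "convex (Sq p)" by (simp add: Sq_def convex_box)
        show "path_image (RP p) \<subseteq> Sq p" by (rule RP_sub)
      qed (auto simp: RP_def)
      then show ?thesis using False by (simp add: contour_integral_unique)
    qed
    have split: "contour_integral (RP p) (\<lambda>\<zeta>. f \<zeta> / (\<zeta> - y)) =
      J (hs p) + J (vs (rt p)) - J (hs (up p)) - J (vs p)"
      if p: "p \<in> F" for p
    proof -
      have "continuous_on (path_image (RP p)) (\<lambda>\<zeta>. f \<zeta> / (\<zeta> - y))"
        using y_path[of p] RP_sub[of p]
        by (intro continuous_intros continuous_on_subset[OF holomorphic_on_imp_continuous_on[OF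
          fhol[OF p]]]) auto
      from contour_integral_rectpath[OF this[unfolded RP_def] leg] show ?thesis
        by (simp add: RP_def J_def hs_def vs_def up_def rt_def g_def)
    qed
    have "2 * pi * \<i> * f y = (\<Sum>p\<in>F. contour_integral (RP p) (\<lambda>\<zeta>. f \<zeta>
      / (\<zeta> - y)))"
      using int q finF by (simp add: sum.delta)
    also have "\<dots> = (\<Sum>p\<in>F. J (hs p) + J (vs (rt p)) - J (hs (up p)) - J (vs p))"
      by (rule sum.cong) (auto simp: split)
    also have "\<dots> = ((\<Sum>p\<in>F. J (hs p)) - (\<Sum>p\<in>F. J (hs (up p)))) +
      ((\<Sum>p\<in>F. J (vs (rt p))) - (\<Sum>p\<in>F. J (vs p)))"
      by (simp add: sum.distrib sum_subtractf)
    also have "(\<Sum>p\<in>F. J (hs (up p))) = (\<Sum>p\<in>up ` F. J (hs p))"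
      using inj(1) by (subst sum.reindex) (auto simp: o_def inj_def inj_on_def)
    also have "(\<Sum>p\<in>F. J (vs (rt p))) = (\<Sum>p\<in>rt ` F. J (vs p))"
      using inj(2) by (subst sum.reindex) (auto simp: o_def inj_def inj_on_def)
    also have "(\<Sum>p\<in>F. J (hs p)) - (\<Sum>p\<in>up ` F. J (hs p)) =
      (\<Sum>p\<in>set A1. J (hs p)) - (\<Sum>p\<in>set A2. J (hs p))"
      unfolding lists by (rule sum_minus_sum) (use finF in auto)
    also have "(\<Sum>p\<in>rt ` F. J (vs p)) - (\<Sum>p\<in>F. J (vs p)) =
      (\<Sum>p\<in>set B1. J (vs p)) - (\<Sum>p\<in>set B2. J (vs p))"
      unfolding lists by (rule sum_minus_sum) (use finF in auto)
    finally have "2 * pi * \<i> * f y = (\<Sum>p\<leftarrow>A1. J (hs p)) - (\<Sum>p\<leftarrow>A2.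
      J (hs p)) + ((\<Sum>p\<leftarrow>B1. J (vs p)) - (\<Sum>p\<leftarrow>B2. J (vs p)))"
      using lists by (simp add: sum_list_distinct_conv_sum_set)
    then have "w * (2 * pi * \<i> * f y) = w * ((\<Sum>p\<leftarrow>A1. J (hs p)) -
      (\<Sum>p\<leftarrow>A2. J (hs p)) + ((\<Sum>p\<leftarrow>B1. J (vs p)) -
      (\<Sum>p\<leftarrow>B2. J (vs p))))"
      by (simp only:)
    moreover have "w * (2 * pi * \<i> * f y) = f y" by (simp add: w_def)
    moreover have "T f y = w * ((\<Sum>p\<leftarrow>A1. J (hs p)) - (\<Sum>p\<leftarrow>A2. J (hs
      p)) + ((\<Sum>p\<leftarrow>B1. J (vs p)) - (\<Sum>p\<leftarrow>B2. J (vs p))))"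
    proof -
      have *: "(\<Sum>(c, a, b)\<leftarrow>map (\<lambda>p. (v, s p)) xs. c * contour_integral
        (linepath a b) (\<lambda>\<zeta>. f \<zeta> / (\<zeta> - y))) =
        v * (\<Sum>p\<leftarrow>xs. J (s p))"
        for v s and xs :: "(int \<times> int) list"
        by (induction xs) (auto simp: J_def case_prod_beta algebra_simps)
      show ?thesis
        unfolding T_def ps_def map_append sum_list_append * by (simp add: algebra_simps)
    qed
    ultimately show ?thesis by metis
  qed
  have "f z = T f z" if f: "f holomorphic_on U" and z: "z \<in> K" for f z
  proof -
    define q where "q = (\<lfloor>Re z / d\<rfloor>, \<lfloor>Im z / d\<rfloor>)"
    have fl: "of_int \<lfloor>x / d\<rfloor> * d \<le> x \<and> x \<le>
      (of_int \<lfloor>x / d\<rfloor> + 1) * d" for x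
      using pos_le_divide_eq[OF d, THEN iffD1, OF of_int_floor_le]
        pos_divide_le_eq[OF d, THEN iffD1, OF real_of_int_floor_add_one_ge] by blast
    have zq: "z \<in> Sq q" unfolding q_def in_Sq using fl by blast
    then have qF: "q \<in> F" using z by (auto simp: F_def)
    \<comment> \<open>The centre of the square witnesses that the open box is nonempty, without
      which its closure would not be the closed box.\<close>
    have "g (fst q) (snd q) + Complex (d/2) (d/2) \<in> Bx q"
      using d by (cases q) (simp add: in_Bx g_def algebra_simps)
    then have "closure (Bx q) = Sq q" unfolding Bx_def Sq_def by (intro closure_box) auto
    then obtain x where x: "\<And>n. x n \<in> Bx q" "x \<longlonglongrightarrow> z"
      using zq closure_sequential by metis
    have "isCont (T f) z"
    proof -
      have "isCont (\<lambda>y. \<Sum>(c, a, b)\<leftarrow>qs. c * contour_integral (linepath a b)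
        (\<lambda>\<zeta>. f \<zeta> / (\<zeta> - y))) z"
        if "set qs \<subseteq> set ps" for qs
        using that
      proof (induction qs)
        case (Cons t qs)
        obtain c a b where t: "t = (c, a, b)" by (cases t)
        have "closed_segment a b \<subseteq> U - K" using Cons.prems t ps_good by auto
        then have "isCont (\<lambda>y. contour_integral (linepath a b) (\<lambda>\<zeta>. f \<zeta>
          / (\<zeta> - y))) z"
          using z f by (intro isCont_Cauchy_transform_linepath)
             (auto intro: holomorphic_on_imp_continuous_on holomorphic_on_subset)
        then show ?case using Cons by (auto simp: t intro!: continuous_intros)
      qed auto
      then show ?thesis unfolding T_def[abs_def] by blast
    qed
    then have 1: "(\<lambda>n. T f (x n)) \<longlonglongrightarrow> T f z"
      using x isCont_tendsto_compose by blast
    have "isCont f z"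
      using f U z holomorphic_on_imp_continuous_on continuous_on_eq_continuous_at by blast
    then have 2: "(\<lambda>n. f (x n)) \<longlonglongrightarrow> f z"
      using x isCont_tendsto_compose by blast
    have "f (x n) = T f (x n)" for n by (rule formula[OF f qF x(1)])
    with 1 2 show ?thesis using LIMSEQ_unique by simp
  qed
  with ps_good show ?thesis using that unfolding T_def by blast
qed

text \<open>
  This is Runge's theorem with \<open>x\<close> as a parameter: the segments of Cauchy's formula
    avoid \<open>K\<close>, and
  the poles on them are pushed to infinity.
\<close>

lemma (in closed_function_algebra) holomorphic_substitution:
  assumes X: "compact X" and p: "p \<in> C" "continuous_on X p" "p ` X \<subseteq> K"
    and K: "compact K" "connected (- K)" and U: "open U" "K \<subseteq> U"
    and cont: "continuous_on (U \<times> X) (\<lambda>(\<zeta>, x). \<phi> \<zeta> x)"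
    and hol: "\<And>x. x \<in> X \<Longrightarrow> (\<lambda>\<zeta>. \<phi> \<zeta> x) holomorphic_on U"
    and C: "\<And>\<zeta>. \<zeta> \<in> U \<Longrightarrow> \<phi> \<zeta> \<in> C"
  shows "(\<lambda>x. \<phi> (p x) x) \<in> C"
proof -
  obtain ps where ps: "\<And>c a b. (c, a, b) \<in> set ps \<Longrightarrow>
    closed_segment a b \<subseteq> U - K"
    "\<And>f z. \<lbrakk>f holomorphic_on U; z \<in> K\<rbrakk> \<Longrightarrow>
      f z = (\<Sum>(c, a, b)\<leftarrow>ps. c * contour_integral (linepath a b) (\<lambda>\<zeta>. f
        \<zeta> / (\<zeta> - z)))"
    using Cauchy_formula_segments[OF K(1) U] by blast
  have "(\<lambda>x. \<Sum>t\<leftarrow>ps. (case t of (c, a, b) \<Rightarrow> c * contour_integral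
    (linepath a b) (\<lambda>\<zeta>. \<phi> \<zeta> x / (\<zeta> - p x)))) \<in> C"
  proof (rule sum_list)
    fix t assume t: "t \<in> set ps"
    obtain c a b where tt: "t = (c, a, b)" by (cases t)
    define l where "l = linepath a b"
    have seg: "l s \<in> U - K" if "s \<in> {0..1}" for s
      using ps(1) t tt linepath_in_path[OF that, of a b] by (auto simp: l_def)
    \<comment> \<open>The parametrised contour integral. For fixed \<open>s\<close> the point
      \<open>l s\<close> lies in \<open>U - K\<close>, so the integrand is a product of members, one
      of them given by \<open>pole\<close>.\<close>
    have "(\<lambda>x. integral {0..1} (\<lambda>s. \<phi> (l s) x * (1 / (l s - p x)) * (b - a))) \<in> C"
    proof (rule integral[OF _ _ X])
      show "(\<lambda>x. \<phi> (l s) x * (1 / (l s - p x)) * (b - a)) \<in> C" if "s \<in> {0..1}" for s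
        using seg[OF that] by (intro mult const C pole[OF p(1,3) K]) auto
      have "continuous_on ({0..1} \<times> X) (\<lambda>q. (\<lambda>(\<zeta>, x). \<phi> \<zeta> x)
        (l (fst q), snd q))"
        by (rule continuous_on_compose2[OF cont])
           (use seg in \<open>auto simp: l_def linepath_def intro!: continuous_intros\<close>)
      moreover have "continuous_on ({0..1} \<times> X) (\<lambda>q. p (snd q))"
        by (rule continuous_on_compose2[OF p(2)]) (auto intro!: continuous_intros)
      moreover have "l (fst q) - p (snd q) \<noteq> 0" if "q \<in> {0..1} \<times> X" for q
        using that seg[of "fst q"] p(3) by (auto simp: image_subset_iff)
      ultimately show "continuous_on ({0..1} \<times> X) (\<lambda>(s, x). \<phi> (l s) x * (1 / (l
        s - p x)) * (b - a))"
        unfolding case_prod_beta by (auto simp: l_def linepath_def intro!: continuous_intros)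
    qed
    then have "(\<lambda>x. contour_integral (linepath a b) (\<lambda>\<zeta>. \<phi> \<zeta> x /
      (\<zeta> - p x))) \<in> C"
      by (simp add: contour_integral_integral l_def)
    from cmult[OF this, of c]
    show "(\<lambda>x. case t of (c, a, b) \<Rightarrow> c * contour_integral (linepath a b)
      (\<lambda>\<zeta>. \<phi> \<zeta> x / (\<zeta> - p x))) \<in> C"
      by (simp add: tt)
  qed
  then show ?thesis
  proof (rule cong)
    fix x assume x: "x \<in> X"
    then have "p x \<in> K" using p(3) by blast
    from ps(2)[OF hol[OF x] this]
    show "(\<Sum>t\<leftarrow>ps. (case t of (c, a, b) \<Rightarrow> c * contour_integral (linepath
      a b) (\<lambda>\<zeta>. \<phi> \<zeta> x / (\<zeta> - p x)))) = \<phi> (p x) x"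
      by simp
  qed
qed

subsection \<open>Polynomials\<close>

text \<open>Evaluating expressions, countably many coefficients yield countably many polynomials.\<close>

datatype ('c, 'r, 'd) pexp =
  PConst 'c | PFst 'r | PSnd 'd
| PAdd "('c, 'r, 'd) pexp" "('c, 'r, 'd) pexp"
| PMult "('c, 'r, 'd) pexp" "('c, 'r, 'd) pexp"

instance pexp :: (countable, countable, countable) countable
  by countable_datatype

primrec peval :: "('c \<Rightarrow> complex) \<Rightarrow> ('c, 'r::finite, 'd::finite) pexp
  \<Rightarrow> ('r, 'd) cpoint \<Rightarrow> complex" where
  "peval \<kappa> (PConst c) = (\<lambda>_. \<kappa> c)"
| "peval \<kappa> (PFst i) = (\<lambda>p. fst p $ i)"
| "peval \<kappa> (PSnd i) = (\<lambda>p. snd p $ i)"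
| "peval \<kappa> (PAdd e1 e2) = (\<lambda>p. peval \<kappa> e1 p + peval \<kappa> e2 p)"
| "peval \<kappa> (PMult e1 e2) = (\<lambda>p. peval \<kappa> e1 p * peval \<kappa> e2 p)"

definition polys :: "(('r::finite, 'd::finite) cpoint \<Rightarrow> complex) set" where
  "polys = range (peval (\<lambda>c. c))"

lemma polys_const: "(\<lambda>_. c) \<in> polys"
  unfolding polys_def by (rule image_eqI[of _ _ "PConst c"]) auto

lemma polys_fst: "(\<lambda>p. fst p $ i) \<in> polys"
  unfolding polys_def by (rule image_eqI[of _ _ "PFst i"]) auto

lemma polys_snd: "(\<lambda>p. snd p $ i) \<in> polys"
  unfolding polys_def by (rule image_eqI[of _ _ "PSnd i"]) auto

lemma polys_add: "\<lbrakk>f \<in> polys; g \<in> polys\<rbrakk> \<Longrightarrow>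
  (\<lambda>p. f p + g p) \<in> polys"
  unfolding polys_def by (auto intro: image_eqI[of _ _ "PAdd _ _"])

lemma polys_mult: "\<lbrakk>f \<in> polys; g \<in> polys\<rbrakk> \<Longrightarrow>
  (\<lambda>p. f p * g p) \<in> polys"
  unfolding polys_def by (auto intro: image_eqI[of _ _ "PMult _ _"])

lemma polys_diff: "\<lbrakk>f \<in> polys; g \<in> polys\<rbrakk> \<Longrightarrow>
  (\<lambda>p. f p - g p) \<in> polys"
  using polys_add[OF _ polys_mult[OF polys_const[of "-1"]], of f g] by simp

lemma polys_induct [consumes 1, case_names const fst snd add mult]:
  fixes P :: "(('r::finite, 'd::finite) cpoint \<Rightarrow> complex) \<Rightarrow> bool"
  assumes "f \<in> polys" "\<And>c. P (\<lambda>_. c)" "\<And>i. P (\<lambda>p. fst p $ i)"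
    "\<And>i. P (\<lambda>p. snd p $ i)"
    "\<And>f g. \<lbrakk>f \<in> polys; P f; g \<in> polys; P g\<rbrakk> \<Longrightarrow>
      P (\<lambda>p. f p + g p)"
    "\<And>f g. \<lbrakk>f \<in> polys; P f; g \<in> polys; P g\<rbrakk> \<Longrightarrow>
      P (\<lambda>p. f p * g p)"
  shows "P f"
proof -
  have "P (peval (\<lambda>c. c) e)" for e
    by (induction e) (auto intro: assms simp: polys_def)
  then show ?thesis using assms(1) by (auto simp: polys_def)
qed

lemma holomorphic_several_peval: "holomorphic_several (peval \<kappa> e) S"
  by (induction e)
     (auto intro: holomorphic_several_const holomorphic_several_fst_nth holomorphic_several_snd_nth
       holomorphic_several_add holomorphic_several_mult)

lemma holomorphic_several_polys: "f \<in> polys \<Longrightarrow> holomorphic_several f S"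
  by (auto simp: polys_def holomorphic_several_peval)

lemma polys_bounded:
  assumes "f \<in> polys" "compact X"
  shows "\<exists>B>0. \<forall>x\<in>X. cmod (f x) \<le> B"
proof -
  have "compact (f ` X)"
    by (intro compact_continuous_image holomorphic_several_continuous holomorphic_several_polys assms)
  then show ?thesis
    using compact_imp_bounded bounded_pos by (metis (no_types, lifting) imageI)
qed

text \<open>From \<open>\<delta> \<le> 1\<close> follows \<open>cmod b' \<le> B + 1\<close>, which
  is the origin of the factor \<open>A + B + 1\<close>.\<close>

lemma approx_mult:
  fixes a b a' b' :: complex
  assumes "cmod a \<le> A" "cmod b \<le> B" "cmod (a - a') \<le> \<delta>" "cmod (b - b') \<le> \<delta>"
    "A > 0" "B > 0" "\<delta> \<le> 1" "\<delta> * (A + B + 1) \<le> e"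
  shows "cmod (a * b - a' * b') \<le> e"
proof -
  have \<delta>: "\<delta> \<ge> 0" using assms(3) norm_ge_zero order_trans by blast
  have "cmod b' \<le> B + 1"
    using norm_triangle_ineq[of b "b' - b"] assms(2,4,7) by (simp add: norm_minus_commute)
  moreover have "a * b - a' * b' = a * (b - b') + (a - a') * b'"
    by (simp add: algebra_simps)
  ultimately have "cmod (a * b - a' * b') \<le> A * \<delta> + \<delta> * (B + 1)"
    using assms norm_triangle_ineq[of "a * (b - b')" "(a - a') * b'"] \<delta>
      mult_mono[of "cmod a" A "cmod (b - b')" \<delta>] mult_mono[of "cmod (a - a')" \<delta> "cmod
        b'" "B + 1"]
    by (simp add: norm_mult)
  also have "\<dots> = \<delta> * (A + B + 1)" by (simp add: algebra_simps)
  finally show ?thesis using assms(8) by simp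
qed

lemma approx_mult_delta:
  fixes A B e :: real
  assumes "A > 0" "B > 0" "e > 0"
  obtains \<delta> where "\<delta> > 0" "\<delta> \<le> 1" "\<delta> * (A + B + 1) \<le> e"
proof
  show "min 1 (e / (A + B + 1)) > 0" using assms by simp
  have "min 1 (e / (A + B + 1)) * (A + B + 1) \<le> e / (A + B + 1) * (A + B + 1)"
    by (rule mult_right_mono) (use assms in auto)
  also have "\<dots> = e" using assms by simp
  finally show "min 1 (e / (A + B + 1)) * (A + B + 1) \<le> e" .
qed simp

text \<open>Coefficients are perturbed at the leaves of the expression. Products cause no trouble
  because polynomials are bounded on the compact set \<open>X\<close>.\<close>

lemma peval_approx:
  assumes f: "f \<in> polys" and \<kappa>: "closure (range \<kappa>) = UNIV" and X: "compact X"
    and e: "e > 0"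
  shows "\<exists>t. \<forall>x\<in>X. cmod (f x - peval \<kappa> t x) \<le> e"
  using f e
proof (induction arbitrary: e rule: polys_induct)
  case (const c)
  have "c \<in> closure (range \<kappa>)" using \<kappa> by simp
  then obtain n where "dist (\<kappa> n) c < e" using const closure_approachable by blast
  then show ?case by (intro exI[of _ "PConst n"]) (auto simp: dist_norm norm_minus_commute)
next
  case (fst i)
  then show ?case by (intro exI[of _ "PFst i"]) auto
next
  case (snd i)
  then show ?case by (intro exI[of _ "PSnd i"]) auto
next
  case (add f g)
  obtain s where s: "\<And>x. x \<in> X \<Longrightarrow> cmod (f x - peval \<kappa> s x) \<le> e/2"
    using add.IH(1)[of "e/2"] add.prems by auto
  obtain t where t: "\<And>x. x \<in> X \<Longrightarrow> cmod (g x - peval \<kappa> t x) \<le> e/2"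
    using add.IH(2)[of "e/2"] add.prems by auto
  have "cmod (f x + g x - peval \<kappa> (PAdd s t) x) \<le> e" if "x \<in> X" for x
    using norm_triangle_ineq[of "f x - peval \<kappa> s x" "g x - peval \<kappa> t x"] s[OF that] t[OF that]
    by (simp add: algebra_simps)
  then show ?case by blast
next
  case (mult f g)
  obtain A where A: "A > 0" "\<forall>x\<in>X. cmod (f x) \<le> A"
    using polys_bounded[OF mult.hyps(1) X] by blast
  obtain B where B: "B > 0" "\<forall>x\<in>X. cmod (g x) \<le> B"
    using polys_bounded[OF mult.hyps(2) X] by blast
  obtain \<delta> where \<delta>: "\<delta> > 0" "\<delta> \<le> 1" "\<delta> * (A + B + 1) \<le> e"
    using approx_mult_delta[OF A(1) B(1) mult.prems] by blast
  obtain s where s: "\<And>x. x \<in> X \<Longrightarrow> cmod (f x - peval \<kappa> s x) \<le>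
    \<delta>" using mult.IH(1)[of \<delta>] \<delta> by auto
  obtain t where t: "\<And>x. x \<in> X \<Longrightarrow> cmod (g x - peval \<kappa> t x) \<le>
    \<delta>" using mult.IH(2)[of \<delta>] \<delta> by auto
  have "cmod (f x * g x - peval \<kappa> (PMult s t) x) \<le> e" if "x \<in> X" for x
    using approx_mult[of "f x" A "g x" B _ \<delta>] A B \<delta> s[OF that] t[OF that] that by simp
  then show ?case by blast
qed

definition poly_closure :: "('r::finite, 'd::finite) cpoint set \<Rightarrow> (('r, 'd) cpoint
  \<Rightarrow> complex) set" where
  "poly_closure X = {f. \<forall>e>0. \<exists>g\<in>polys. \<forall>x\<in>X. cmod (f x - g x) \<le> e}"

lemma poly_closureI: "f \<in> polys \<Longrightarrow> f \<in> poly_closure X"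
  by (auto simp: poly_closure_def intro!: bexI[of _ f])

lemma poly_closureD: "f \<in> poly_closure X \<Longrightarrow> e > 0 \<Longrightarrow>
  \<exists>g\<in>polys. \<forall>x\<in>X. cmod (f x - g x) \<le> e"
  by (auto simp: poly_closure_def)

lemma closed_function_algebra_poly_closure:
  assumes X: "compact X"
  shows "closed_function_algebra X (poly_closure X)"
proof
  have bdd: "\<exists>B>0. \<forall>x\<in>X. cmod (f x) \<le> B" if f: "f \<in> poly_closure X" for f
  proof -
    obtain g where g: "g \<in> polys" "\<And>x. x \<in> X \<Longrightarrow> cmod (f x - g x) \<le> 1"
      using poly_closureD[OF f, of 1] by auto
    obtain B where B: "B > 0" "\<forall>x\<in>X. cmod (g x) \<le> B" using polys_bounded[OF g(1) X] by blast
    have "cmod (f x) \<le> B + 1" if "x \<in> X" for x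
      using norm_triangle_ineq[of "f x - g x" "g x"] g(2)[OF that] B that by fastforce
    then show ?thesis using B(1) by (intro exI[of _ "B + 1"]) auto
  qed
  show "bounded (f ` X)" if "f \<in> poly_closure X" for f
    using bdd[OF that] by (auto simp: bounded_iff)
  show "(\<lambda>_. c) \<in> poly_closure X" for c by (intro poly_closureI polys_const)
  show "(\<lambda>x. f x + g x) \<in> poly_closure X"
    if fg: "f \<in> poly_closure X" "g \<in> poly_closure X" for f g
    unfolding poly_closure_def
  proof safe
    fix e :: real assume e: "e > 0"
    obtain s where s: "s \<in> polys" "\<And>x. x \<in> X \<Longrightarrow> cmod (f x - s x) \<le> e/2"
      using poly_closureD[OF fg(1), of "e/2"] e by auto
    obtain t where t: "t \<in> polys" "\<And>x. x \<in> X \<Longrightarrow> cmod (g x - t x) \<le> e/2"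
      using poly_closureD[OF fg(2), of "e/2"] e by auto
    have "cmod (f x + g x - (s x + t x)) \<le> e" if "x \<in> X" for x
      using norm_triangle_ineq[of "f x - s x" "g x - t x"] s(2)[OF that] t(2)[OF that]
      by (simp add: algebra_simps)
    then show "\<exists>u\<in>polys. \<forall>x\<in>X. cmod (f x + g x - u x) \<le> e"
      using polys_add[OF s(1) t(1)] by (intro bexI[of _ "\<lambda>x. s x + t x"] ballI)
  qed
  show "(\<lambda>x. f x * g x) \<in> poly_closure X"
    if fg: "f \<in> poly_closure X" "g \<in> poly_closure X" for f g
    unfolding poly_closure_def
  proof safe
    fix e :: real assume e: "e > 0"
    obtain A where A: "A > 0" "\<forall>x\<in>X. cmod (f x) \<le> A" using bdd[OF fg(1)] by blast
    obtain B where B: "B > 0" "\<forall>x\<in>X. cmod (g x) \<le> B" using bdd[OF fg(2)] by blast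
    obtain \<delta> where \<delta>: "\<delta> > 0" "\<delta> \<le> 1" "\<delta> * (A + B + 1) \<le> e"
      using approx_mult_delta[OF A(1) B(1) e] by blast
    obtain s where s: "s \<in> polys" "\<And>x. x \<in> X \<Longrightarrow> cmod (f x - s x) \<le> \<delta>"
      using poly_closureD[OF fg(1) \<delta>(1)] by auto
    obtain t where t: "t \<in> polys" "\<And>x. x \<in> X \<Longrightarrow> cmod (g x - t x) \<le> \<delta>"
      using poly_closureD[OF fg(2) \<delta>(1)] by auto
    have "cmod (f x * g x - s x * t x) \<le> e" if "x \<in> X" for x
      using approx_mult[of "f x" A "g x" B _ \<delta>] A B \<delta> s(2)[OF that] t(2)[OF that] that by simp
    then show "\<exists>u\<in>polys. \<forall>x\<in>X. cmod (f x * g x - u x) \<le> e"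
      using polys_mult[OF s(1) t(1)] by (intro bexI[of _ "\<lambda>x. s x * t x"] ballI)
  qed
  show "f \<in> poly_closure X" if lim: "\<And>e. e > 0 \<Longrightarrow>
    \<exists>g\<in>poly_closure X. \<forall>x\<in>X. cmod (f x - g x) \<le> e" for f
    unfolding poly_closure_def
  proof safe
    fix e :: real assume e: "e > 0"
    obtain g where g: "g \<in> poly_closure X" "\<And>x. x \<in> X \<Longrightarrow>
      cmod (f x - g x) \<le> e/2"
      using lim[of "e/2"] e by auto
    obtain t where t: "t \<in> polys" "\<And>x. x \<in> X \<Longrightarrow> cmod (g x - t x) \<le> e/2"
      using poly_closureD[OF g(1), of "e/2"] e by auto
    have "cmod (f x - t x) \<le> e" if "x \<in> X" for x
      using norm_triangle_ineq[of "f x - g x" "g x - t x"] g(2)[OF that] t(2)[OF that] by simp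
    then show "\<exists>u\<in>polys. \<forall>x\<in>X. cmod (f x - u x) \<le> e"
      using t(1) by (intro bexI[of _ t] ballI)
  qed
qed

subsection \<open>Runge's theorem on products\<close>

text \<open>The sum type puts the coordinates of \<open>w\<close> and \<open>z\<close> on an equal
  footing, so that the induction for Runge's theorem runs over one finite index set.\<close>

fun coord :: "'r + 'd \<Rightarrow> ('r::finite, 'd::finite) cpoint \<Rightarrow> complex" where
  "coord (Inl i) p = fst p $ i"
| "coord (Inr j) p = snd p $ j"

definition of_coords :: "('r + 'd \<Rightarrow> complex) \<Rightarrow> ('r::finite, 'd::finite)
  cpoint" where
  "of_coords g = (\<chi> i. g (Inl i), \<chi> j. g (Inr j))"

definition coord_box :: "('r + 'd \<Rightarrow> complex set) \<Rightarrow> ('r::finite, 'd::finite)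
  cpoint set" where
  "coord_box A = {p. \<forall>i. coord i p \<in> A i}"

lemma coord_of_coords [simp]: "coord i (of_coords g) = g i"
  by (cases i) (auto simp: of_coords_def)

lemma of_coords_coord [simp]: "of_coords (\<lambda>i. coord i p) = p"
  by (auto simp: of_coords_def prod_eq_iff vec_eq_iff)

lemma coord_box_eq: "coord_box A = box_prod (\<lambda>i. A (Inl i)) \<times> box_prod (\<lambda>j. A
  (Inr j))"
  by (auto simp: coord_box_def box_prod_def split_sum_all)

lemma open_box_prod: "(\<And>i. open (A i)) \<Longrightarrow> open (box_prod A)"
  unfolding box_prod_def by (rule open_vector_box) auto

lemma compact_box_prod:
  assumes "\<And>i. compact (A i)"
  shows "compact (box_prod A)"
  unfolding compact_eq_bounded_closed
proof
  show "closed (box_prod A)"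
    unfolding box_prod_def by (rule closed_vector_box) (use assms compact_imp_closed in blast)
  have "\<forall>i. \<exists>b. \<forall>z\<in>A i. cmod z \<le> b"
    using assms compact_imp_bounded bounded_iff by metis
  then obtain b where b: "\<And>i z. z \<in> A i \<Longrightarrow> cmod z \<le> b i" by metis
  have "norm x \<le> (\<Sum>i\<in>UNIV. b i)" if "x \<in> box_prod A" for x
  proof -
    have "norm x \<le> (\<Sum>i\<in>UNIV. cmod (x $ i))" unfolding norm_vec_def by (rule L2_set_le_sum) simp
    also have "\<dots> \<le> (\<Sum>i\<in>UNIV. b i)"
      by (rule sum_mono) (use that b in \<open>auto simp: box_prod_def\<close>)
    finally show ?thesis .
  qed
  then show "bounded (box_prod A)" by (auto simp: bounded_iff)
qed

lemma continuous_on_of_coords: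
  "(\<And>k. continuous_on S (\<lambda>y. g y k)) \<Longrightarrow> continuous_on S (\<lambda>y.
    of_coords (g y))"
  unfolding of_coords_def by (intro continuous_on_Pair continuous_on_vec_lambda)

lemma continuous_on_coord: "continuous_on S (coord i)"
  by (cases i) (auto intro!: continuous_intros)

lemma polys_coord: "coord i \<in> polys"
proof (cases i)
  case (Inl a)
  then have "coord i = (\<lambda>p. fst p $ a)" by (simp add: fun_eq_iff)
  then show ?thesis by (simp add: polys_fst)
next
  case (Inr a)
  then have "coord i = (\<lambda>p. snd p $ a)" by (simp add: fun_eq_iff)
  then show ?thesis by (simp add: polys_snd)
qed

lemma Runge_product:
  fixes U K :: "'r::finite + 'd::finite \<Rightarrow> complex set"
  assumes U: "\<And>i. open (U i)" "\<And>i. K i \<subseteq> U i"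
    and K: "\<And>i. compact (K i)" "\<And>i. connected (- K i)"
    and f: "holomorphic_several f (coord_box U)"
  shows "f \<in> poly_closure (coord_box K)"
proof -
  define X where "X = coord_box K"
  have X: "compact X" unfolding X_def coord_box_eq by (intro compact_Times compact_box_prod K)
  interpret closed_function_algebra X "poly_closure X"
    by (rule closed_function_algebra_poly_closure[OF X])
  \<comment> \<open>The coordinates outside \<open>I\<close> are frozen at values in
    \<open>U\<close>, not just in \<open>K\<close>: releasing coordinate \<open>i\<close> requires
    the statement for every frozen value in \<open>U i\<close>, since the contour of the Cauchy
    formula runs through \<open>U i - K i\<close>.\<close>
  have main: "(\<lambda>x. f (of_coords (\<lambda>k. if k \<in> I then coord k x else c k))) \<in>
    poly_closure X"
    if "finite I" "\<And>k. c k \<in> U k" for I c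
    using that
  proof (induction I arbitrary: c)
    case empty
    show ?case by (simp add: const)
  next
    case (insert i I)
    define m where "m c x = of_coords (\<lambda>k. if k \<in> I then coord k x else c k)"
      for c and x :: "('r, 'd) cpoint"
    define u :: "('r, 'd) cpoint" where "u = of_coords (\<lambda>k. if k = i then 1 else 0)"
    define m0 where "m0 = m (c(i := 0))"
    have m_line: "m (c(i := \<zeta>)) x = m0 x + cscale \<zeta> u" for \<zeta> x
      using insert.hyps(2) by (auto simp: m0_def m_def u_def of_coords_def cscale_def vec_eq_iff
        prod_eq_iff)
    have m_mem: "m (c(i := \<zeta>)) x \<in> coord_box U" if "\<zeta> \<in> U i" "x \<in> X" for \<zeta> x
      using that insert.prems U(2) by (auto simp: coord_box_def m_def X_def)
    have m_insert: "m (c(i := coord i x)) x = of_coords (\<lambda>k. if k \<in> insert i I then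
      coord k x else c k)" for x
      unfolding m_def by (rule arg_cong[of _ _ of_coords]) (use insert.hyps(2) in auto)
    have "(\<lambda>x. (\<lambda>\<zeta> x. f (m (c(i := \<zeta>)) x)) (coord i x) x) \<in> poly_closure X"
    proof (rule holomorphic_substitution[of "coord i" "K i" "U i" "\<lambda>\<zeta> x. f (m (c(i :=
      \<zeta>)) x)"])
      show "continuous_on (U i \<times> X) (\<lambda>(\<zeta>, x). f (m (c(i := \<zeta>)) x))"
        unfolding case_prod_beta
      proof (rule continuous_on_compose2[OF holomorphic_several_continuous[OF f]])
        show "continuous_on (U i \<times> X) (\<lambda>q. m (c(i := fst q)) (snd q))"
          unfolding m_line unfolding m0_def m_def
        proof (intro continuous_on_add continuous_on_of_coords)
          show "continuous_on (U i \<times> X) (\<lambda>q. if k \<in> I then coord k (snd q) else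
            (c(i := 0)) k)" for k
            by (cases "k \<in> I")
              (auto intro!: continuous_on_compose2[OF continuous_on_coord] continuous_intros)
          show "continuous_on (U i \<times> X) (\<lambda>q. cscale (fst q) u)"
            by (rule continuous_on_compose2[OF linear_continuous_on[OF bounded_linear_cscale_left,
              of UNIV]])
              (auto intro!: continuous_intros)
        qed
      qed (use m_mem in auto)
      show "(\<lambda>\<zeta>. f (m (c(i := \<zeta>)) x)) holomorphic_on U i" if "x \<in> X" for x
        unfolding m_line by (rule holomorphic_on_line[OF f]) (use m_mem[OF _ that] in \<open>simp
          add: m_line\<close>)
      show "(\<lambda>x. f (m (c(i := \<zeta>)) x)) \<in> poly_closure X" if "\<zeta> \<in> U i" for \<zeta>
        unfolding m_def by (rule insert.IH) (use insert.prems that in auto)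
      show "coord i ` X \<subseteq> K i" by (auto simp: X_def coord_box_def)
    qed (fact X U K poly_closureI[OF polys_coord] continuous_on_coord)+
    then show ?case unfolding m_insert .
  qed
  show ?thesis
  proof (cases "X = {}")
    case True
    show ?thesis unfolding X_def[symmetric]
      by (rule cong[OF poly_closureI[OF polys_const[of 0]]]) (simp add: True)
  next
    case False
    then obtain c where "c \<in> X" by blast
    then have "coord k c \<in> U k" for k using U(2) by (auto simp: X_def coord_box_def)
    from main[OF finite[of UNIV] this] show ?thesis unfolding X_def[symmetric] by (simp)
  qed
qed

text \<open>Here \<open>X\<close> need not be a box; only one of its coordinates is confined to
  \<open>K\<close>. Nor need \<open>U\<close> be connected, so \<open>f\<close> may take different
  constant values near different parts of \<open>K\<close>.\<close>

lemma Runge_coord: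
  assumes X: "compact X" and K: "compact K" "connected (- K)" "coord i ` X \<subseteq> K"
    and U: "open U" "K \<subseteq> U" and f: "f holomorphic_on U"
  shows "(\<lambda>x. f (coord i x)) \<in> poly_closure X"
proof -
  interpret closed_function_algebra X "poly_closure X"
    by (rule closed_function_algebra_poly_closure[OF X])
  show ?thesis
  proof (rule holomorphic_substitution[of "coord i" K U "\<lambda>\<zeta> _. f \<zeta>"])
    show "continuous_on (U \<times> X) (\<lambda>(\<zeta>, x). f \<zeta>)"
      unfolding case_prod_beta
      by (rule continuous_on_compose2[OF holomorphic_on_imp_continuous_on[OF f]]) (auto intro!:
        continuous_intros)
  qed (rule assms const poly_closureI[OF polys_coord] continuous_on_coord)+
qed

subsection \<open>Taylor sums\<close>

text \<open>Each partial derivative acts on a single factor. This is what makes the Taylor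
  coefficients of monomials computable.\<close>

lemma multi_deriv_prod:
  fixes \<phi> :: "'n::{finite,linorder} \<Rightarrow> complex \<Rightarrow> complex"
  assumes hol: "\<And>j. \<phi> j holomorphic_on UNIV"
  shows "multi_deriv m (\<lambda>u. \<Prod>j\<in>UNIV. \<phi> j (u $ j)) =
    (\<lambda>u. \<Prod>j\<in>UNIV. (deriv ^^ (m $ j)) (\<phi> j) (u $ j))"
proof -
  have 1: "partial_deriv i (\<lambda>u. \<Prod>j\<in>UNIV. \<psi> j (u $ j)) =
    (\<lambda>u. \<Prod>j\<in>UNIV. (\<psi>(i := deriv (\<psi> i))) j (u $ j))"
    if "\<psi> i holomorphic_on UNIV" for i and \<psi> :: "'n \<Rightarrow> complex \<Rightarrow> complex"
  proof
    fix u :: "'n cspace"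
    have *: "(\<Prod>j\<in>UNIV. g j) = g i * (\<Prod>j\<in>UNIV - {i}. g j)"
      for g :: "'n \<Rightarrow> complex"
      by (rule prod.remove) auto
    have "(\<lambda>t. \<Prod>j\<in>UNIV. \<psi> j ((\<chi> j. if j = i then t else u $ j) $ j)) =
      (\<lambda>t. \<psi> i t * (\<Prod>j\<in>UNIV - {i}. \<psi> j (u $ j)))"
      by (rule ext, subst *) (auto intro!: prod.cong)
    moreover have "deriv (\<lambda>t. \<psi> i t * (\<Prod>j\<in>UNIV - {i}. \<psi> j (u $ j))) (u $
      i) = deriv (\<psi> i) (u $ i) * (\<Prod>j\<in>UNIV - {i}. \<psi> j (u $ j))"
      by (rule deriv_cmult_right) (use that in \<open>auto simp: holomorphic_on_def\<close>)
    ultimately show "partial_deriv i (\<lambda>u. \<Prod>j\<in>UNIV. \<psi> j (u $ j)) u =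
      (\<Prod>j\<in>UNIV. (\<psi>(i := deriv (\<psi> i))) j (u $ j))"
      unfolding partial_deriv_def by (subst *) (auto intro!: prod.cong)
  qed
  have 2: "(partial_deriv i ^^ n) (\<lambda>u. \<Prod>j\<in>UNIV. \<psi> j (u $ j)) =
    (\<lambda>u. \<Prod>j\<in>UNIV. (\<psi>(i := (deriv ^^ n) (\<psi> i))) j (u $ j))"
    if "\<psi> i holomorphic_on UNIV" for i n and \<psi> :: "'n \<Rightarrow> complex \<Rightarrow> complex"
  proof (induction n)
    case (Suc n)
    have "(deriv ^^ n) (\<psi> i) holomorphic_on UNIV"
      by (rule holomorphic_higher_deriv[OF that]) simp
    then show ?case using 1[of "\<psi>(i := (deriv ^^ n) (\<psi> i))" i] Suc by simp
  qed simp
  have "foldr (\<lambda>i. partial_deriv i ^^ (m $ i)) xs (\<lambda>u. \<Prod>j\<in>UNIV. \<phi> j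
    (u $ j)) =
      (\<lambda>u. \<Prod>j\<in>UNIV. (if j \<in> set xs then (deriv ^^ (m $ j)) (\<phi> j) else
        \<phi> j) (u $ j))"
    if "distinct xs" for xs
    using that
  proof (induction xs)
    case (Cons x xs)
    let ?\<psi> = "\<lambda>j. if j \<in> set xs then (deriv ^^ (m $ j)) (\<phi> j) else \<phi> j"
    have "?\<psi>(x := (deriv ^^ (m $ x)) (?\<psi> x)) = (\<lambda>j. if j \<in> set (x # xs) then
      (deriv ^^ (m $ j)) (\<phi> j) else \<phi> j)"
      using Cons.prems by (auto simp: fun_eq_iff)
    with 2[of ?\<psi> x "m $ x"] Cons hol show ?case by simp
  qed simp
  from this[of "sorted_list_of_set UNIV"] show ?thesis by (simp add: multi_deriv_def)
qed

definition cmonom :: "'d::finite cspace \<Rightarrow> 'd mindex \<Rightarrow> 'd cspace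
  \<Rightarrow> complex" where
  "cmonom \<zeta> m z = (\<Prod>i\<in>UNIV. (z $ i - \<zeta> $ i) ^ (m $ i))"

lemma higher_deriv_power_centre:
  "(deriv ^^ j) (\<lambda>w. (w - z) ^ n) (z :: complex) = (if j = n then fact n else 0)"
proof (cases j n rule: linorder_cases)
  case greater
  then show ?thesis by (simp add: higher_deriv_power pochhammer_0_left)
qed (simp_all add: higher_deriv_power pochhammer_fact[symmetric])

lemma multi_deriv_cmonom: "multi_deriv m (cmonom \<zeta> k) \<zeta> = (if m =
  k then (\<Prod>i\<in>UNIV. fact (m $ i)) else 0)"
proof -
  have "multi_deriv m (cmonom \<zeta> k) \<zeta> = (\<Prod>j\<in>UNIV. (deriv ^^ (m $ j))
    (\<lambda>t. (t - \<zeta> $ j) ^ (k $ j)) (\<zeta> $ j))"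
    unfolding cmonom_def[abs_def]
    by (subst multi_deriv_prod) (auto intro!: holomorphic_intros)
  also have "\<dots> = (\<Prod>j\<in>UNIV. if m $ j = k $ j then fact (k $ j) else 0)"
    by (simp add: higher_deriv_power_centre)
  also have "\<dots> = (if m = k then (\<Prod>i\<in>UNIV. fact (m $ i)) else 0)"
  proof (cases "m = k")
    case False
    then obtain j where "m $ j \<noteq> k $ j" by (auto simp: vec_eq_iff)
    then show ?thesis using False by (auto intro!: prod_zero bexI[of _ j])
  qed simp
  finally show ?thesis .
qed

lemma cmonom_simps:
  "cmonom \<zeta> 0 z = 1" "cmonom \<zeta> (axis j 1) z = z $ j - \<zeta> $ j"
  "cmonom \<zeta> (k + l) z = cmonom \<zeta> k z * cmonom \<zeta> l z"
proof -
  have "(\<Prod>i\<in>UNIV. (z $ i - \<zeta> $ i) ^ (axis j 1 $ i)) = (\<Prod>i\<in>UNIV. if i =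
    j then z $ j - \<zeta> $ j else 1)"
    by (rule prod.cong) (auto simp: axis_def)
  then show "cmonom \<zeta> (axis j 1) z = z $ j - \<zeta> $ j" by (simp add: cmonom_def)
qed (simp_all add: cmonom_def power_add prod.distrib)

lemma holomorphic_several_cmonom: "holomorphic_several (\<lambda>p. cmonom \<zeta> k (snd p)) S"
  unfolding cmonom_def
  by (intro holomorphic_several_prod holomorphic_several_power holomorphic_several_diff
      holomorphic_several_snd_nth holomorphic_several_const)

text \<open>
  The coefficients may be arbitrary functions of \<open>w\<close>, because Taylor coefficients are
    computed with \<open>w\<close>
  fixed.
\<close>

inductive_set taylor_polys :: "'d::{finite,linorder} cspace \<Rightarrow> (('r::{finite,linorder},
  'd) cpoint \<Rightarrow> complex) set"
  for \<zeta> where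
  zero: "(\<lambda>_. 0) \<in> taylor_polys \<zeta>"
| step: "g \<in> taylor_polys \<zeta> \<Longrightarrow> (\<lambda>p. a (fst p) * cmonom \<zeta> k
  (snd p) + g p) \<in> taylor_polys \<zeta>"

lemma taylor_polys_term: "(\<lambda>p. a (fst p) * cmonom \<zeta> k (snd p)) \<in> taylor_polys \<zeta>"
  using taylor_polys.step[OF taylor_polys.zero, of a \<zeta> k] by simp

lemma taylor_polys_add:
  assumes "f \<in> taylor_polys \<zeta>" "g \<in> taylor_polys \<zeta>"
  shows "(\<lambda>p. f p + g p) \<in> taylor_polys \<zeta>"
  using assms
proof (induction rule: taylor_polys.induct)
  case (step f a k)
  then show ?case using taylor_polys.step[of "\<lambda>p. f p + g p" \<zeta> a k] by (simp add: add.assoc)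
qed simp

lemma taylor_polys_mult_term:
  assumes "f \<in> taylor_polys \<zeta>"
  shows "(\<lambda>p. a (fst p) * cmonom \<zeta> k (snd p) * f p) \<in> taylor_polys \<zeta>"
  using assms
proof (induction rule: taylor_polys.induct)
  case zero
  show ?case by (simp add: taylor_polys.zero)
next
  case (step f b l)
  then show ?case
    using taylor_polys.step[OF step.IH, of "\<lambda>w. a w * b w" "k + l"]
    by (simp add: cmonom_simps algebra_simps)
qed

lemma taylor_polys_mult:
  assumes "f \<in> taylor_polys \<zeta>" "g \<in> taylor_polys \<zeta>"
  shows "(\<lambda>p. f p * g p) \<in> taylor_polys \<zeta>"
  using assms
proof (induction rule: taylor_polys.induct)
  case zero
  show ?case by (simp add: taylor_polys.zero)
next
  case (step f a k)
  then show ?case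
    using taylor_polys_add[OF taylor_polys_mult_term[OF step.prems, of a k] step.IH[OF step.prems]]
    by (simp add: distrib_right)
qed

lemma polys_subset_taylor_polys:
  assumes "f \<in> polys"
  shows "f \<in> taylor_polys \<zeta>"
  using assms
proof (induction rule: polys_induct)
  case (const c)
  then show ?case using taylor_polys_term[of "\<lambda>_. c" \<zeta> 0] by (simp add: cmonom_simps)
next
  case (fst i)
  then show ?case using taylor_polys_term[of "\<lambda>w. w $ i" \<zeta> 0] by (simp add: cmonom_simps)
next
  case (snd i)
  then show ?case
    using taylor_polys_add[OF taylor_polys_term[of "\<lambda>_. 1" \<zeta> "axis i 1"]
      taylor_polys_term[of "\<lambda>_. \<zeta> $ i" \<zeta> 0]]
    by (simp add: cmonom_simps del: One_nat_def)
qed (auto intro: taylor_polys_add taylor_polys_mult)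

text \<open>Regards a function of \<open>z\<close> alone as a function on pairs, so that the rules
  for mixed derivatives become available with \<open>w\<close> fixed and without any regularity in
  \<open>w\<close>.\<close>

lemma multi_deriv_snd: "multi_deriv m F \<zeta> = mixed_deriv 0 m (\<lambda>p. F (snd p)) (w, \<zeta>)"
  by (simp add: mixed_deriv_def)

lemma partial_sum_cmonom:
  "partial_sum N n f w \<zeta> z = (\<Sum>k\<le>n. taylor_coeff (N k) f w \<zeta> * cmonom \<zeta> (N k) z)"
  by (simp add: partial_sum_def cmonom_def)

text \<open>Only finitely many multi-indices carry a nonzero coefficient. Surjectivity of
  \<open>N\<close> makes each of them appear eventually, and injectivity makes it appear only
  once.\<close>

lemma partial_sum_polys:
  fixes f :: "('r::{finite,linorder}, 'd::{finite,linorder}) cpoint \<Rightarrow> complex"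
  assumes f: "f \<in> polys" and N: "bij N"
  shows "\<exists>n0. \<forall>n\<ge>n0. \<forall>w z. partial_sum N n f w \<zeta> z = f (w, z)"
proof -
  \<comment> \<open>Holomorphy is claimed with \<open>w\<close> frozen, because the coefficients in
    \<open>taylor_polys\<close> are arbitrary functions of \<open>w\<close>; it is what additivity
    of the derivatives in \<open>z\<close> needs.\<close>
  have "(\<forall>w. holomorphic_several (\<lambda>p :: ('r, 'd) cpoint. f (w, snd p)) UNIV) \<and>
     (\<exists>n0. \<forall>n\<ge>n0. \<forall>w z. partial_sum N n f w \<zeta> z = f (w, z))"
    using polys_subset_taylor_polys[OF f, of \<zeta>]
  proof (induction rule: taylor_polys.induct)
    case zero
    have "multi_deriv m (\<lambda>u. 0 :: complex) z = 0" for m and z :: "'d cspace"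
    proof -
      have "multi_deriv m (\<lambda>u. 0 :: complex) z = mixed_deriv 0 m (\<lambda>p :: ('r, 'd)
        cpoint. (\<lambda>_. 0) p - (\<lambda>_. 0) p) (0, z)"
        by (simp add: multi_deriv_snd[of _ _ _ "0 :: 'r cspace"])
      also have "\<dots> = 0" by (subst mixed_deriv_diff[of _ UNIV]) auto
      finally show ?thesis .
    qed
    then show ?case by (auto simp: partial_sum_def taylor_coeff_def)
  next
    case (step g a k)
    obtain n0 where n0: "\<And>n w z. n \<ge> n0 \<Longrightarrow> partial_sum N n g w \<zeta> z =
      g (w, z)" using step.IH by blast
    have hol_g: "holomorphic_several (\<lambda>p :: ('r, 'd) cpoint. g (w, snd p)) UNIV" for w
      using step.IH by blast
    obtain i where i: "N i = k" using N by (metis bij_pointE)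
    have coeff: "taylor_coeff m (\<lambda>p. a (fst p) * cmonom \<zeta> k (snd p) + g p) w \<zeta> =
      (if m = k then a w else 0) + taylor_coeff m g w \<zeta>" for m w
    proof -
      have "multi_deriv m (\<lambda>u. a w * cmonom \<zeta> k u + g (w, u)) \<zeta> =
        a w * multi_deriv m (cmonom \<zeta> k) \<zeta> + multi_deriv m (\<lambda>u. g (w, u)) \<zeta>"
        unfolding multi_deriv_snd[of _ _ _ w]
        by (rule mixed_deriv_lincomb[OF holomorphic_several_cmonom hol_g]) auto
      then show ?thesis
        by (simp add: taylor_coeff_def multi_deriv_cmonom add_divide_distrib)
    qed
    have "partial_sum N n (\<lambda>p. a (fst p) * cmonom \<zeta> k (snd p) + g p) w \<zeta> z =
      a w * cmonom \<zeta> k z + g (w, z)"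
      if n: "n \<ge> max n0 i" for n w z
    proof -
      have "(\<Sum>j\<le>n. (if N j = k then a w else 0) * cmonom \<zeta> (N j) z) =
        (\<Sum>j\<le>n. if j = i then a w * cmonom \<zeta> k z else 0)"
        using i N by (intro sum.cong) (auto simp: bij_def inj_def)
      also have "\<dots> = a w * cmonom \<zeta> k z" using n by simp
      finally show ?thesis using n0[of n w z] n
        by (simp add: partial_sum_cmonom coeff distrib_right sum.distrib)
    qed
    moreover have "holomorphic_several (\<lambda>p :: ('r, 'd) cpoint. a w * cmonom \<zeta> k (snd
      p) + g (w, snd p)) UNIV" for w
      by (intro holomorphic_several_add holomorphic_several_cmult holomorphic_several_cmonom hol_g)
    ultimately show ?case unfolding fst_conv snd_conv by blast
  qed
  then show ?thesis by blast
qed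

lemma taylor_coeff_mixed_deriv:
  "taylor_coeff m f w \<zeta> = mixed_deriv 0 m f (w, \<zeta>) / (\<Prod>i\<in>UNIV. fact (m $ i))"
  by (simp add: taylor_coeff_def multi_deriv_eq_mixed_deriv)

section \<open>Taylor sums as operators on holomorphic functions\<close>

locale taylor_setting =
  fixes G :: "'r::{finite,linorder} cspace set" and W :: "'d::{finite,linorder} cspace set"
    and \<zeta> :: "'d cspace" and N :: "nat \<Rightarrow> 'd mindex"
  assumes open_G: "open G" and open_W: "open W" and \<zeta>: "\<zeta> \<in> W" and N: "bij N"
begin

text \<open>A polynomial in \<open>z\<close>, hence considered on all of
  \<open>G \<times> UNIV\<close>, where it is to be compared with targets outside
  \<open>\<Omega>\<close>.\<close>

definition tsum :: "nat \<Rightarrow> (('r, 'd) cpoint \<Rightarrow> complex) \<Rightarrow> ('r, 'd)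
  cpoint \<Rightarrow> complex" where
  "tsum n f = (\<lambda>(w, z). partial_sum N n f w \<zeta> z)"

lemma open_GW: "open (G \<times> W)" and open_GU: "open (G \<times> UNIV)"
  using open_G open_W by (auto intro: open_Times)

lemma tsum_eq: "tsum n f p = (\<Sum>k\<le>n. inverse (\<Prod>i\<in>UNIV. fact (N k $ i)) *
  mixed_deriv 0 (N k) f (fst p, \<zeta>) * cmonom \<zeta> (N k) (snd p))"
  by (cases p) (simp add: tsum_def partial_sum_cmonom taylor_coeff_mixed_deriv divide_inverse mult_ac)

lemma holomorphic_several_tsum:
  assumes "holomorphic_several f (G \<times> W)"
  shows "holomorphic_several (tsum n f) (G \<times> UNIV)"
  unfolding tsum_eq[abs_def]
  by (intro holomorphic_several_sum holomorphic_several_mult holomorphic_several_const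
        holomorphic_several_cmonom
        holomorphic_several_freeze[OF holomorphic_several_mixed_deriv[OF assms open_GW]])
     (use \<zeta> in auto)

lemma tsum_lincomb:
  assumes "holomorphic_several f (G \<times> W)" "holomorphic_several g (G \<times> W)" "p \<in> G
    \<times> UNIV"
  shows "tsum n (\<lambda>p. c * f p + g p) p = c * tsum n f p + tsum n g p"
proof -
  have "mixed_deriv 0 m (\<lambda>p. c * f p + g p) (fst p, \<zeta>) =
    c * mixed_deriv 0 m f (fst p, \<zeta>) + mixed_deriv 0 m g (fst p, \<zeta>)" for m
    by (rule mixed_deriv_lincomb[OF assms(1,2) open_GW]) (use assms(3) \<zeta> in auto)
  then show ?thesis
    by (simp add: tsum_eq sum_distrib_left sum.distrib algebra_simps)
qed

lemma tsum_diff: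
  assumes "holomorphic_several f (G \<times> W)" "holomorphic_several g (G \<times> W)" "p \<in> G
    \<times> UNIV"
  shows "tsum n (\<lambda>p. f p - g p) p = tsum n f p - tsum n g p"
  using tsum_lincomb[OF assms(2,1,3), of n "-1"] by simp

lemma tsum_cong:
  assumes "\<And>q. q \<in> G \<times> W \<Longrightarrow> f q = g q" "p \<in> G \<times> UNIV"
  shows "tsum n f p = tsum n g p"
proof -
  have "mixed_deriv 0 m f (fst p, \<zeta>) = mixed_deriv 0 m g (fst p, \<zeta>)" for m
    by (rule mixed_deriv_cong[OF open_GW _ assms(1)]) (use assms(2) \<zeta> in auto)
  then show ?thesis by (simp add: tsum_eq)
qed

lemma tsum_polys:
  assumes "f \<in> polys"
  shows "\<exists>n0. \<forall>n\<ge>n0. tsum n f = f"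
  using partial_sum_polys[OF assms N, of \<zeta>] by (auto simp: tsum_def fun_eq_iff)

text \<open>Continuity of the linear map \<open>tsum n\<close> for fixed \<open>n\<close>. The
  coefficients are derivatives at the points \<open>(w, \<zeta>)\<close> with \<open>w\<close> in
  the compact projection of \<open>C\<close>, and the monomials are bounded on
  \<open>C\<close>.\<close>

lemma tsum_bound:
  assumes C: "compact C" "C \<subseteq> G \<times> UNIV"
  shows "\<exists>C' A. compact C' \<and> C' \<subseteq> G \<times> W \<and> A > 0 \<and>
    (\<forall>f B. holomorphic_several f (G \<times> W) \<longrightarrow> (\<forall>q\<in>C'. cmod
      (f q) \<le> B) \<longrightarrow> B \<ge> 0 \<longrightarrow>
       (\<forall>p\<in>C. cmod (tsum n f p) \<le> A * B))"
proof -
  define Cz where "Cz = fst ` C \<times> {\<zeta>}"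
  have C0: "compact Cz" "Cz \<subseteq> G \<times> W"
    using C \<zeta> unfolding Cz_def by (auto intro!: compact_Times compact_continuous_image
      continuous_on_fst continuous_on_id)
  have "\<exists>C' A. compact C' \<and> C' \<subseteq> G \<times> W \<and> A > 0 \<and>
     (\<forall>f B. holomorphic_several f (G \<times> W) \<longrightarrow>
       (\<forall>q\<in>C'. cmod (f q) \<le> B) \<longrightarrow> B \<ge> 0 \<longrightarrow>
       (\<forall>p\<in>C. cmod (inverse (\<Prod>i\<in>UNIV. fact (N k $ i)) * mixed_deriv 0 (N k) f
         (fst p, \<zeta>) * cmonom \<zeta> (N k) (snd p)) \<le> A * B))" for k
  proof -
    obtain C' A where C': "compact C'" "C' \<subseteq> G \<times> W" "A > 0"
      and *: "\<And>f B p. \<lbrakk>holomorphic_several f (G \<times> W); \<forall>q\<in>C'. cmod (f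
        q) \<le> B; p \<in> Cz\<rbrakk> \<Longrightarrow>
          cmod (mixed_deriv 0 (N k) f p) \<le> A * B"
      using mixed_deriv_bound[OF open_GW C0, of 0 "N k"] by blast
    have "compact ((\<lambda>p. cmonom \<zeta> (N k) (snd p)) ` C)"
      by (intro compact_continuous_image holomorphic_several_continuous holomorphic_several_cmonom C)
    then obtain M where M: "M > 0" "\<forall>p\<in>C. cmod (cmonom \<zeta> (N k) (snd p)) \<le> M"
      using compact_imp_bounded bounded_pos by (metis (no_types, lifting) imageI)
    define c where "c = cmod (inverse (\<Prod>i\<in>UNIV. fact (N k $ i)))"
    have c: "c > 0" by (simp add: c_def prod_zero_iff)
    have "cmod (inverse (\<Prod>i\<in>UNIV. fact (N k $ i)) * mixed_deriv 0 (N k) f (fst p, \<zeta>)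
      * cmonom \<zeta> (N k) (snd p)) \<le> (c * A * M) * B"
      if f: "holomorphic_several f (G \<times> W)" "\<forall>q\<in>C'. cmod (f q) \<le>
        B" "B \<ge> 0" and p: "p \<in> C" for f B p
    proof -
      have "cmod (mixed_deriv 0 (N k) f (fst p, \<zeta>)) \<le> A * B"
        by (rule *) (use f p Cz_def in auto)
      moreover have "cmod (cmonom \<zeta> (N k) (snd p)) \<le> M" using M(2) p by blast
      ultimately have "cmod (mixed_deriv 0 (N k) f (fst p, \<zeta>)) * cmod (cmonom \<zeta> (N k)
        (snd p)) \<le> A * B * M"
        by (rule mult_mono) (use C'(3) f(3) in auto)
      then have "c * (cmod (mixed_deriv 0 (N k) f (fst p, \<zeta>)) * cmod (cmonom \<zeta> (N k)
        (snd p))) \<le> c * (A * B * M)"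
        using c by (intro mult_left_mono) auto
      then show ?thesis unfolding norm_mult c_def[symmetric] by (simp add: mult_ac)
    qed
    moreover have "c * A * M > 0" using c C'(3) M(1) by simp
    ultimately show ?thesis using C'(1,2) by (intro exI[of _ C'] exI[of _ "c * A * M"]) blast
  qed
  then obtain C' A where 1: "\<And>k. compact (C' k)" "\<And>k. C' k \<subseteq> G \<times> W"
    "\<And>k::nat. A k > 0"
    and 2: "\<And>k f B p. \<lbrakk>holomorphic_several f (G \<times> W); \<forall>q\<in>C' k. cmod
      (f q) \<le> B; B \<ge> 0; p \<in> C\<rbrakk> \<Longrightarrow>
       cmod (inverse (\<Prod>i\<in>UNIV. fact (N k $ i)) * mixed_deriv 0 (N k) f (fst p, \<zeta>) *
         cmonom \<zeta> (N k) (snd p)) \<le> A k * B"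
    by metis
  show ?thesis
  proof (intro exI[of _ "\<Union>k\<le>n. C' k"] exI[of _ "\<Sum>k\<le>n. A k"] conjI allI impI ballI)
    show "compact (\<Union>k\<le>n. C' k)" by (intro compact_UN 1) auto
    show "(\<Union>k\<le>n. C' k) \<subseteq> G \<times> W" using 1 by blast
    show "(\<Sum>k\<le>n. A k) > 0" by (rule sum_pos) (use 1 in auto)
    show "cmod (tsum n f p) \<le> (\<Sum>k\<le>n. A k) * B"
      if f: "holomorphic_several f (G \<times> W)"
        and B: "\<forall>q\<in>(\<Union>k\<le>n. C' k). cmod (f q) \<le> B" "B \<ge> 0"
        and p: "p \<in> C" for f B p
      unfolding tsum_eq sum_distrib_right
    proof (rule sum_norm_le)
      fix k assume "k \<in> {..n}"
      then have "\<forall>q\<in>C' k. cmod (f q) \<le> B" using B(1) by blast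
      from 2[OF f this B(2) p]
      show "cmod (inverse (\<Prod>i\<in>UNIV. fact (N k $ i)) * mixed_deriv 0 (N k) f (fst p,
        \<zeta>) * cmonom \<zeta> (N k) (snd p)) \<le> A k * B" .
    qed
  qed
qed

end

subsection \<open>Compact sets with connected complement\<close>

text \<open>
  Given \<open>K\<close>, the components of \<open>\<infinity>\<close> in \<open>{z. |z| > n}
    \<union> \<Union>F\<close>, where \<open>F\<close> runs through the finite families
  of balls of a countable base, exhaust \<open>- K\<close>; their complements form the countable
    cofinal family.
\<close>

lemma countable_cofinal_compacts:
  obtains \<Q> :: "complex set set" where "countable \<Q>"
    "\<And>Q. Q \<in> \<Q> \<Longrightarrow> compact Q \<and> connected (- Q)"
    "\<And>K U. \<lbrakk>compact K; connected (- K); open U; K \<subseteq> U\<rbrakk> \<Longrightarrow>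
      \<exists>Q\<in>\<Q>. K \<subseteq> interior Q \<and> Q \<subseteq> U"
proof -
  obtain D :: "complex set" where D: "countable D" "\<And>X. \<lbrakk>open X; X \<noteq> {}\<rbrakk> \<Longrightarrow>
    \<exists>d\<in>D. d \<in> X"
    using countable_dense_setE by blast
  define B where "B = (\<lambda>(q, m). ball q (inverse (real (Suc m)))) ` (D \<times> UNIV)"
  have cB: "countable B" unfolding B_def by (intro countable_image countable_SIGMA D) auto
  define S where "S n F = {z. cmod z > real n} \<union> \<Union>F" for n :: nat and F :: "complex set set"
  \<comment> \<open>The component of infinity, represented by the finite point \<open>Suc n\<close>,
    which lies in the connected set of all \<open>z\<close> with \<open>cmod z > n\<close>.\<close>
  define W where "W n F = connected_component_set (S n F) (of_nat (Suc n))" for n F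
  have far: "connected {z :: complex. cmod z > real n}" for n
  proof -
    have "{z :: complex. cmod z > real n} = - cball 0 (real n)" by auto
    then show ?thesis by (simp add: connected_complement_bounded_convex)
  qed
  have W_far: "{z. cmod z > real n} \<subseteq> W n F" for n F
    unfolding W_def by (rule connected_component_maximal[OF _ far]) (auto simp: S_def norm_of_nat
      simp del: of_nat_Suc)
  have W_S: "W n F \<subseteq> S n F" for n F unfolding W_def by (rule connected_component_subset)
  have W_open: "open (W n F)" if "F \<subseteq> B" for n F
    unfolding W_def
  proof (rule open_connected_component)
    have "open {z :: complex. cmod z > real n}" by (intro open_Collect_less continuous_intros)
    moreover have "open b" if "b \<in> B" for b using that by (auto simp: B_def)
    then have "open (\<Union>F)" using \<open>F \<subseteq> B\<close> by (intro open_Union ballI) blast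
    ultimately show "open (S n F)" unfolding S_def by (intro open_Un)
  qed
  define \<Q> where "\<Q> = (\<lambda>(n, F). - W n F) ` (UNIV \<times> {F. F \<subseteq> B \<and>
    finite F})"
  show ?thesis
  proof
    show "countable \<Q>" unfolding \<Q>_def
      by (intro countable_image countable_SIGMA) (auto simp: conj_commute intro:
        countable_Collect_finite_subset[OF cB])
    show "compact Q \<and> connected (- Q)" if Q: "Q \<in> \<Q>" for Q
    proof -
      obtain n F where nF: "Q = - W n F" "F \<subseteq> B" using Q by (auto simp: \<Q>_def)
      have "\<not> cmod z > real n" if "z \<in> Q" for z using W_far[of n F] nF that by blast
      then have "Q \<subseteq> cball 0 (real n)" by (auto simp: not_less)
      then have "bounded Q" by (rule bounded_subset[OF bounded_cball])
      moreover have "closed Q" using W_open[OF nF(2)] nF(1) by (simp add: closed_Compl)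
      ultimately show ?thesis using nF(1)
        by (simp add: compact_eq_bounded_closed W_def connected_connected_component)
    qed
    show "\<exists>Q\<in>\<Q>. K \<subseteq> interior Q \<and> Q \<subseteq> U"
      if K: "compact K" "connected (- K)" and U: "open U" "K \<subseteq> U" for K U
    proof -
      obtain R where R: "\<And>z. z \<in> K \<Longrightarrow> cmod z \<le> R"
        using compact_imp_bounded[OF K(1)] bounded_iff by blast
      obtain n where n: "R < real n" using reals_Archimedean2 by blast
      have Kn: "K \<subseteq> ball 0 (real n)" using R n by force
      \<comment> \<open>Asking for the closures to avoid \<open>K\<close>, and not merely the balls,
        is what will place \<open>K\<close> in the interior of the complement of a finite
        union.\<close>
      define B' where "B' = {b \<in> B. closure b \<subseteq> - K}"
      have cB': "countable B'" using cB by (simp add: B'_def)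
      have base: "\<exists>b\<in>B'. y \<in> b" if y: "y \<in> - K" for y
      proof -
        obtain e where e: "e > 0" "ball y e \<subseteq> - K"
          using y K(1) compact_imp_closed open_contains_ball open_Compl by metis
        obtain m where m: "inverse (real (Suc m)) < e / 2" using e(1) reals_Archimedean[of "e/2"] by auto
        define r where "r = inverse (real (Suc m))"
        have r: "r > 0" "r < e / 2" using m by (auto simp: r_def)
        obtain q where q: "q \<in> D" "q \<in> ball y r" using D(2)[of "ball y r"] r by auto
        have "cball q r \<subseteq> ball y e" using q(2) r
          by (auto simp: cball_subset_ball_iff dist_commute)
        then have "closure (ball q r) \<subseteq> - K"
          using e(2) closure_minimal[OF ball_subset_cball closed_cball, of q r] by blast
        moreover have "ball q r \<in> B" unfolding B_def r_def using q(1) by auto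
        ultimately show ?thesis using q(2) by (auto simp: B'_def dist_commute intro!: bexI[of _ "ball q r"])
      qed
      have p0: "of_nat (Suc n) \<in> - K" using Kn
        by (auto simp: dist_norm norm_of_nat simp del: of_nat_Suc)
      then have B'_ne: "B' \<noteq> {}" using base by blast
      define F where "F m = from_nat_into B' ` {..m}" for m
      have F: "F m \<subseteq> B'" "finite (F m)" for m using from_nat_into[OF B'_ne] by (auto simp: F_def)
      have F_mono: "F m \<subseteq> F m'" if "m \<le> m'" for m m' using that by (auto simp: F_def)
      have F_B: "F m \<subseteq> B" for m using F(1)[of m] by (auto simp: B'_def)
      have S_K: "closure (S n (F m)) \<subseteq> - K" for m
      proof -
        have "closure {z :: complex. cmod z > real n} \<subseteq> {z. cmod z \<ge> real n}"
          by (rule closure_minimal) (auto intro!: closed_Collect_le continuous_intros)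
        moreover have "{z. cmod z \<ge> real n} \<subseteq> - K" using Kn by (auto simp: subset_iff)
        moreover have "closure (\<Union>(F m)) \<subseteq> (\<Union>b\<in>F m. closure b)"
          by (rule closure_minimal) (use closure_subset F(2) in \<open>auto intro!: closed_UN\<close>)
        moreover have "(\<Union>b\<in>F m. closure b) \<subseteq> - K" using F(1)[of m]
          unfolding B'_def by blast
        ultimately show ?thesis unfolding S_def closure_Un by blast
      qed
      have W_mono: "W n (F m) \<subseteq> W n (F m')" if "m \<le> m'" for m m'
        unfolding W_def by (rule connected_component_mono) (use F_mono[OF that] in \<open>auto simp:
          S_def\<close>)
      define V where "V = (\<Union>m. W n (F m))"
      have V: "open V" "V \<subseteq> - K" "V \<noteq> {}"
      proof -
        show "open V" unfolding V_def using W_open[OF F_B] by blast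
        show "V \<subseteq> - K" unfolding V_def using W_S S_K closure_subset by blast
        have "of_nat (Suc n) \<in> W n (F 0)" using W_far[of n "F 0"]
          by (force simp: norm_of_nat simp del: of_nat_Suc)
        then show "V \<noteq> {}" unfolding V_def by blast
      qed
      \<comment> \<open>A ball of \<open>B'\<close> that meets some \<open>W n (F m)\<close> is
        absorbed once it occurs in the finite family. So \<open>V\<close> is open and closed in
        \<open>- K\<close>, and connectedness gives \<open>V = - K\<close>.\<close>
      have "open (- K - V)"
      proof (subst open_subopen, intro ballI)
        fix y assume y: "y \<in> - K - V"
        then obtain b where b: "b \<in> B'" "y \<in> b" using base by blast
        then obtain k where k: "b = from_nat_into B' k" using cB' from_nat_into_surj by metis
        have bB: "open b" "connected b" using b(1) by (auto simp: B'_def B_def)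
        have "b \<inter> V = {}"
        proof (rule ccontr)
          assume "b \<inter> V \<noteq> {}"
          then obtain x m where x: "x \<in> b" "x \<in> W n (F m)" by (auto simp: V_def)
          define m' where "m' = max m k"
          have "b \<in> F m'" unfolding F_def m'_def k by auto
          then have bS: "b \<subseteq> S n (F m')" by (auto simp: S_def)
          have "x \<in> W n (F m')" using x(2) W_mono[of m m'] by (auto simp: m'_def)
          then have "W n (F m') = connected_component_set (S n (F m')) x"
            unfolding W_def using connected_component_eq by fastforce
          then have "b \<subseteq> W n (F m')" using connected_component_maximal[OF x(1) bB(2) bS] by simp
          then show False using y b(2) by (auto simp: V_def)
        qed
        then show "\<exists>T. open T \<and> y \<in> T \<and> T \<subseteq> - K - V"
          using b bB(1) closure_subset[of b] by (intro exI[of _ b]) (auto simp: B'_def)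
      qed
      then have V_eq: "V = - K"
        using connectedD[OF K(2) V(1)] V(2,3) by blast
      \<comment> \<open>Points of modulus above \<open>n\<close> lie in every
        \<open>W n (F m)\<close>; only this compact remainder of \<open>- U\<close> has to be
        covered, and monotonicity makes a single \<open>m\<close> suffice.\<close>
      have "compact (cball 0 (real n) - U)" by (intro compact_diff compact_cball U)
      moreover have "cball 0 (real n) - U \<subseteq> (\<Union>m. W n (F m))" using U(2) V_eq V_def by blast
      ultimately obtain I where I: "finite I" "cball 0 (real n) - U \<subseteq> (\<Union>m\<in>I. W
        n (F m))"
        using W_open[OF F_B] by (metis (no_types, lifting) compactE_image)
      define m where "m = Max (insert 0 I)"
      have "W n (F i) \<subseteq> W n (F m)" if "i \<in> I" for i
        by (rule W_mono) (use that I(1) in \<open>auto simp: m_def\<close>)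
      then have cov: "cball 0 (real n) - U \<subseteq> W n (F m)" using I(2) by blast
      show ?thesis
      proof (intro bexI[of _ "- W n (F m)"] conjI)
        show "- W n (F m) \<in> \<Q>" unfolding \<Q>_def using F_B F(2) by auto
        show "- W n (F m) \<subseteq> U"
        proof
          fix z assume z: "z \<in> - W n (F m)"
          then have "\<not> cmod z > real n" using W_far[of n "F m"] by blast
          then have "z \<in> cball 0 (real n)" by auto
          then show "z \<in> U" using z cov by blast
        qed
        show "K \<subseteq> interior (- W n (F m))"
          unfolding interior_complement using S_K[of m] closure_mono[OF W_S[of n "F m"]] by blast
      qed
    qed
  qed
qed

text \<open>The holes of a thickening \<open>D\<close> are filled in. They lie in \<open>G\<close>
  because \<open>inside G\<close> is empty for simply connected \<open>G\<close>; thickening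
  beforehand puts \<open>C\<close> into the interior.\<close>

lemma compact_fill_simply_connected:
  fixes G :: "complex set"
  assumes G: "open G" "simply_connected G" and C: "compact C" "C \<subseteq> G"
  obtains Q where "compact Q" "connected (- Q)" "C \<subseteq> interior Q" "Q \<subseteq> G"
proof -
  obtain e D where e: "e > 0" and D: "compact D" and DG: "D \<subseteq> G"
    and sub: "\<And>x. x \<in> C \<Longrightarrow> cball x e \<subseteq> D"
    using compact_thickening[OF C(1) G(1) C(2)] by blast
  have "C \<subseteq> interior D"
  proof
    fix x assume "x \<in> C"
    then have "ball x e \<subseteq> D" using sub ball_subset_cball by blast
    then show "x \<in> interior D" using e by (meson centre_in_ball interiorI open_ball)
  qed
  have "inside G = {}" using G simply_connected_eq_empty_inside by blast
  then have inG: "inside D \<subseteq> G" using inside_mono[OF DG] by blast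
  show ?thesis
  proof
    have eq: "- (D \<union> inside D) = outside D" by (simp add: union_with_inside)
    show "connected (- (D \<union> inside D))"
      unfolding eq using D by (simp add: connected_outside compact_imp_bounded)
    have "open (outside D)" using D compact_imp_closed open_outside by blast
    then have "closed (D \<union> inside D)" unfolding closed_def eq .
    then show "compact (D \<union> inside D)"
      using D by (simp add: compact_eq_bounded_closed bounded_inside)
    show "C \<subseteq> interior (D \<union> inside D)"
      using \<open>C \<subseteq> interior D\<close> interior_mono[of D "D \<union> inside D"] by blast
    show "D \<union> inside D \<subseteq> G" using DG inG by blast
  qed
qed

lemma box_prod_tube:
  fixes K :: "'d::finite \<Rightarrow> complex set"
  assumes K: "\<And>i. compact (K i)" and V: "open V" "box_prod K \<subseteq> V"
  obtains U where "\<And>i. open (U i)" "\<And>i. K i \<subseteq> U i" "box_prod U \<subseteq> V"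
proof -
  obtain e where e: "e > 0" "(\<Union>x\<in>box_prod K. cball x e) \<subseteq> V"
    using compact_subset_open_imp_cball_epsilon_subset[OF compact_box_prod[of K, OF K] V] by blast
  \<comment> \<open>The norm is at most the sum of the moduli of the coordinates, so an error
    \<open>\<delta>\<close> in each coordinate adds up to at most \<open>e\<close>.\<close>
  define \<delta> where "\<delta> = e / real CARD('d)"
  have \<delta>: "\<delta> > 0" using e by (simp add: \<delta>_def)
  define U where "U i = (\<Union>s\<in>K i. ball s \<delta>)" for i
  show ?thesis
  proof
    show "open (U i)" "K i \<subseteq> U i" for i using \<delta> by (auto simp: U_def)
    show "box_prod U \<subseteq> V"
    proof
      fix y assume "y \<in> box_prod U"
      then have "\<forall>i. \<exists>s\<in>K i. dist s (y $ i) < \<delta>"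
        by (auto simp: box_prod_def U_def)
      then obtain s where s: "\<And>i. s i \<in> K i" "\<And>i. dist (s i) (y $ i) < \<delta>" by metis
      define x where "x = (\<chi> i. s i)"
      have "norm (x - y) \<le> (\<Sum>i\<in>UNIV. cmod ((x - y) $ i))"
        unfolding norm_vec_def by (rule L2_set_le_sum) simp
      also have "\<dots> \<le> (\<Sum>i\<in>(UNIV :: 'd set). \<delta>)"
        by (rule sum_mono) (use s(2) in \<open>auto simp: x_def dist_norm less_imp_le\<close>)
      also have "\<dots> = e" by (simp add: \<delta>_def)
      finally have "y \<in> cball x e" by (simp add: dist_norm)
      moreover have "x \<in> box_prod K" using s(1) by (simp add: x_def box_prod_def)
      ultimately show "y \<in> V" using e(2) by blast
    qed
  qed
qed

subsection \<open>The space of holomorphic functions\<close>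

lemma HolI: "\<lbrakk>holomorphic_several f S; open S\<rbrakk> \<Longrightarrow>
  (\<lambda>p. if p \<in> S then f p else 0) \<in> Hol S"
  by (auto simp: Hol_def intro: holomorphic_several_cong)

lemma HolD: "f \<in> Hol S \<Longrightarrow> holomorphic_several f S"
  by (simp add: Hol_def)

lemma Hol_lincomb:
  assumes "f \<in> Hol S" "g \<in> Hol S"
  shows "(\<lambda>p. c * f p + g p) \<in> Hol S"
  using assms by (auto simp: Hol_def intro!: holomorphic_several_add holomorphic_several_cmult)

lemma openin_Hol_topD:
  assumes "openin (Hol_top S) A" "f \<in> A"
  obtains C e where "compact C" "C \<subseteq> S" "e > 0"
    "\<And>g. \<lbrakk>g \<in> Hol S; \<And>p. p \<in> C \<Longrightarrow> cmod (g p - f p) <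
      e\<rbrakk> \<Longrightarrow> g \<in> A"
proof -
  obtain C e where "compact C" "C \<subseteq> S" "e > 0" "{g \<in> Hol S. \<forall>p\<in>C. cmod (g
    p - f p) < e} \<subseteq> A"
    using assms unfolding openin_Hol_top by blast
  then show ?thesis using that[of C e] by blast
qed

section \<open>Density and Baire's theorem\<close>

definition Hol_dense ::
    "('r::finite, 'd::finite) cpoint set \<Rightarrow> (('r, 'd) cpoint \<Rightarrow> complex) set
      \<Rightarrow> bool" where
  "Hol_dense S A \<longleftrightarrow> (\<forall>f C e. f \<in> Hol S \<and> compact C \<and>
    C \<subseteq> S \<and> e > 0 \<longrightarrow>
     (\<exists>g\<in>A. \<forall>p\<in>C. cmod (g p - f p) < e))"

lemma Hol_denseD:
  "\<lbrakk>Hol_dense S A; f \<in> Hol S; compact C; C \<subseteq> S; e > 0\<rbrakk> \<Longrightarrow>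
    \<exists>g\<in>A. \<forall>p\<in>C. cmod (g p - f p) < e"
  by (simp add: Hol_dense_def)

lemma Hol_top_closure_dense:
  assumes A: "A \<subseteq> Hol S" and dense: "Hol_dense S A"
  shows "Hol_top S closure_of A = Hol S"
proof
  show "Hol_top S closure_of A \<subseteq> Hol S"
    using closure_of_subset_topspace[of "Hol_top S" A] by simp
  show "Hol S \<subseteq> Hol_top S closure_of A"
  proof
    fix f assume f: "f \<in> Hol S"
    show "f \<in> Hol_top S closure_of A"
      unfolding in_closure_of
    proof (intro conjI allI impI)
      show "f \<in> topspace (Hol_top S)" using f by simp
      fix T assume T: "f \<in> T \<and> openin (Hol_top S) T"
      obtain C e where C: "compact C" "C \<subseteq> S" "e > 0"
        "\<And>g. \<lbrakk>g \<in> Hol S; \<And>p. p \<in> C \<Longrightarrow> cmod (g p - f p) <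
          e\<rbrakk> \<Longrightarrow> g \<in> T"
        using openin_Hol_topD[of S T f] T by blast
      obtain g where "g \<in> A" "\<forall>p\<in>C. cmod (g p - f p) < e"
        using Hol_denseD[OF dense f C(1-3)] by blast
      then show "\<exists>g. g \<in> A \<and> g \<in> T" using C(4) A by blast
    qed
  qed
qed

lemma compact_exhaustion:
  fixes S :: "'a::euclidean_space set"
  assumes "open S"
  shows "\<exists>E :: nat \<Rightarrow> 'a set. (\<forall>n. compact (E n) \<and> E n \<subseteq> S \<and>
    E n \<subseteq> E (Suc n)) \<and>
    (\<forall>K. compact K \<longrightarrow> K \<subseteq> S \<longrightarrow>
      (\<exists>m. \<forall>n\<ge>m. K \<subseteq> E n))"
proof (rule open_Union_compact_subsets[OF assms])
  fix E :: "nat \<Rightarrow> 'a set"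
  assume E: "\<And>n. compact (E n)" "\<And>n. E n \<subseteq> S" "\<And>n. E n \<subseteq> interior
    (E (Suc n))" "\<Union> (range E) = S"
    "\<And>K. \<lbrakk>compact K; K \<subseteq> S\<rbrakk> \<Longrightarrow>
      \<exists>N. \<forall>n\<ge>N. K \<subseteq> E n"
  have "E n \<subseteq> E (Suc n)" for n using E(3) interior_subset by blast
  then show ?thesis using E(1,2,5) by (intro exI[of _ E]) simp
qed

text \<open>One step of the nested-ball argument. A closed ball is given by a centre, a compact set
  and a radius; the new one lies in \<open>V\<close> and inside the old one, and its compact set
  also swallows \<open>E\<close>.\<close>

lemma Hol_Baire_step:
  fixes S :: "('r::finite, 'd::finite) cpoint set"
  assumes V: "openin (Hol_top S) V"
    and dense: "Hol_dense S V"
    and f: "f \<in> Hol S" and D: "compact D" "D \<subseteq> S" "\<delta> > 0"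
      and E: "compact E" "E \<subseteq> S" and t: "\<tau> > 0"
  shows "\<exists>g D' \<delta>'. g \<in> Hol S \<and> compact D' \<and> D' \<subseteq> S \<and> 0 <
    \<delta>' \<and> \<delta>' \<le> \<tau> \<and> \<delta>' \<le> \<delta> \<and> D \<subseteq> D' \<and>
    E \<subseteq> D' \<and>
     (\<forall>p\<in>D. cmod (g p - f p) + \<delta>' \<le> \<delta>) \<and>
     (\<forall>h\<in>Hol S. (\<forall>p\<in>D'. cmod (h p - g p) \<le> \<delta>') \<longrightarrow>
       h \<in> V)"
proof -
  obtain g where g: "g \<in> V" "\<forall>p\<in>D. cmod (g p - f p) < \<delta> / 2"
    using Hol_denseD[OF dense f D(1,2), of "\<delta>/2"] D(3) by auto
  have gH: "g \<in> Hol S" using V g(1) openin_subset by fastforce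
  obtain C e where C: "compact C" "C \<subseteq> S" "e > 0"
    "\<And>h. \<lbrakk>h \<in> Hol S; \<And>p. p \<in> C \<Longrightarrow> cmod (h p - g p) <
      e\<rbrakk> \<Longrightarrow> h \<in> V"
    using openin_Hol_topD[OF V g(1)] by blast
  \<comment> \<open>Half of \<open>\<delta>\<close> because \<open>g\<close> has already moved by
    less than \<open>\<delta> / 2\<close> from \<open>f\<close>; half of \<open>e\<close> because
    membership in \<open>V\<close> needs a strict inequality.\<close>
  define \<delta>' where "\<delta>' = min (min \<tau> (\<delta> / 2)) (e / 2)"
  have \<delta>': "0 < \<delta>'" "\<delta>' \<le> \<tau>" "\<delta>' \<le> \<delta> / 2" "\<delta>' <
    e" using t D(3) C(3) by (auto simp: \<delta>'_def)
  have 1: "cmod (g p - f p) + \<delta>' \<le> \<delta>" if "p \<in> D" for p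
    using g(2)[rule_format, OF that] \<delta>'(3) by linarith
  have 2: "h \<in> V" if "h \<in> Hol S" "\<forall>p\<in>D \<union> E \<union> C. cmod (h p - g p) \<le>
    \<delta>'" for h
    using that \<delta>'(4) by (intro C(4)) force+
  show ?thesis
    using gH C(1,2) D E \<delta>' 1 2
    by (intro exI[of _ g] exI[of _ "D \<union> E \<union> C"] exI[of _ \<delta>']) auto
qed

text \<open>The centres of nested balls converge locally uniformly, since the radii tend to 0 and
  the compact sets absorb the exhaustion \<open>E\<close>. Completeness of the space is the theorem
  on uniform limits.\<close>

lemma Hol_Baire:
  fixes S :: "('r::finite, 'd::finite) cpoint set"
  assumes S: "open S"
    and op: "\<And>k::nat. openin (Hol_top S) (V k)"
    and dense: "\<And>k. Hol_dense S (V k)"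
  shows "Hol_dense S (Hol S \<inter> (\<Inter>k. V k))"
  unfolding Hol_dense_def
proof (intro allI impI, elim conjE)
  fix f C and e :: real
  assume f: "f \<in> Hol S" and C: "compact C" "C \<subseteq> S" "e > 0"
  obtain E :: "nat \<Rightarrow> (('r, 'd) cpoint) set"
    where E: "\<And>n. compact (E n)" "\<And>n. E n \<subseteq> S"
    "\<And>K. \<lbrakk>compact K; K \<subseteq> S\<rbrakk> \<Longrightarrow>
      \<exists>N. \<forall>n\<ge>N. K \<subseteq> E n"
    using compact_exhaustion[OF S] by auto
  define P where "P x \<longleftrightarrow> fst x \<in> Hol S \<and> compact (fst (snd x)) \<and>
    fst (snd x) \<subseteq> S \<and> 0 < snd (snd x)"
    for x :: "(('r, 'd) cpoint \<Rightarrow> complex) \<times> ('r, 'd) cpoint set \<times> real"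
  define R where "R k x y \<longleftrightarrow> snd (snd y) \<le> inverse (real (Suc k)) \<and>
    snd (snd y) \<le> snd (snd x) \<and>
      fst (snd x) \<subseteq> fst (snd y) \<and> E k \<subseteq> fst (snd y) \<and>
      (\<forall>p\<in>fst (snd x). cmod (fst y p - fst x p) + snd (snd y) \<le> snd (snd x)) \<and>
      (\<forall>h\<in>Hol S. (\<forall>p\<in>fst (snd y). cmod (h p - fst y p) \<le> snd (snd y)) \<longrightarrow>
        h \<in> V k)"
    for k :: nat and x y :: "(('r, 'd) cpoint \<Rightarrow> complex) \<times> ('r, 'd) cpoint set
      \<times> real"
  have stepP: "\<exists>y. P y \<and> R k x y" if x: "P x" for x k
  proof -
    have xs: "fst x \<in> Hol S" "compact (fst (snd x))" "fst (snd x) \<subseteq> S" "0 < snd (snd x)"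
      using x by (auto simp: P_def)
    have "0 < inverse (real (Suc k))" by simp
    from Hol_Baire_step[OF op dense xs E(1,2) this, of k k] obtain g D' \<delta>' where
      "g \<in> Hol S \<and> compact D' \<and> D' \<subseteq> S \<and> 0 < \<delta>' \<and> \<delta>' \<le>
        inverse (real (Suc k)) \<and> \<delta>' \<le> snd (snd x) \<and> fst (snd x) \<subseteq> D' \<and>
        E k \<subseteq> D' \<and>
     (\<forall>p\<in>fst (snd x). cmod (g p - fst x p) + \<delta>' \<le> snd (snd x)) \<and>
     (\<forall>h\<in>Hol S. (\<forall>p\<in>D'. cmod (h p - g p) \<le> \<delta>') \<longrightarrow>
       h \<in> V k)" by (elim exE)
    then show ?thesis by (intro exI[of _ "(g, D', \<delta>')"]) (simp add: P_def R_def)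
  qed
  \<comment> \<open>The limit satisfies only a non-strict bound by the initial radius, so the latter
    is taken smaller than \<open>e\<close>.\<close>
  have "P (f, C, e / 2)" using f C by (simp add: P_def)
  then obtain X where X: "X 0 = (f, C, e / 2)" "\<And>k. P (X k)" "\<And>k. R k (X k) (X (Suc k))"
    using dependent_nat_choice[of "\<lambda>k x. P x \<and> (k = 0 \<longrightarrow> x =
      (f, C, e / 2))" R] stepP by (metis nat.distinct(2))
  define F D d where "F k = fst (X k)" and "D k = fst (snd (X k))" and "d k = snd (snd (X k))" for k
  have FD: "F k \<in> Hol S" "compact (D k)" "D k \<subseteq> S" "0 < d k" for k
    using X(2)[of k] by (auto simp: P_def F_def D_def d_def)
  have step: "d (Suc k) \<le> inverse (real (Suc k))" "d (Suc k) \<le>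
    d k" "D k \<subseteq> D (Suc k)" "E k \<subseteq> D (Suc k)"
     "\<And>p. p \<in> D k \<Longrightarrow> cmod (F (Suc k) p - F k p) + d (Suc k) \<le> d k"
     "\<And>h. \<lbrakk>h \<in> Hol S; \<forall>p\<in>D (Suc k). cmod (h p - F (Suc k) p) \<le>
       d (Suc k)\<rbrakk> \<Longrightarrow> h \<in> V k" for k
    using X(3)[of k] unfolding R_def F_def D_def d_def by blast+
  \<comment> \<open>Including the remaining radius \<open>d (k + j)\<close> on the left makes the
    inequality telescope.\<close>
  have dist: "cmod (F (k + j) p - F k p) + d (k + j) \<le> d k"
    and mono: "D k \<subseteq> D (k + j)" if p: "p \<in> D k" for k j p
  proof -
    have "D k \<subseteq> D (k + j) \<and> cmod (F (k + j) p - F k p) + d (k + j) \<le> d k"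
    proof (induction j)
      case (Suc j)
      then have "p \<in> D (k + j)" using p by blast
      from step(5)[OF this] Suc norm_triangle_ineq[of "F (Suc (k + j)) p - F (k + j) p" "F (k + j) p
        - F k p"] step(3)[of "k + j"]
      show ?case by auto
    qed simp
    then show "cmod (F (k + j) p - F k p) + d (k + j) \<le> d k" "D k \<subseteq> D (k + j)" by auto
  qed
  have in_D: "\<exists>k0. \<forall>k\<ge>k0. K \<subseteq> D (Suc k)"
    if "compact K" "K \<subseteq> S" for K
    using E(3)[OF that] step(4) by (meson order_trans)
  have "\<exists>l. (\<lambda>k. F k p) \<longlonglongrightarrow> l" if p: "p \<in> S" for p
  proof -
    have "Cauchy (\<lambda>k. F k p)"
    proof (rule metric_CauchyI)
      fix \<epsilon> :: real assume "\<epsilon> > 0"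
      then obtain m where m: "inverse (real (Suc m)) < \<epsilon> / 2"
        using reals_Archimedean[of "\<epsilon>/2"] by auto
      obtain k0 where k0: "\<forall>k\<ge>k0. {p} \<subseteq> D (Suc k)" using in_D[of "{p}"] p by auto
      define k where "k = Suc (max m k0)"
      have pk: "p \<in> D k" using k0 by (auto simp: k_def)
      have "inverse (real (Suc (max m k0))) \<le> inverse (real (Suc m))" by (rule le_imp_inverse_le) auto
      then have dk: "d k < \<epsilon> / 2" using step(1)[of "max m k0"] m unfolding k_def by linarith
      have "dist (F i p) (F k p) < \<epsilon> / 2" if "i \<ge> k" for i
        using dist[OF pk, of "i - k"] that dk FD(4)[of i] by (simp add: dist_norm)
      then have "dist (F i p) (F j p) < \<epsilon>" if "i \<ge> k" "j \<ge> k" for i j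
        using that dist_triangle_half_l by blast
      then show "\<exists>M. \<forall>m\<ge>M. \<forall>n\<ge>M. dist (F m p) (F n p) < \<epsilon>" by blast
    qed
    then show ?thesis using Cauchy_convergent_iff convergent_def by blast
  qed
  then obtain g0 where g0: "\<And>p. p \<in> S \<Longrightarrow> (\<lambda>k. F k p)
    \<longlonglongrightarrow> g0 p" by metis
  have lim: "cmod (g0 p - F k p) \<le> d k" if p: "p \<in> D k" for k p
  proof (rule LIMSEQ_le_const2)
    show "(\<lambda>j. cmod (F j p - F k p)) \<longlonglongrightarrow> cmod (g0 p - F k p)"
      using g0[of p] p FD(3) by (intro tendsto_intros) auto
    show "\<exists>N. \<forall>j\<ge>N. cmod (F j p - F k p) \<le> d k"
    proof (intro exI[of _ k] allI impI)
      fix j assume "k \<le> j"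
      then show "cmod (F j p - F k p) \<le> d k"
        using dist[OF p, of "j - k"] FD(4)[of j] by simp
    qed
  qed
  have "holomorphic_several g0 S"
  proof (rule holomorphic_several_uniform_limit)
    show "holomorphic_several (F n) S" for n by (rule HolD[OF FD(1)])
    fix p assume "p \<in> S"
    then obtain r where r: "r > 0" "cball p r \<subseteq> S" using S open_contains_cball by blast
    obtain k0 where k0: "\<forall>k\<ge>k0. cball p r \<subseteq> D (Suc k)"
      using in_D[OF compact_cball r(2)] by blast
    have "uniform_limit (cball p r) F g0 sequentially"
    proof (rule uniform_limitI)
      fix \<epsilon> :: real assume "\<epsilon> > 0"
      then obtain m where m: "inverse (real (Suc m)) < \<epsilon>" using reals_Archimedean by blast
      have "dist (F n q) (g0 q) < \<epsilon>" if n: "n \<ge> Suc (max m k0)"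
        and q: "q \<in> cball p r" for n q
      proof -
        obtain k where k: "n = Suc k" "k \<ge> m" "k \<ge> k0" using n by (cases n) auto
        have "inverse (real (Suc k)) \<le> inverse (real (Suc m))"
          by (rule le_imp_inverse_le) (use k in auto)
        then have "d n < \<epsilon>" using step(1)[of k] m unfolding k(1) by linarith
        moreover have "q \<in> D n" using k0 k q by blast
        ultimately show ?thesis using lim[of q n] by (simp add: dist_norm norm_minus_commute)
      qed
      then show "\<forall>\<^sub>F n in sequentially. \<forall>q\<in>cball p r. dist (F n q) (g0 q) <
        \<epsilon>"
        unfolding eventually_sequentially by blast
    qed
    with r show "\<exists>r>0. cball p r \<subseteq> S \<and> uniform_limit (cball p r) F g0
      sequentially" by blast
  qed
  define g where "g p = (if p \<in> S then g0 p else 0)" for p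
  have gH: "g \<in> Hol S" unfolding g_def[abs_def]
    by (rule HolI[OF \<open>holomorphic_several g0 S\<close> S])
  have lim': "cmod (g p - F k p) \<le> d k" if "p \<in> D k" for k p
    using lim[OF that] FD(3)[of k] that by (auto simp: g_def)
  have "g \<in> V k" for k by (rule step(6)[OF gH]) (use lim' in blast)
  moreover have "cmod (g p - f p) < e" if "p \<in> C" for p
    using lim'[of p 0] that X(1) C(3) by (simp add: F_def D_def d_def)
  ultimately show "\<exists>g\<in>Hol S \<inter> (\<Inter>k. V k). \<forall>p\<in>C. cmod (g p - f p) < e"
    using gH by (intro bexI[of _ g]) auto
qed

text \<open>With non-strict bounds the condition on a supremum becomes a condition on points. It
  also covers empty sets and sequences whose first suprema are infinite.\<close>

lemma ennreal_SUP_tendsto_0_iff: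
  fixes c :: "nat \<Rightarrow> 'a \<Rightarrow> 'b \<Rightarrow> real"
  assumes nn: "\<And>n w z. c n w z \<ge> 0"
  shows "(\<lambda>n. SUP w\<in>L. SUP z\<in>K. ennreal (c n w z)) \<longlonglongrightarrow> 0
    \<longleftrightarrow>
     (\<forall>e>0. \<exists>n0. \<forall>n\<ge>n0. \<forall>w\<in>L. \<forall>z\<in>K. c n w z \<le> e)"
proof -
  define s where "s n = (SUP w\<in>L. SUP z\<in>K. ennreal (c n w z))" for n
  have le: "s n \<le> ennreal e \<longleftrightarrow> (\<forall>w\<in>L. \<forall>z\<in>K. c n w z \<le>
    e)" if "e > 0" for n e
    using that nn by (auto simp: s_def SUP_le_iff ennreal_le_iff)
  have "s \<longlonglongrightarrow> 0 \<longleftrightarrow> (\<forall>e>0. \<exists>n0.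
    \<forall>n\<ge>n0. s n \<le> ennreal e)"
  proof
    assume "s \<longlonglongrightarrow> 0"
    then have "\<forall>\<^sub>F n in sequentially. s n < ennreal e" if "e > 0" for e
      using that by (intro order_tendstoD(2)) auto
    then show "\<forall>e>0. \<exists>n0. \<forall>n\<ge>n0. s n \<le> ennreal e"
      unfolding eventually_sequentially by (meson less_imp_le)
  next
    assume R: "\<forall>e>0. \<exists>n0. \<forall>n\<ge>n0. s n \<le> ennreal e"
    show "s \<longlonglongrightarrow> 0"
    proof (rule order_tendstoI)
      fix a :: ennreal assume "0 < a"
      \<comment> \<open>As \<open>a\<close> may be infinite, a number strictly below it is chosen,
        which is then given by a real number.\<close>
      then obtain b where b: "0 < b" "b < a" using dense by blast
      define e where "e = enn2real b"
      have be: "b = ennreal e" using b using order_less_le_trans[OF b(2) top_greatest]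
        by (simp add: e_def ennreal_enn2real)
      have "e > 0" using b(1) be by simp
      then obtain n0 where "\<forall>n\<ge>n0. s n \<le> ennreal e" using R by blast
      then show "\<forall>\<^sub>F n in sequentially. s n < a"
        unfolding eventually_sequentially using b(2) be by (metis order_le_less_trans)
    qed simp
  qed
  also have "\<dots> \<longleftrightarrow> (\<forall>e>0. \<exists>n0. \<forall>n\<ge>n0.
    \<forall>w\<in>L. \<forall>z\<in>K. c n w z \<le> e)"
    using le by simp
  finally show ?thesis unfolding s_def .
qed

subsection \<open>Universality\<close>

lemma mixed_deriv_bound_finite:
  fixes C :: "('r::{finite,linorder}, 'd::{finite,linorder}) cpoint set"
  assumes S: "open S" "compact C" "C \<subseteq> S" and fin: "finite \<D>"
  shows "\<exists>C' A. compact C' \<and> C' \<subseteq> S \<and> A > 0 \<and>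
    (\<forall>f B. holomorphic_several f S \<longrightarrow> (\<forall>q\<in>C'. cmod (f q) \<le> B) \<longrightarrow>
      B \<ge> 0 \<longrightarrow>
       (\<forall>(a, b)\<in>\<D>. \<forall>p\<in>C. cmod (mixed_deriv a b f p) \<le> A * B))"
  using fin
proof induction
  case empty
  show ?case by (intro exI[of _ "{}"] exI[of _ "1::real"]) auto
next
  case (insert d \<D>)
  obtain a b where d: "d = (a, b)" by (cases d)
  obtain C1 A1 where 1: "compact C1" "C1 \<subseteq> S" "A1 > 0"
    "\<And>f B. \<lbrakk>holomorphic_several f S; \<forall>q\<in>C1. cmod (f q) \<le>
      B; B \<ge> 0\<rbrakk> \<Longrightarrow>
       (\<forall>(a, b)\<in>\<D>. \<forall>p\<in>C. cmod (mixed_deriv a b f p) \<le> A1 * B)"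
    using insert.IH by blast
  obtain C2 A2 where 2: "compact C2" "C2 \<subseteq> S" "A2 > 0"
    "\<And>f B. \<lbrakk>holomorphic_several f S; \<forall>q\<in>C2. cmod (f q) \<le>
      B\<rbrakk> \<Longrightarrow>
       (\<forall>p\<in>C. cmod (mixed_deriv a b f p) \<le> A2 * B)"
    using mixed_deriv_bound[OF S, of a b] by blast
  define A where "A = max A1 A2"
  have "cmod (mixed_deriv a' b' f p) \<le> A * B"
    if f: "holomorphic_several f S" "\<forall>q\<in>C1 \<union> C2. cmod (f q) \<le> B" "B \<ge> 0"
      and ab: "(a', b') \<in> insert d \<D>" and p: "p \<in> C" for f B a' b' p
  proof -
    have AB: "A1 * B \<le> A * B" "A2 * B \<le> A * B"
      using f(3) by (auto simp: A_def intro: mult_right_mono)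
    have f1: "\<forall>q\<in>C1. cmod (f q) \<le> B" and f2: "\<forall>q\<in>C2. cmod (f q) \<le> B"
      using f(2) by auto
    show ?thesis
    proof (cases "(a', b') = d")
      case True
      then show ?thesis using 2(4)[OF f(1) f2] p AB(2) d by fastforce
    next
      case False
      then show ?thesis using 1(4)[OF f(1) f1 f(3)] p AB(1) ab by fastforce
    qed
  qed
  moreover have "A > 0" using 1(3) by (simp add: A_def)
  ultimately show ?case using 1(1,2) 2(1,2)
    by (intro exI[of _ "C1 \<union> C2"] exI[of _ A]) (auto simp: case_prod_beta)
qed

text \<open>The coordinate projections of \<open>C\<close> are filled one by one, so that an
  arbitrary compact set is surrounded by a box to which Runge's theorem applies.\<close>

lemma box_fill:
  fixes A :: "'n::finite \<Rightarrow> complex set"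
  assumes A: "\<And>i. simply_connected_domain (A i)" and C: "compact C" "C \<subseteq> box_prod A"
  shows "\<exists>P. \<forall>i. compact (P i) \<and> connected (- P i) \<and> P i \<subseteq> A i \<and>
    (\<forall>w\<in>C. w $ i \<in> interior (P i))"
proof (intro choice allI)
  fix i
  have "compact ((\<lambda>w. w $ i) ` C)" by (intro compact_continuous_image C continuous_intros)
  moreover have "(\<lambda>w. w $ i) ` C \<subseteq> A i" using C(2) by (auto simp: box_prod_def)
  ultimately obtain Q where "compact Q" "connected (- Q)" "(\<lambda>w. w $ i) ` C \<subseteq>
    interior Q" "Q \<subseteq> A i"
    using compact_fill_simply_connected[of "A i"] A[of i] unfolding simply_connected_domain_def by metis
  then show "\<exists>P. compact P \<and> connected (- P) \<and> P \<subseteq> A i \<and>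
    (\<forall>w\<in>C. w $ i \<in> interior P)"
    by (intro exI[of _ Q]) auto
qed

lemma eventually_range_strict_mono:
  assumes "strict_mono (l :: nat \<Rightarrow> nat)"
  shows "(\<exists>n0. \<forall>n\<in>range l. n \<ge> n0 \<longrightarrow> P n) \<longleftrightarrow>
    (\<exists>n0. \<forall>n\<ge>n0. P (l n))"
proof
  assume "\<exists>n0. \<forall>n\<in>range l. n \<ge> n0 \<longrightarrow> P n"
  then obtain n0 where "\<forall>n\<in>range l. n \<ge> n0 \<longrightarrow> P n" by blast
  then have "\<forall>n\<ge>n0. P (l n)" using seq_suble[OF assms] by (meson order_trans rangeI)
  then show "\<exists>n0. \<forall>n\<ge>n0. P (l n)" by blast
next
  assume "\<exists>n0. \<forall>n\<ge>n0. P (l n)"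
  then obtain n0 where "\<forall>n\<ge>n0. P (l n)" by blast
  then have "\<forall>n\<in>range l. n \<ge> l n0 \<longrightarrow> P n"
    using strict_mono_less_eq[OF assms] by auto
  then show "\<exists>n0. \<forall>n\<in>range l. n \<ge> n0 \<longrightarrow> P n" by blast
qed

lemma ex_ge_conj:
  "(\<exists>n0 :: nat. \<forall>n\<ge>n0. P n \<and> Q n) \<longleftrightarrow>
    (\<exists>n0. \<forall>n\<ge>n0. P n) \<and> (\<exists>n0. \<forall>n\<ge>n0. Q n)"
  using eventually_conj_iff[of P Q sequentially] by (simp only: eventually_sequentially)

text \<open>The exhaustions \<open>L\<close> and \<open>M\<close>, the dense sequence
  \<open>\<kappa>\<close> of coefficients and the cofinal family \<open>\<Q>\<close> are fixed once
  and for all; they index the countably many conditions.\<close>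

locale universal_setting =
  taylor_setting "box_prod Gs" "box_prod \<Omega>s" \<zeta> N
  for Gs :: "'r::{finite,linorder} \<Rightarrow> complex set"
    and \<Omega>s :: "'d::{finite,linorder} \<Rightarrow> complex set"
    and \<zeta> N +
  fixes L :: "nat \<Rightarrow> 'r cspace set" and M :: "nat \<Rightarrow> 'd cspace set"
    and \<kappa> :: "nat \<Rightarrow> complex" and \<Q> :: "complex set set"
  assumes sc_G: "\<And>i. simply_connected_domain (Gs i)"
    and sc_\<Omega>: "\<And>i. simply_connected_domain (\<Omega>s i)"
    and L: "\<And>n. compact (L n)" "\<And>n. L n \<subseteq> box_prod Gs" "\<And>n. L n \<subseteq>
      L (Suc n)"
      "\<And>C. \<lbrakk>compact C; C \<subseteq> box_prod Gs\<rbrakk> \<Longrightarrow>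
        \<exists>m. \<forall>n\<ge>m. C \<subseteq> L n"
    and M: "\<And>n. compact (M n)" "\<And>n. M n \<subseteq> box_prod \<Omega>s" "\<And>n. M n
      \<subseteq> M (Suc n)"
      "\<And>C. \<lbrakk>compact C; C \<subseteq> box_prod \<Omega>s\<rbrakk> \<Longrightarrow>
        \<exists>m. \<forall>n\<ge>m. C \<subseteq> M n"
    and \<kappa>: "closure (range \<kappa>) = UNIV"
    and \<Q>: "countable \<Q>" "\<And>Q. Q \<in> \<Q> \<Longrightarrow> compact Q \<and> connected (- Q)"
      "\<And>K U. \<lbrakk>compact K; connected (- K); open U; K \<subseteq> U\<rbrakk> \<Longrightarrow>
        \<exists>Q\<in>\<Q>. K \<subseteq> interior Q \<and> Q \<subseteq> U"
begin

abbreviation "G \<equiv> box_prod Gs"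
abbreviation "W \<equiv> box_prod \<Omega>s"
abbreviation "H \<equiv> Hol (G \<times> W)"
abbreviation "\<U> \<nu> \<equiv> universal_class N \<nu> G \<Omega>s \<zeta>"

lemma L_mono: "m \<le> n \<Longrightarrow> L m \<subseteq> L n" using L(3) by (rule lift_Suc_mono_le)
lemma M_mono: "m \<le> n \<Longrightarrow> M m \<subseteq> M n" using M(3) by (rule lift_Suc_mono_le)

lemma peval_polys: "peval \<kappa> t \<in> polys"
proof -
  have "peval \<kappa> t = peval (\<lambda>c. c) (map_pexp \<kappa> id id t)" by (induction t) auto
  then show ?thesis by (simp add: polys_def)
qed

definition admissible :: "('d \<Rightarrow> complex set) \<Rightarrow> bool" where
  "admissible K \<longleftrightarrow> (\<forall>i. compact (K i) \<and> connected (- K i)) \<and>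
    (\<exists>i. \<Omega>s i \<inter> K i = {})"

text \<open>Convergence along a set of indices in place of a sequence: sets can be shrunk again and
  again without reindexing, as the construction of the vector space requires.\<close>

definition conv_along ::
    "nat set \<Rightarrow> (('r, 'd) cpoint \<Rightarrow> complex) \<Rightarrow> ('d \<Rightarrow>
      complex set) \<Rightarrow> (('r, 'd) cpoint \<Rightarrow> complex) \<Rightarrow> bool" where
  "conv_along \<nu> f K h \<longleftrightarrow> (\<forall>C D a b e. compact C \<and>
    C \<subseteq> G \<and> compact D \<and> D \<subseteq> W \<and> 0 < e \<longrightarrow>
     (\<exists>n0. \<forall>n\<in>\<nu>. n \<ge> n0 \<longrightarrow>
        (\<forall>w\<in>C. \<forall>z\<in>box_prod K. cmod (mixed_deriv a b (\<lambda>p. tsum n f p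
          - h p) (w, z)) \<le> e) \<and>
        (\<forall>w\<in>C. \<forall>z\<in>D. cmod (tsum n f (w, z) - f (w, z)) \<le> e)))"

lemma conv_along_range:
  assumes l: "strict_mono l"
  shows "conv_along (range l) f K h \<longleftrightarrow>
    (\<forall>C D a b. compact C \<and> C \<subseteq> G \<and> compact D \<and>
      D \<subseteq> W \<longrightarrow>
       (\<lambda>n. SUP w\<in>C. SUP z\<in>box_prod K. ennreal (cmod
          (mixed_deriv a b (\<lambda>(w', z'). partial_sum N (l n) f w' \<zeta> z' - h (w', z')) (w,
            z)))) \<longlonglongrightarrow> 0 \<and>
       (\<lambda>n. SUP w\<in>C. SUP z\<in>D. ennreal (cmod (partial_sum N (l n) f w \<zeta> z - f
         (w, z)))) \<longlonglongrightarrow> 0)"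
proof -
  have 1: "(\<lambda>(w', z'). partial_sum N n f w' \<zeta> z' - h (w', z')) =
    (\<lambda>p. tsum n f p - h p)" for n
    by (auto simp: tsum_def)
  have 2: "partial_sum N n f w \<zeta> z = tsum n f (w, z)" for n w z by (simp add: tsum_def)
  show ?thesis
    unfolding conv_along_def 1 unfolding 2 eventually_range_strict_mono[OF l]
      ennreal_SUP_tendsto_0_iff[OF norm_ge_zero]
  proof (intro iffI allI impI, goal_cases)
    case (1 C D a b)
    then show ?case by (meson)
  next
    case (2 C D a b e)
    then show ?case unfolding ex_ge_conj using 2(1)[rule_format, of C D a b] 2(2) by simp
  qed
qed

lemma universal_class_iff:
  "f \<in> \<U> \<nu> \<longleftrightarrow> f \<in> H \<and>
     (\<forall>K V h. admissible K \<and> open V \<and> box_prod K \<subseteq> V \<and>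
       holomorphic_several h (G \<times> V) \<longrightarrow>
        (\<exists>\<nu>'\<subseteq>\<nu>. infinite \<nu>' \<and> conv_along \<nu>' f K h))"
proof -
  have eq: "(\<exists>l :: nat \<Rightarrow> nat. strict_mono l \<and> range l \<subseteq> \<nu> \<and>
    conv_along (range l) f K h) \<longleftrightarrow>
     (\<exists>\<nu>'\<subseteq>\<nu>. infinite \<nu>' \<and> conv_along \<nu>' f K h)" for K h
  proof
    assume "\<exists>l :: nat \<Rightarrow> nat. strict_mono l \<and> range l \<subseteq> \<nu> \<and>
      conv_along (range l) f K h"
    then obtain l :: "nat \<Rightarrow> nat"
      where l: "strict_mono l" "range l \<subseteq> \<nu>" "conv_along (range l) f K h"
      by blast
    then have "infinite (range l)" by (intro range_inj_infinite strict_mono_imp_inj_on)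
    with l show "\<exists>\<nu>'\<subseteq>\<nu>. infinite \<nu>' \<and> conv_along \<nu>' f K h"
      by (intro exI[of _ "range l"]) simp
  next
    assume "\<exists>\<nu>'\<subseteq>\<nu>. infinite \<nu>' \<and> conv_along \<nu>' f K h"
    then obtain \<nu>' where "\<nu>' \<subseteq> \<nu>" "infinite \<nu>'" "conv_along \<nu>' f K h" by blast
    then show "\<exists>l :: nat \<Rightarrow> nat. strict_mono l \<and> range l \<subseteq> \<nu> \<and>
      conv_along (range l) f K h"
      by (intro exI[of _ "enumerate \<nu>'"]) (simp add: range_enumerate strict_mono_enumerate)
  qed
  have "(\<exists>l :: nat \<Rightarrow> nat. strict_mono l \<and> range l \<subseteq> \<nu> \<and>
      (\<forall>C D a b. compact C \<and> C \<subseteq> G \<and> compact D \<and>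
        D \<subseteq> W \<longrightarrow>
       (\<lambda>n. SUP w\<in>C. SUP z\<in>box_prod K. ennreal (cmod
          (mixed_deriv a b (\<lambda>(w', z'). partial_sum N (l n) f w' \<zeta> z' - h (w', z')) (w,
            z)))) \<longlonglongrightarrow> 0 \<and>
       (\<lambda>n. SUP w\<in>C. SUP z\<in>D. ennreal (cmod (partial_sum N (l n) f w \<zeta> z - f
         (w, z)))) \<longlonglongrightarrow> 0)) \<longleftrightarrow>
     (\<exists>\<nu>'\<subseteq>\<nu>. infinite \<nu>' \<and> conv_along \<nu>' f K h)" for K h
    unfolding eq[symmetric] by (rule ex_cong1) (rule conj_cong[OF refl], simp only: conv_along_range)
  then show ?thesis
    unfolding universal_class_def mem_Collect_eq admissible_def by (simp only: conj_assoc)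
qed

text \<open>Runge's theorem is applied on a box \<open>X\<close> whose interior contains
  \<open>C \<times> box_prod K\<close>; Cauchy's estimates in the interior then turn closeness of
  values into closeness of finitely many derivatives.\<close>

lemma approx_derivs:
  assumes K: "\<And>i. compact (K i)" "\<And>i. connected (- K i)"
    and V: "open V" "box_prod K \<subseteq> V"
    and h: "holomorphic_several h (G \<times> V)" and C: "compact C" "C \<subseteq> G"
    and fin: "finite \<D>" and \<epsilon>: "\<epsilon> > 0"
  shows "\<exists>t. \<forall>(a, b)\<in>\<D>. \<forall>w\<in>C. \<forall>z\<in>box_prod K. cmod
    (mixed_deriv a b (\<lambda>p. peval \<kappa> t p - h p) (w, z)) \<le> \<epsilon>"
proof -
  obtain U where U: "\<And>i. open (U i)" "\<And>i. K i \<subseteq> U i" "box_prod U \<subseteq> V"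
    using box_prod_tube[OF K(1) V] by blast
  have "\<forall>i. \<exists>Q. compact Q \<and> connected (- Q) \<and> K i \<subseteq> interior Q \<and>
    Q \<subseteq> U i"
    using \<Q>(2,3) K U by metis
  then obtain Q where Q: "\<And>i. compact (Q i)" "\<And>i. connected (- Q i)" "\<And>i. K i
    \<subseteq> interior (Q i)" "\<And>i. Q i \<subseteq> U i"
    by metis
  obtain P where P: "\<And>i. compact (P i)" "\<And>i. connected (- P i)" "\<And>i. P i \<subseteq> Gs i"
      "\<And>i w. w \<in> C \<Longrightarrow> w $ i \<in> interior (P i)"
    using box_fill[OF sc_G C] by metis
  define S where "S = coord_box (case_sum (\<lambda>i. interior (P i)) (\<lambda>i. interior (Q i)))"
  define X where "X = coord_box (case_sum P Q)"
  have S: "open S" unfolding S_def coord_box_eq by (auto intro!: open_Times open_box_prod)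
  have SX: "S \<subseteq> X" unfolding S_def X_def coord_box_eq box_prod_def
    using interior_subset by fastforce
  have X: "compact X" unfolding X_def coord_box_eq by (auto intro!: compact_Times compact_box_prod P Q)
  have XG: "X \<subseteq> coord_box (case_sum Gs U)" unfolding X_def coord_box_eq box_prod_def
    using P(3) Q(4) by fastforce
  have UV: "coord_box (case_sum Gs U) \<subseteq> G \<times> V" unfolding coord_box_eq using U(3) by auto
  have CK: "compact (C \<times> box_prod K)" "C \<times> box_prod K \<subseteq> S"
  proof -
    show "compact (C \<times> box_prod K)" by (intro compact_Times C compact_box_prod K)
    show "C \<times> box_prod K \<subseteq> S" unfolding S_def coord_box_eq box_prod_def
      using P(4) Q(3) by fastforce
  qed
  obtain C' A where A: "compact C'" "C' \<subseteq> S" "A > 0"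
    "\<And>f B. \<lbrakk>holomorphic_several f S; \<forall>q\<in>C'. cmod (f q) \<le>
      B; B \<ge> 0\<rbrakk> \<Longrightarrow>
       (\<forall>(a, b)\<in>\<D>. \<forall>p\<in>C \<times> box_prod K. cmod (mixed_deriv a b f p) \<le>
         A * B)"
    using mixed_deriv_bound_finite[OF S CK fin] by blast
  \<comment> \<open>The 2 accounts for two approximations, first of \<open>h\<close> by a polynomial
    and then of its coefficients by values of \<open>\<kappa>\<close>.\<close>
  define \<delta> where "\<delta> = \<epsilon> / (2 * A)"
  have \<delta>: "\<delta> > 0" "A * (2 * \<delta>) = \<epsilon>" using \<epsilon> A(3)
    by (auto simp: \<delta>_def)
  have "h \<in> poly_closure X" unfolding X_def
  proof (rule Runge_product)
    show "open (case_sum Gs U i)" for i using sc_G U(1)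
      by (cases i) (auto simp: simply_connected_domain_def)
    show "case_sum P Q i \<subseteq> case_sum Gs U i" for i using P Q by (cases i) auto
    show "compact (case_sum P Q i)" for i using P Q by (cases i) auto
    show "connected (- case_sum P Q i)" for i using P Q by (cases i) auto
    show "holomorphic_several h (coord_box (case_sum Gs U))" by (rule holomorphic_several_subset[OF h UV])
  qed
  then obtain g where g: "g \<in> polys" "\<And>x. x \<in> X \<Longrightarrow> cmod (h x - g x) \<le>
    \<delta>"
    using poly_closureD[OF _ \<delta>(1)] by blast
  obtain t where t: "\<And>x. x \<in> X \<Longrightarrow> cmod (g x - peval \<kappa> t x) \<le> \<delta>"
    using peval_approx[OF g(1) \<kappa> X \<delta>(1)] by blast
  have "cmod (peval \<kappa> t q - h q) \<le> 2 * \<delta>" if "q \<in> C'" for q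
  proof -
    have "q \<in> X" using that A(2) SX by blast
    then show ?thesis
      using norm_triangle_ineq[of "h q - g q" "g q - peval \<kappa> t q"] g(2)[of q] t[of q]
      by (simp add: norm_minus_commute)
  qed
  moreover have "holomorphic_several (\<lambda>p. peval \<kappa> t p - h p) S"
    by (intro holomorphic_several_diff holomorphic_several_peval holomorphic_several_subset[OF h])
       (use SX XG UV in blast)
  ultimately have "\<forall>(a, b)\<in>\<D>. \<forall>p\<in>C \<times> box_prod K. cmod (mixed_deriv
    a b (\<lambda>p. peval \<kappa> t p - h p) p) \<le> A * (2 * \<delta>)"
    using A(4)[of "\<lambda>p. peval \<kappa> t p - h p" "2 * \<delta>"] \<delta>(1) by simp
  then show ?thesis unfolding \<delta>(2) by (intro exI[of _ t]) auto
qed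

section \<open>The countably many open and dense conditions\<close>

definition small_index :: "nat \<Rightarrow> ('r mindex \<times> 'd mindex) set" where
  "small_index s = {a. to_nat a \<le> s} \<times> {b. to_nat b \<le> s}"

lemma finite_small_index: "finite (small_index s)"
proof -
  have "finite {a :: 'r mindex. to_nat a \<le> s}" "finite {a :: 'd mindex. to_nat a \<le> s}"
    using finite_vimageI[of "{..s}" "to_nat :: 'r mindex \<Rightarrow> nat"]
      finite_vimageI[of "{..s}" "to_nat :: 'd mindex \<Rightarrow> nat"] by (simp_all add: vimage_def)
  then show ?thesis by (simp add: small_index_def)
qed

definition near :: "nat \<Rightarrow> real \<Rightarrow> ('d \<Rightarrow> complex set)
  \<Rightarrow> (('r, 'd) cpoint \<Rightarrow> complex) \<Rightarrow> nat \<Rightarrow> (('r, 'd)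
  cpoint \<Rightarrow> complex) \<Rightarrow> bool" where
  "near s \<eta> K h n f \<longleftrightarrow>
     (\<forall>(a, b)\<in>small_index s. \<forall>p\<in>L s \<times> box_prod K. cmod (mixed_deriv a
       b (\<lambda>p. tsum n f p - h p) p) \<le> \<eta>) \<and>
     (\<forall>p\<in>L s \<times> M s. cmod (tsum n f p - f p) \<le> \<eta>)"

text \<open>Since \<open>near\<close> is a non-strict condition, openness comes from the strict
  inequality for \<open>\<eta>\<close>. The requirement \<open>n \<ge> s\<close> forces arbitrarily
  large indices once all \<open>s\<close> are considered.\<close>

definition basic_set :: "nat set \<Rightarrow> ('d \<Rightarrow> complex set) \<Rightarrow> (nat,
  'r, 'd) pexp \<Rightarrow> nat \<Rightarrow> (('r, 'd) cpoint \<Rightarrow> complex) set" where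
  "basic_set \<nu> K t s = {f \<in> H. \<exists>n\<in>\<nu>. n \<ge> s \<and> (\<exists>\<eta> <
    inverse (real (Suc s)). near s \<eta> K (peval \<kappa> t) n f)}"

lemma LK:
  assumes "\<And>i. compact (K i)"
  shows "compact (L s \<times> box_prod K)" "L s \<times> box_prod K \<subseteq> G \<times> UNIV"
  using L by (auto intro!: compact_Times compact_box_prod assms)

text \<open>For the index \<open>n\<close> that works for \<open>f\<close>, the Taylor sum and its
  derivatives depend continuously on the function, and the gap between \<open>\<eta>\<close> and
  \<open>inverse (real (Suc s))\<close> absorbs a small perturbation.\<close>

lemma openin_basic_set:
  assumes K: "\<And>i. compact (K i)"
  shows "openin (Hol_top (G \<times> W)) (basic_set \<nu> K t s)"
  unfolding openin_Hol_top
proof (intro conjI ballI)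
  show "basic_set \<nu> K t s \<subseteq> H" by (auto simp: basic_set_def)
  fix f assume "f \<in> basic_set \<nu> K t s"
  then obtain n \<eta> where f: "f \<in> H" and n: "n \<in> \<nu>" "n \<ge> s"
    and \<eta>: "\<eta> < inverse (real (Suc s))"
    and nr: "near s \<eta> K (peval \<kappa> t) n f" by (auto simp: basic_set_def)
  define \<theta> where "\<theta> = (inverse (real (Suc s)) - \<eta>) / 2"
  have half: "0 < (c - \<eta>) / 2" "\<eta> + (c - \<eta>) / 2 < c" if "\<eta> < c" for c
    using that by (simp_all add: field_simps)
  have \<theta>: "\<theta> > 0" "\<eta> + \<theta> < inverse (real (Suc s))" unfolding \<theta>_def
    by (rule half[OF \<eta>])+
  note hf = HolD[OF f]
  define GU and Z where "GU = G \<times> (UNIV :: 'd cspace set)" and "Z = L s \<times> box_prod K"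
  have Z: "compact Z" "Z \<subseteq> GU" and GU: "open GU" using LK[OF K] open_GU
    by (simp_all add: Z_def GU_def)
  obtain D A1 where D': "compact D" "D \<subseteq> GU" "A1 > 0"
    "\<And>f B. \<lbrakk>holomorphic_several f GU; \<forall>q\<in>D. cmod (f q) \<le>
      B; B \<ge> 0\<rbrakk> \<Longrightarrow>
       (\<forall>(a, b)\<in>small_index s. \<forall>p\<in>Z. cmod (mixed_deriv a b f p) \<le> A1 * B)"
    using mixed_deriv_bound_finite[OF GU Z finite_small_index[of s]] by blast
  note D = D'[unfolded GU_def Z_def]
  have LM: "compact (L s \<times> M s)" "L s \<times> M s \<subseteq> G \<times> W" "L s \<times> M
    s \<subseteq> G \<times> UNIV"
    using L(1,2)[of s] M(1,2)[of s] by (auto intro!: compact_Times)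
  have DLM: "compact (D \<union> L s \<times> M s)" "D \<union> L s \<times> M s \<subseteq> G
    \<times> UNIV" using D LM by auto
  obtain C' A2 where C': "compact C'" "C' \<subseteq> G \<times> W" "A2 > 0"
    "\<And>f B. \<lbrakk>holomorphic_several f (G \<times> W); \<forall>q\<in>C'. cmod (f q) \<le>
      B; B \<ge> 0\<rbrakk> \<Longrightarrow>
       (\<forall>p\<in>D \<union> L s \<times> M s. cmod (tsum n f p) \<le> A2 * B)"
    using tsum_bound[OF DLM, of n] by blast
  \<comment> \<open>A perturbation by \<open>d\<close> changes derivatives of the Taylor sum by at
    most \<open>A1 * A2 * d\<close> and its difference from the function by at most
    \<open>A2 * d + d\<close>; both must stay below \<open>\<theta>\<close>.\<close>
  define d where "d = \<theta> / (A1 * A2 + A2 + 1)"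
  have pos: "A1 * A2 + A2 + 1 > 0" using D(3) C'(3) by (simp add: add_pos_pos)
  have d: "d > 0" using \<theta>(1) pos by (simp add: d_def)
  have dd: "A1 * (A2 * d) \<le> \<theta>" "A2 * d + d \<le> \<theta>"
  proof -
    have "(A1 * A2 + A2 + 1) * d = \<theta>" using pos by (simp add: d_def)
    moreover have "A1 * A2 * d \<ge> 0" "A2 * d \<ge> 0" using D(3) C'(3) d by simp_all
    ultimately show "A1 * (A2 * d) \<le> \<theta>" "A2 * d + d \<le> \<theta>" using d
      by (auto simp: algebra_simps)
  qed
  have "g \<in> basic_set \<nu> K t s" if g: "g \<in> H"
    and gf: "\<forall>p\<in>C' \<union> L s \<times> M s. cmod (g p - f p) < d" for g
  proof -
    note hg = HolD[OF g]
    have h1: "holomorphic_several (\<lambda>p. g p - f p) (G \<times> W)"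
      by (intro holomorphic_several_diff hf hg)
    have T: "cmod (tsum n (\<lambda>p. g p - f p) p) \<le> A2 * d"
      if "p \<in> D \<union> L s \<times> M s" for p
      using C'(4)[OF h1, of d] gf d that by (auto simp: less_imp_le)
    have near1: "cmod (mixed_deriv a b (\<lambda>p. tsum n g p - peval \<kappa> t p) p) \<le>
      \<eta> + \<theta>"
      if ab: "(a, b) \<in> small_index s" and p: "p \<in> L s \<times> box_prod K" for a b p
    proof -
      have pG: "p \<in> G \<times> UNIV" using p L(2) by blast
      have "mixed_deriv a b (\<lambda>p. tsum n g p - peval \<kappa> t p) p =
        mixed_deriv a b (\<lambda>p. 1 * tsum n (\<lambda>p. g p - f p) p + (tsum n f p - peval
          \<kappa> t p)) p"
        by (rule mixed_deriv_cong[OF open_GU pG]) (simp add: tsum_diff[OF hg hf])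
      also have "\<dots> = 1 * mixed_deriv a b (tsum n (\<lambda>p. g p - f p)) p + mixed_deriv a b
        (\<lambda>p. tsum n f p - peval \<kappa> t p) p"
        by (rule mixed_deriv_lincomb[OF _ _ open_GU pG])
           (intro holomorphic_several_tsum h1 hf holomorphic_several_diff holomorphic_several_peval)+
      finally have "cmod (mixed_deriv a b (\<lambda>p. tsum n g p - peval \<kappa> t p) p) \<le>
         cmod (mixed_deriv a b (tsum n (\<lambda>p. g p - f p)) p) + cmod (mixed_deriv a b
           (\<lambda>p. tsum n f p - peval \<kappa> t p) p)"
        by (simp add: norm_triangle_ineq)
      moreover have "cmod (mixed_deriv a b (tsum n (\<lambda>p. g p - f p)) p) \<le> A1 * (A2 * d)"
        using D(4)[OF holomorphic_several_tsum[OF h1], of n "A2 * d"] T ab p C'(3) d by fastforce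
      moreover have "cmod (mixed_deriv a b (\<lambda>p. tsum n f p - peval \<kappa> t p) p) \<le> \<eta>"
        using nr ab p unfolding near_def by blast
      ultimately show ?thesis using dd(1) by linarith
    qed
    have tri: "cmod (x + y - z) \<le> cmod x + cmod y + cmod z" for x y z :: complex
      using norm_triangle_ineq4[of "x + y" z] norm_triangle_ineq[of x y] by linarith
    have near2: "cmod (tsum n g p - g p) \<le> \<eta> + \<theta>" if p: "p \<in> L s \<times> M s" for p
    proof -
      have "p \<in> G \<times> UNIV" using p LM(3) by blast
      then have "tsum n g p - g p = tsum n (\<lambda>p. g p - f p) p + (tsum n f p - f p) - (g p - f p)"
        by (simp add: tsum_diff[OF hg hf])
      then have "cmod (tsum n g p - g p) \<le> cmod (tsum n (\<lambda>p. g p - f p) p) + cmod (tsum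
        n f p - f p) + cmod (g p - f p)"
        by (simp only: tri)
      moreover have "cmod (tsum n f p - f p) \<le> \<eta>" using nr p unfolding near_def by blast
      moreover have "cmod (g p - f p) < d" using gf p by blast
      ultimately show ?thesis using T[of p] p dd(2) by auto
    qed
    have "near s (\<eta> + \<theta>) K (peval \<kappa> t) n g" unfolding near_def using near1 near2 by blast
    then show ?thesis using g n \<theta>(2) unfolding basic_set_def by blast
  qed
  then show "\<exists>C e. compact C \<and> C \<subseteq> G \<times> W \<and> 0 < e \<and>
    {g \<in> H. \<forall>p\<in>C. cmod (g p - f p) < e} \<subseteq> basic_set \<nu> K t s"
    using C'(1,2) LM d by (intro exI[of _ "C' \<union> L s \<times> M s"] exI[of _ d]) auto
qed

text \<open>A polynomial belongs to \<open>H\<close> only after it has been replaced by 0 off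
  \<open>G \<times> W\<close>. Its Taylor sums over \<open>G\<close> and its values on
  \<open>M s\<close> are not affected.\<close>

lemma near_cong:
  assumes fg: "\<And>q. q \<in> G \<times> W \<Longrightarrow> f q = g q"
  shows "near s \<eta> K h n f \<longleftrightarrow> near s \<eta> K h n g"
proof -
  have "mixed_deriv a b (\<lambda>p. tsum n f p - h p) p = mixed_deriv a b (\<lambda>p. tsum n g p - h p) p"
    if "p \<in> L s \<times> box_prod K" for a b p
    by (rule mixed_deriv_cong[OF open_GU]) (use that L(2) tsum_cong[OF fg] in auto)
  moreover have "tsum n f p - f p = tsum n g p - g p" if "p \<in> L s \<times> M s" for p
  proof -
    have "p \<in> G \<times> W" using that L(2) M(2) by blast
    then show ?thesis using fg tsum_cong[OF fg, where p = p] by auto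
  qed
  ultimately show ?thesis unfolding near_def by (simp cong: ball_cong)
qed

lemma poly_dense:
  assumes f: "f \<in> H" and C: "compact C" "C \<subseteq> G \<times> W" and e: "e > 0"
  shows "\<exists>t. \<forall>p\<in>C. cmod (peval \<kappa> t p - f p) \<le> e"
proof -
  have C1: "compact (fst ` C)" "compact (snd ` C)" "fst ` C \<subseteq> G" "snd ` C \<subseteq> W"
    using C by (auto intro!: compact_continuous_image continuous_intros)
  obtain R where R: "\<And>i. compact (R i)" "\<And>i. connected (- R i)" "\<And>i. R i \<subseteq>
    \<Omega>s i"
      "\<And>i w. w \<in> snd ` C \<Longrightarrow> w $ i \<in> interior (R i)"
    using box_fill[OF sc_\<Omega> C1(2,4)] by metis
  have RW: "box_prod R \<subseteq> W" using R(3) by (fastforce simp: box_prod_def)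
  \<comment> \<open>The derivative of order 0 is the function itself, so the approximation of values
    is a special case.\<close>
  obtain t where t: "\<forall>(a, b)\<in>{(0, 0)}. \<forall>w\<in>fst ` C. \<forall>z\<in>box_prod
    R. cmod (mixed_deriv a b (\<lambda>p. peval \<kappa> t p - f p) (w, z)) \<le> e"
    using approx_derivs[OF R(1,2) open_W RW HolD[OF f] C1(1,3) _ e, of "{(0, 0)}"] by blast
  have "cmod (peval \<kappa> t p - f p) \<le> e" if p: "p \<in> C" for p
  proof -
    have "snd p $ i \<in> R i" for i using R(4)[of "snd p" i] p by (auto intro: subsetD[OF interior_subset])
    then have "snd p \<in> box_prod R" by (simp add: box_prod_def)
    moreover have "fst p \<in> fst ` C" using p by simp
    ultimately have "cmod (mixed_deriv 0 0 (\<lambda>p. peval \<kappa> t p - f p) (fst p, snd p)) \<le>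
      e" using t by blast
    then show ?thesis by (simp add: mixed_deriv_def)
  qed
  then show ?thesis by blast
qed

text \<open>The compact set near \<open>f\<close> and the one near \<open>K\<close> do not form a
  box together, so Runge's theorem on products cannot treat their union. Coordinate
  \<open>i0\<close> separates them, and a factor in this coordinate alone switches between two
  polynomials that are defined everywhere.\<close>

lemma dense_basic_set:
  assumes \<nu>: "infinite \<nu>" and K: "\<And>i. compact (K i)" "\<And>i. connected (- K i)"
    and i0: "\<Omega>s i0 \<inter> K i0 = {}"
  shows "Hol_dense (G \<times> W) (basic_set \<nu> K t s)"
  unfolding Hol_dense_def
proof (intro allI impI, elim conjE)
  fix f C and e :: real
  assume f: "f \<in> H" and C: "compact C" "C \<subseteq> G \<times> W" and e: "e > 0"
  have C1: "compact (snd ` C)" "snd ` C \<subseteq> W"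
    using C by (auto intro!: compact_continuous_image continuous_intros)
  obtain R where R: "\<And>i. compact (R i)" "\<And>i. connected (- R i)" "\<And>i. R i \<subseteq>
    \<Omega>s i"
      "\<And>i w. w \<in> snd ` C \<Longrightarrow> w $ i \<in> interior (R i)"
    using box_fill[OF sc_\<Omega> C1] by metis
  obtain t0 where t0: "\<And>p. p \<in> C \<Longrightarrow> cmod (peval \<kappa> t0 p - f p) \<le> e / 3"
    using poly_dense[OF f C, of "e/3"] e by auto
  define g0 where "g0 = peval \<kappa> t0"
  have g0: "g0 \<in> polys" by (simp add: g0_def peval_polys)
  \<comment> \<open>\<open>Q\<close> is a neighbourhood of \<open>K i0\<close> and may well meet
    \<open>\<Omega>s i0\<close>; it only has to avoid the compact set \<open>R i0\<close>.\<close>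
  obtain Q where Q: "compact Q" "connected (- Q)" "K i0 \<subseteq> interior Q" "Q \<subseteq> - R i0"
  proof -
    have "open (- R i0)" "K i0 \<subseteq> - R i0" using R(1,3) i0
      by (auto simp: compact_imp_closed open_Compl)
    then show ?thesis using \<Q>(2,3) K that by metis
  qed
  \<comment> \<open>Janiszewski's theorem: disjoint compact sets with connected complements have a
    union with connected complement, so the function equal to 1 near \<open>R i0\<close> and to 0
    near \<open>Q\<close> falls under Runge's theorem.\<close>
  have RQ: "compact (R i0 \<union> Q)" "connected (- (R i0 \<union> Q))"
  proof -
    show "compact (R i0 \<union> Q)" by (intro compact_Un R Q)
    have "R i0 \<inter> Q = {}" using Q(4) by blast
    then show "connected (- (R i0 \<union> Q))"
      using Janiszewski_connected[of "R i0" Q] R Q by (simp add: compact_imp_closed)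
  qed
  obtain U1 U2 where U: "open U1" "open U2" "R i0 \<subseteq> U1" "Q \<subseteq> U2" "U1 \<inter> U2 = {}"
  proof -
    have "R i0 \<inter> Q = {}" using Q(4) by blast
    then show ?thesis
      using separation_normal_compact[OF R(1) compact_imp_closed[OF Q(1)]] that by metis
  qed
  define ind :: "complex \<Rightarrow> complex" where "ind z = (if z \<in> U1 then 1 else 0)" for z
  have ind: "ind holomorphic_on U1 \<union> U2"
  proof (rule holomorphic_on_Un)
    show "ind holomorphic_on U1"
      by (rule holomorphic_transform[of "\<lambda>_. 1"]) (auto simp: ind_def)
    show "ind holomorphic_on U2"
      by (rule holomorphic_transform[of "\<lambda>_. 0"]) (use U(5) in \<open>auto simp: ind_def\<close>)
  qed (fact U)+
  \<comment> \<open>Only coordinate \<open>i0\<close> is restricted. This is the open set on which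
    smallness of the switching factor is turned into smallness of derivatives over
    \<open>K\<close>.\<close>
  define S :: "('r, 'd) cpoint set" where "S = UNIV \<times> {z. z $ i0 \<in> interior Q}"
  have S: "open S"
  proof -
    have "open ((\<lambda>z :: 'd cspace. z $ i0) -` interior Q)"
      by (intro open_vimage open_interior continuous_intros)
    then show ?thesis unfolding S_def by (auto intro!: open_Times simp: vimage_def)
  qed
  have KS: "L s \<times> box_prod K \<subseteq> S" using Q(3) by (auto simp: S_def box_prod_def)
  define Z where "Z = L s \<times> box_prod K"
  have Z: "compact Z" "Z \<subseteq> S" using LK(1)[OF K(1)] KS by (simp_all add: Z_def)
  obtain C' A where A': "compact C'" "C' \<subseteq> S" "A > 0"
    "\<And>f B. \<lbrakk>holomorphic_several f S; \<forall>q\<in>C'. cmod (f q) \<le>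
      B; B \<ge> 0\<rbrakk> \<Longrightarrow>
       (\<forall>(a, b)\<in>small_index s. \<forall>p\<in>Z. cmod (mixed_deriv a b f p) \<le> A * B)"
    using mixed_deriv_bound_finite[OF S Z finite_small_index[of s]] by blast
  note A = A'[unfolded Z_def]
  define Y where "Y = C \<union> C'"
  have Y: "compact Y" using C A by (auto simp: Y_def)
  have pk: "(\<lambda>p. g0 p - peval \<kappa> t p) \<in> polys" by (intro polys_diff g0 peval_polys)
  obtain B where B: "B > 0" "\<forall>x\<in>Y. cmod (g0 x - peval \<kappa> t x) \<le> B"
    using polys_bounded[OF pk Y] by blast
  define \<epsilon> where "\<epsilon> = inverse (real (Suc s)) / 2"
  have \<epsilon>: "\<epsilon> > 0" "\<epsilon> < inverse (real (Suc s))" by (auto simp: \<epsilon>_def)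
  \<comment> \<open>\<open>B\<close> bounds the difference of the two polynomials. The first term of
    the minimum controls the error on \<open>C\<close>, the second one the derivatives over
    \<open>K\<close>, after the loss of the factor \<open>A\<close>.\<close>
  define \<delta> where "\<delta> = min (e / 3) (\<epsilon> / A) / B"
  have \<delta>: "\<delta> > 0" "\<delta> * B \<le> e / 3" "A * (\<delta> * B) \<le> \<epsilon>"
  proof -
    show "\<delta> > 0" using e \<epsilon> A(3) B(1) by (simp add: \<delta>_def)
    have dB: "\<delta> * B = min (e / 3) (\<epsilon> / A)" using B(1) by (simp add: \<delta>_def)
    show "\<delta> * B \<le> e / 3" unfolding dB by (rule min.cobounded1)
    have "A * (\<delta> * B) \<le> A * (\<epsilon> / A)" unfolding dB
      by (rule mult_left_mono) (use A(3) in auto)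
    then show "A * (\<delta> * B) \<le> \<epsilon>" using A(3) by simp
  qed
  have coordC: "coord (Inr i0) p \<in> R i0" if "p \<in> C" for p
    using R(4)[of "snd p" i0] that by (auto intro: subsetD[OF interior_subset])
  have coordC': "coord (Inr i0) p \<in> Q" if "p \<in> C'" for p
    using A(2) that interior_subset by (fastforce simp: S_def)
  have "(\<lambda>x. ind (coord (Inr i0) x)) \<in> poly_closure Y"
  proof (rule Runge_coord[OF Y RQ _ _ _ ind])
    show "coord (Inr i0) ` Y \<subseteq> R i0 \<union> Q" using coordC coordC' by (auto simp: Y_def)
    show "open (U1 \<union> U2)" "R i0 \<union> Q \<subseteq> U1 \<union> U2" using U by auto
  qed
  then obtain q where q: "q \<in> polys" "\<And>x. x \<in> Y \<Longrightarrow>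
    cmod (ind (coord (Inr i0) x) - q x) \<le> \<delta>"
    using poly_closureD[OF _ \<delta>(1)] by blast
  have qC: "cmod (1 - q x) \<le> \<delta>" if "x \<in> C" for x
    using q(2)[of x] coordC[OF that] U(3) that by (auto simp: ind_def Y_def)
  have qC': "cmod (q x) \<le> \<delta>" if "x \<in> C'" for x
  proof -
    have "coord (Inr i0) x \<notin> U1" using coordC'[OF that] U(4,5) by blast
    then show ?thesis using q(2)[of x] that by (simp add: ind_def Y_def)
  qed
  define p' where "p' x = peval \<kappa> t x + q x * (g0 x - peval \<kappa> t x)" for x
  have p': "p' \<in> polys" unfolding p'_def[abs_def] by (intro polys_add polys_mult peval_polys q pk)
  have on_C: "cmod (p' x - f x) < e" if "x \<in> C" for x
  proof -
    have "p' x - f x = - ((1 - q x) * (g0 x - peval \<kappa> t x)) + (g0 x - f x)"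
      by (simp add: p'_def algebra_simps)
    then have "cmod (p' x - f x) \<le> cmod ((1 - q x) * (g0 x - peval \<kappa> t x)) + cmod (g0 x - f x)"
      by (metis norm_minus_cancel norm_triangle_ineq)
    also have "cmod ((1 - q x) * (g0 x - peval \<kappa> t x)) \<le> \<delta> * B"
      unfolding norm_mult using qC[OF that] B that \<delta>(1) by (intro mult_mono) (auto simp: Y_def)
    also have "cmod (g0 x - f x) \<le> e / 3" using t0[OF that] by (simp add: g0_def)
    finally show ?thesis using \<delta>(2) e by linarith
  qed
  have on_C': "cmod (p' x - peval \<kappa> t x) \<le> \<delta> * B" if "x \<in> C'" for x
  proof -
    have "p' x - peval \<kappa> t x = q x * (g0 x - peval \<kappa> t x)" by (simp add: p'_def)
    then show ?thesis
      using mult_mono[of "cmod (q x)" \<delta> "cmod (g0 x - peval \<kappa> t x)" B] qC'[OF that] B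
        that \<delta>(1)
      by (simp add: norm_mult Y_def)
  qed
  have D: "\<forall>(a, b)\<in>small_index s. \<forall>p\<in>L s \<times> box_prod K. cmod
    (mixed_deriv a b (\<lambda>p. p' p - peval \<kappa> t p) p) \<le> A * (\<delta> * B)"
    by (rule A(4)) (use on_C' \<delta>(1) B(1) in \<open>auto intro: holomorphic_several_diff
      holomorphic_several_polys p' peval_polys\<close>)
  obtain n0 where n0: "\<And>n. n \<ge> n0 \<Longrightarrow> tsum n p' = p'" using tsum_polys[OF p']
    by blast
  \<comment> \<open>From \<open>n0\<close> on the Taylor sum is \<open>p'\<close> itself: the
    condition on \<open>M s\<close> holds with error 0, and the one on \<open>K\<close> concerns
    \<open>p'\<close> only.\<close>
  obtain n where n: "n \<in> \<nu>" "n \<ge> max n0 s" using \<nu> by (metis infinite_nat_iff_unbounded_le)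
  define g where "g x = (if x \<in> G \<times> W then p' x else 0)" for x
  have gH: "g \<in> H" unfolding g_def[abs_def] by (rule HolI[OF holomorphic_several_polys[OF p'] open_GW])
  have "near s \<epsilon> K (peval \<kappa> t) n p'"
    unfolding near_def n0[OF order_trans[OF max.cobounded1 n(2)]]
    using D \<delta>(3) \<epsilon>(1) by (fastforce intro: order_trans)
  then have "near s \<epsilon> K (peval \<kappa> t) n g"
    using near_cong[of g p'] by (simp add: g_def)
  then have "g \<in> basic_set \<nu> K t s" using gH n \<epsilon>(2) by (auto simp: basic_set_def)
  moreover have "\<forall>p\<in>C. cmod (g p - f p) < e" using on_C C(2) by (auto simp: g_def)
  ultimately show "\<exists>g\<in>basic_set \<nu> K t s. \<forall>p\<in>C. cmod (g p - f p) < e" by blast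
qed

text \<open>
  Removing \<open>\<Omega>s i\<close> from \<open>g i\<close> keeps the complement connected:
    \<open>- g i\<close> and \<open>\<Omega>s i\<close> share the point \<open>\<zeta> $ i\<close>.
\<close>

definition compact_family :: "('d \<Rightarrow> complex set) set" where
  "compact_family = (\<lambda>(i, g). \<lambda>j. if j = i then g j - \<Omega>s j else g j) ` {(i,
    g). (\<forall>j. g j \<in> \<Q>) \<and> \<zeta> $ i \<notin> g i}"

lemma countable_compact_family: "countable compact_family"
proof -
  have "countable (PiE (UNIV :: 'd set) (\<lambda>_. \<Q>))" by (intro countable_PiE \<Q>) auto
  then have "countable ((UNIV :: 'd set) \<times> {g :: 'd \<Rightarrow> complex set. \<forall>j. g
    j \<in> \<Q>})"
    by (intro countable_SIGMA) (auto simp: PiE_UNIV_domain Pi_def)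
  then show ?thesis unfolding compact_family_def
    by (intro countable_image) (rule countable_subset[rotated], auto)
qed

lemma compact_family_admissible:
  assumes "K \<in> compact_family"
  shows "admissible K"
proof -
  obtain i g where K: "K = (\<lambda>j. if j = i then g j - \<Omega>s j else g j)"
    and g: "\<And>j. g j \<in> \<Q>" "\<zeta> $ i \<notin> g i"
    using assms by (auto simp: compact_family_def)
  have \<Omega>: "open (\<Omega>s j)" "connected (\<Omega>s j)" for j using sc_\<Omega>[of j]
    by (auto simp: simply_connected_domain_def)
  have "connected (- g i \<union> \<Omega>s i)"
  proof (rule connected_Un)
    show "- g i \<inter> \<Omega>s i \<noteq> {}" using g(2) \<zeta> by (auto simp: box_prod_def)
  qed (use \<Omega> \<Q>(2)[OF g(1)] in auto)
  moreover have "- (g i - \<Omega>s i) = - g i \<union> \<Omega>s i" by blast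
  ultimately have "connected (- (g i - \<Omega>s i))" by simp
  moreover have "compact (g i - \<Omega>s i)" using \<Q>(2)[OF g(1)] \<Omega> by (intro compact_diff) auto
  moreover have "\<Omega>s i \<inter> K i = {}" by (auto simp: K)
  ultimately show ?thesis using \<Q>(2)[OF g(1)] unfolding admissible_def K by auto
qed

text \<open>The complement of \<open>\<Omega>s i\<close> is closed and cannot serve as the open set
  \<open>U\<close> for the family \<open>\<Q>\<close>. The complement of the single point
  \<open>\<zeta> $ i\<close> can, and removing \<open>\<Omega>s i\<close> afterwards loses no point
  of \<open>K i\<close>.\<close>

lemma compact_family_cofinal:
  assumes "admissible K"
  shows "\<exists>K'\<in>compact_family. \<forall>i. K i \<subseteq> K' i"
proof -
  obtain i where i: "\<Omega>s i \<inter> K i = {}" using assms by (auto simp: admissible_def)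
  have K: "compact (K j)" "connected (- K j)" for j using assms by (auto simp: admissible_def)
  have \<zeta>i: "\<zeta> $ i \<in> \<Omega>s i" using \<zeta> by (auto simp: box_prod_def)
  have "\<exists>Q\<in>\<Q>. K j \<subseteq> interior Q \<and> Q \<subseteq> (if j =
    i then - {\<zeta> $ i} else UNIV)" for j
    by (rule \<Q>(3)[OF K]) (use i \<zeta>i in auto)
  then obtain g where g: "\<And>j. g j \<in> \<Q>" "\<And>j. K j \<subseteq> interior (g j)"
    "\<And>j. g j \<subseteq> (if j = i then - {\<zeta> $ i} else UNIV)"
    by metis
  have "\<zeta> $ i \<notin> g i" using g(3)[of i] by auto
  define K' where "K' = (\<lambda>j. if j = i then g j - \<Omega>s j else g j)"
  have "K' \<in> compact_family"
    unfolding compact_family_def K'_def using g(1) \<open>\<zeta> $ i \<notin> g i\<close>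
      by (auto intro!: image_eqI[of _ _ "(i, g)"])
  moreover have "K j \<subseteq> K' j" for j
    using g(2)[of j] interior_subset[of "g j"] i by (auto simp: K'_def)
  ultimately show ?thesis by (intro bexI[of _ K'] allI)
qed

text \<open>A diagonal choice: the \<open>s\<close>-th index is good at level \<open>s\<close>, and
  any given compact sets, derivative and precision are covered by all sufficiently high levels. The
  factor 2 leaves room for replacing \<open>h\<close> by a polynomial.\<close>

lemma conv_along_if_frequently_near:
  assumes P: "\<And>s m. \<exists>n\<in>\<nu>. n \<ge> m \<and> near s (2 * inverse (real (Suc s))) K h n f"
  shows "\<exists>\<nu>'\<subseteq>\<nu>. infinite \<nu>' \<and> conv_along \<nu>' f K h"
proof -
  define \<eta> where "\<eta> s = 2 * inverse (real (Suc s))" for s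
  have "\<exists>l. \<forall>s. (l s \<in> \<nu> \<and> near s (\<eta> s) K h (l s) f) \<and> l s <
    l (Suc s)"
  proof (rule dependent_nat_choice)
    show "\<exists>x. x \<in> \<nu> \<and> near 0 (\<eta> 0) K h x f" using P[of 0 0]
      by (auto simp: \<eta>_def)
    show "\<exists>y. (y \<in> \<nu> \<and> near (Suc s) (\<eta> (Suc s)) K h y f) \<and> x < y" for x s
      using P[of "Suc x" "Suc s"] unfolding \<eta>_def by (metis Suc_le_eq)
  qed
  then obtain l where l: "\<And>s. l s \<in> \<nu>" "\<And>s. near s (\<eta> s) K h (l s) f"
    "\<And>s. l s < l (Suc s)" by blast
  have sm: "strict_mono l" using l(3) by (simp add: strict_mono_Suc_iff)
  have "conv_along (range l) f K h"
    unfolding conv_along_def eventually_range_strict_mono[OF sm]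
  proof (intro allI impI, elim conjE)
    fix C D and a :: "'r mindex" and b :: "'d mindex" and e :: real
    assume C: "compact C" "C \<subseteq> G" and D: "compact D" "D \<subseteq> W" and e: "0 < e"
    obtain m1 where m1: "\<forall>n\<ge>m1. C \<subseteq> L n" using L(4)[OF C] by blast
    obtain m2 where m2: "\<forall>n\<ge>m2. D \<subseteq> M n" using M(4)[OF D] by blast
    obtain m3 where m3: "inverse (real (Suc m3)) < e / 2" using reals_Archimedean[of "e/2"] e by auto
    define s0 where "s0 = max (max m1 m2) (max m3 (max (to_nat a) (to_nat b)))"
    have "(\<forall>w\<in>C. \<forall>z\<in>box_prod K. cmod (mixed_deriv a b (\<lambda>p. tsum (l
      s) f p - h p) (w, z)) \<le> e) \<and>
        (\<forall>w\<in>C. \<forall>z\<in>D. cmod (tsum (l s) f (w, z) - f (w, z)) \<le>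
          e)" if s: "s \<ge> s0" for s
    proof -
      have "inverse (real (Suc s)) \<le> inverse (real (Suc m3))"
        by (rule le_imp_inverse_le) (use s in \<open>auto simp: s0_def\<close>)
      then have \<eta>e: "\<eta> s \<le> e" using m3 unfolding \<eta>_def by linarith
      have ab: "(a, b) \<in> small_index s" using s by (auto simp: small_index_def s0_def)
      have CL: "C \<subseteq> L s" "D \<subseteq> M s" using m1 m2 s by (auto simp: s0_def)
      have "cmod (mixed_deriv a b (\<lambda>p. tsum (l s) f p - h p) (w, z)) \<le> \<eta> s"
        if "w \<in> C" "z \<in> box_prod K" for w z
        using l(2)[of s] ab that CL unfolding near_def by blast
      moreover have "cmod (tsum (l s) f (w, z) - f (w, z)) \<le> \<eta> s"
        if "w \<in> C" "z \<in> D" for w z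
        using l(2)[of s] that CL unfolding near_def by blast
      ultimately show ?thesis using \<eta>e by (meson order_trans)
    qed
    then show "\<exists>n0. \<forall>n\<ge>n0. (\<forall>w\<in>C. \<forall>z\<in>box_prod K. cmod
      (mixed_deriv a b (\<lambda>p. tsum (l n) f p - h p) (w, z)) \<le> e) \<and>
        (\<forall>w\<in>C. \<forall>z\<in>D. cmod (tsum (l n) f (w, z) - f (w, z)) \<le> e)" by blast
  qed
  moreover have "range l \<subseteq> \<nu>" using l(1) by blast
  moreover have "infinite (range l)" using sm by (intro range_inj_infinite strict_mono_imp_inj_on)
  ultimately show ?thesis by (intro exI[of _ "range l"] conjI)
qed

lemma near_if_conv_along:
  assumes cv: "conv_along \<nu> f K h" and \<nu>: "infinite \<nu>" and \<eta>: "\<eta> > 0"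
  shows "\<exists>n\<in>\<nu>. n \<ge> m \<and> near s \<eta> K h n f"
proof -
  define P where "P a b n \<longleftrightarrow>
        (\<forall>w\<in>L s. \<forall>z\<in>box_prod K. cmod (mixed_deriv a b (\<lambda>p. tsum n f
          p - h p) (w, z)) \<le> \<eta>) \<and>
        (\<forall>w\<in>L s. \<forall>z\<in>M s. cmod (tsum n f (w, z) - f (w, z)) \<le> \<eta>)" for a b n
  have "\<exists>n0. \<forall>n\<in>\<nu>. n \<ge> n0 \<longrightarrow> P a b n" for a b
    unfolding P_def
    using cv[unfolded conv_along_def, rule_format, of "L s" "M s" \<eta> a b] L(1,2) M(1,2) \<eta> by simp
  then obtain n0 where n0: "\<And>a b n. \<lbrakk>n \<in> \<nu>; n \<ge> n0 a b\<rbrakk> \<Longrightarrow>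
    P a b n"
    by metis
  define n1 where "n1 = Max ((\<lambda>(a, b). n0 a b) ` small_index s)"
  have n1: "n0 a b \<le> n1" if "(a, b) \<in> small_index s" for a b
    unfolding n1_def by (rule Max_ge) (use that finite_small_index in force)+
  \<comment> \<open>The condition on \<open>M s\<close> involves no derivative and is taken from the
    pair \<open>(0, 0)\<close>. This pair need not belong to \<open>small_index s\<close>, so its
    threshold is added separately.\<close>
  obtain n where n: "n \<in> \<nu>" "n \<ge> max m (max n1 (n0 0 0))" using \<nu>
    by (metis infinite_nat_iff_unbounded_le)
  have "near s \<eta> K h n f"
    unfolding near_def
  proof (intro conjI ballI)
    fix d assume d: "d \<in> small_index s"
    obtain a b where ab: "d = (a, b)" by (cases d)
    have "n0 a b \<le> n" using n1[of a b] d n(2) ab by auto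
    from n0[OF n(1) this, unfolded P_def] show "case d of (a, b) \<Rightarrow> \<forall>p\<in>L s
      \<times> box_prod K. cmod (mixed_deriv a b (\<lambda>p. tsum n f p - h p) p) \<le> \<eta>"
      by (auto simp: ab)
  next
    fix p assume "p \<in> L s \<times> M s"
    then show "cmod (tsum n f p - f p) \<le> \<eta>" using n0[OF n(1), of 0 0, unfolded P_def] n(2) by auto
  qed
  then show ?thesis using n by auto
qed

text \<open>From left to right, a polynomial is an admissible target with \<open>V = UNIV\<close>.
  Conversely, \<open>K\<close> is enlarged to a member of the family, and \<open>h\<close> is
  approximated over the original \<open>K\<close> by a polynomial that depends on the level.\<close>

lemma universal_class_eq_Inter:
  assumes \<nu>: "infinite \<nu>"
  shows "\<U> \<nu> = H \<inter> (\<Inter>K\<in>compact_family. \<Inter>t. \<Inter>s. basic_set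
    \<nu> K t s)"
proof (intro equalityI subsetI IntI INT_I)
  fix f assume f: "f \<in> \<U> \<nu>"
  then show fH: "f \<in> H" by (simp add: universal_class_iff)
  fix K and s :: nat and t :: "(nat, 'r, 'd) pexp"
  assume K: "K \<in> compact_family"
  have "admissible K \<and> open UNIV \<and> box_prod K \<subseteq> UNIV \<and>
    holomorphic_several (peval \<kappa> t) (G \<times> UNIV)"
    by (simp add: compact_family_admissible[OF K] holomorphic_several_peval)
  then obtain \<nu>' where \<nu>': "\<nu>' \<subseteq> \<nu>" "infinite \<nu>'" "conv_along \<nu>' f
    K (peval \<kappa> t)"
    using f unfolding universal_class_iff by blast
  have \<eta>: "0 < inverse (real (Suc s)) / 2" "inverse (real (Suc s)) / 2 <
    inverse (real (Suc s))" by auto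
  obtain n where "n \<in> \<nu>'" "n \<ge> s" "near s (inverse (real (Suc s)) / 2) K (peval \<kappa> t) n f"
    using near_if_conv_along[OF \<nu>'(3,2) \<eta>(1)] by blast
  then show "f \<in> basic_set \<nu> K t s" using \<nu>'(1) fH \<eta>(2) unfolding basic_set_def by blast
next
  fix f assume f: "f \<in> H \<inter> (\<Inter>K\<in>compact_family. \<Inter>t. \<Inter>s. basic_set
    \<nu> K t s)"
  show "f \<in> \<U> \<nu>"
    unfolding universal_class_iff
  proof (intro conjI allI impI)
    show fH: "f \<in> H" using f by blast
    fix K V h assume A: "admissible K \<and> open V \<and> box_prod K \<subseteq> V \<and>
      holomorphic_several h (G \<times> V)"
    then have K: "\<And>i. compact (K i)" "\<And>i. connected (- K i)" by (auto simp: admissible_def)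
    obtain K' where K': "K' \<in> compact_family" "\<And>i. K i \<subseteq> K' i"
      using compact_family_cofinal A by blast
    have KK': "box_prod K \<subseteq> box_prod K'" using K'(2) by (auto simp: box_prod_def)
    show "\<exists>\<nu>'\<subseteq>\<nu>. infinite \<nu>' \<and> conv_along \<nu>' f K h"
    proof (rule conv_along_if_frequently_near)
      fix s m :: nat
      \<comment> \<open>Membership at level \<open>s'\<close> yields the precision of level
        \<open>s\<close> and an index beyond \<open>m\<close> at the same time.\<close>
      define s' where "s' = max s m"
      have i: "inverse (real (Suc s)) > 0" by simp
      obtain t where t: "\<forall>(a, b)\<in>small_index s. \<forall>w\<in>L s. \<forall>z\<in>box_prod K.
            cmod (mixed_deriv a b (\<lambda>p. peval \<kappa> t p - h p) (w, z)) \<le>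
              inverse (real (Suc s))"
        using approx_derivs[of K V h "L s" "small_index s" "inverse (real (Suc s))"]
          K A L(1,2)[of s] finite_small_index[of s] i by blast
      obtain n \<eta> where n: "n \<in> \<nu>" "n \<ge> s'" "\<eta> <
        inverse (real (Suc s'))" "near s' \<eta> K' (peval \<kappa> t) n f"
        using f K'(1) unfolding basic_set_def by blast
      have "inverse (real (Suc s')) \<le> inverse (real (Suc s))"
        by (rule le_imp_inverse_le) (auto simp: s'_def)
      then have \<eta>: "\<eta> \<le> inverse (real (Suc s))" using n(3) by linarith
      have ss: "s \<le> s'" by (simp add: s'_def)
      have sub: "small_index s \<subseteq> small_index s'" using ss by (auto simp: small_index_def)
      have "near s (2 * inverse (real (Suc s))) K h n f"
        unfolding near_def
      proof (intro conjI ballI)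
        fix d assume d: "d \<in> small_index s"
        obtain a b where ab: "d = (a, b)" by (cases d)
        have "cmod (mixed_deriv a b (\<lambda>p. tsum n f p - h p) p) \<le> 2 * inverse (real (Suc s))"
          if p: "p \<in> L s \<times> box_prod K" for p
        proof -
          have pGV: "p \<in> G \<times> V" using p L(2) A by blast
          have oGV: "open (G \<times> V)" using open_G A by (auto intro: open_Times)
          have hT: "holomorphic_several (tsum n f) (G \<times> V)"
            by (rule holomorphic_several_subset[OF holomorphic_several_tsum[OF HolD[OF fH]]]) auto
          have "mixed_deriv a b (\<lambda>p. tsum n f p - h p) p =
              mixed_deriv a b (\<lambda>p. 1 * (tsum n f p - peval \<kappa> t p) + (peval \<kappa> t
                p - h p)) p" by simp
          also have "\<dots> = 1 * mixed_deriv a b (\<lambda>p. tsum n f p - peval \<kappa> t p) p +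
            mixed_deriv a b (\<lambda>p. peval \<kappa> t p - h p) p"
            by (rule mixed_deriv_lincomb[OF _ _ oGV pGV])
               (use A in \<open>intro holomorphic_several_diff hT holomorphic_several_peval; blast\<close>)+
          finally have "cmod (mixed_deriv a b (\<lambda>p. tsum n f p - h p) p) \<le>
             cmod (mixed_deriv a b (\<lambda>p. tsum n f p - peval \<kappa> t p) p) + cmod
               (mixed_deriv a b (\<lambda>p. peval \<kappa> t p - h p) p)"
            by (simp add: norm_triangle_ineq)
          moreover have "p \<in> L s' \<times> box_prod K'" using p KK' L_mono[OF ss] by blast
          then have "cmod (mixed_deriv a b (\<lambda>p. tsum n f p - peval \<kappa> t p) p) \<le> \<eta>"
            using n(4) sub d ab unfolding near_def by blast
          moreover have "cmod (mixed_deriv a b (\<lambda>p. peval \<kappa> t p - h p) p) \<le>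
            inverse (real (Suc s))"
            using t d ab p by (cases p) auto
          ultimately show ?thesis using \<eta> by linarith
        qed
        then show "case d of (a, b) \<Rightarrow> \<forall>p\<in>L s \<times> box_prod K. cmod
          (mixed_deriv a b (\<lambda>p. tsum n f p - h p) p) \<le> 2 * inverse (real (Suc s))"
          by (simp add: ab)
      next
        fix p assume "p \<in> L s \<times> M s"
        then have "p \<in> L s' \<times> M s'" using L_mono[OF ss] M_mono[OF ss] by blast
        then have "cmod (tsum n f p - f p) \<le> \<eta>" using n(4) unfolding near_def by blast
        then show "cmod (tsum n f p - f p) \<le> 2 * inverse (real (Suc s))" using \<eta> i by linarith
      qed
      then show "\<exists>n\<in>\<nu>. m \<le> n \<and> near s (2 * inverse (real (Suc s))) K h n f"
        using n(1,2) by (auto simp: s'_def)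
    qed
  qed
qed

lemma Hol_dense_Hol: "Hol_dense (G \<times> W) H"
  unfolding Hol_dense_def by (auto intro!: bexI)

lemma universal_class_countable_Inter:
  assumes \<nu>: "infinite \<nu>"
  shows "\<exists>V :: nat \<Rightarrow> (('r, 'd) cpoint \<Rightarrow> complex) set. (\<forall>k.
    openin (Hol_top (G \<times> W)) (V k) \<and> Hol_dense (G \<times> W) (V k)) \<and>
    \<U> \<nu> = (\<Inter>k. V k)"
proof -
  \<comment> \<open>\<open>H\<close> itself is added as a member, which confines the intersection to
    \<open>H\<close>.\<close>
  define \<V> where "\<V> = insert H ((\<lambda>(K, t, s). basic_set \<nu> K t s) ` (compact_family
    \<times> UNIV \<times> UNIV))"
  have "countable \<V>" unfolding \<V>_def
    by (intro countable_insert countable_image countable_SIGMA countable_compact_family) auto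
  moreover have "\<V> \<noteq> {}" by (simp add: \<V>_def)
  ultimately have r: "range (from_nat_into \<V>) = \<V>" by (simp add: range_from_nat_into)
  have "openin (Hol_top (G \<times> W)) A \<and> Hol_dense (G \<times> W) A" if AV: "A \<in> \<V>" for A
  proof (cases "A = H")
    case True
    then show ?thesis using openin_topspace[of "Hol_top (G \<times> W)"] Hol_dense_Hol by simp
  next
    case False
    then obtain K t s where K: "K \<in> compact_family" and A: "A = basic_set \<nu> K t s" using AV
      by (auto simp: \<V>_def)
    have adm: "admissible K" by (rule compact_family_admissible[OF K])
    then obtain i where "\<Omega>s i \<inter> K i = {}" by (auto simp: admissible_def)
    with adm show ?thesis unfolding A
      by (intro conjI openin_basic_set dense_basic_set[OF \<nu>]) (auto simp: admissible_def)
  qed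
  then have "openin (Hol_top (G \<times> W)) (from_nat_into \<V> k) \<and>
    Hol_dense (G \<times> W) (from_nat_into \<V> k)" for k
    using r by blast
  moreover have "\<U> \<nu> = (\<Inter>k. from_nat_into \<V> k)"
    unfolding universal_class_eq_Inter[OF \<nu>] r by (auto simp: \<V>_def)
  ultimately show ?thesis by blast
qed

lemma universal_class_subset: "\<U> \<nu> \<subseteq> H"
  by (auto simp: universal_class_def)

lemma gdelta_universal_class:
  assumes "infinite \<nu>"
  shows "gdelta_in (Hol_top (G \<times> W)) (\<U> \<nu>)"
proof -
  obtain V :: "nat \<Rightarrow> (('r, 'd) cpoint \<Rightarrow> complex) set"
    where V: "\<And>k. openin (Hol_top (G \<times> W)) (V k)"
    "\<U> \<nu> = (\<Inter>k. V k)"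
    using universal_class_countable_Inter[OF assms] by blast
  show ?thesis unfolding V(2)
    by (rule gdelta_in_Inter) (use V(1) in \<open>auto intro: open_imp_gdelta_in\<close>)
qed

text \<open>Countably many index sets are needed simultaneously: a generator of the vector space has
  to be universal along one prescribed index set for each compact set of the family.\<close>

lemma dense_Inter_universal_class:
  fixes \<nu> :: "nat \<Rightarrow> nat set"
  assumes "\<And>k. infinite (\<nu> k)"
  shows "Hol_dense (G \<times> W) (\<Inter>k. \<U> (\<nu> k))"
proof -
  have "\<forall>k. \<exists>V :: nat \<Rightarrow> (('r, 'd) cpoint \<Rightarrow> complex) set.
    (\<forall>j. openin (Hol_top (G \<times> W)) (V j) \<and> Hol_dense (G \<times> W) (V j)) \<and>
    \<U> (\<nu> k) = (\<Inter>j. V j)"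
    using universal_class_countable_Inter[OF assms] by blast
  then obtain V :: "nat \<Rightarrow> nat \<Rightarrow> (('r, 'd) cpoint \<Rightarrow> complex) set" where
    V: "\<And>k j. openin (Hol_top (G \<times> W)) (V k j)" "\<And>k j. Hol_dense (G \<times> W) (V k j)"
      "\<And>k. \<U> (\<nu> k) = (\<Inter>j. V k j)"
    by metis
  define V' where "V' n = V (fst (prod_decode n)) (snd (prod_decode n))" for n
  have "Hol_dense (G \<times> W) (H \<inter> (\<Inter>n. V' n))"
    by (rule Hol_Baire[OF open_GW]) (simp_all add: V'_def V(1,2))
  moreover have "H \<inter> (\<Inter>n. V' n) = (\<Inter>k. \<U> (\<nu> k))"
  proof -
    have "V' (prod_encode (k, j)) = V k j" for k j by (simp add: V'_def)
    then have 1: "x \<in> V k j" if "\<forall>n. x \<in> V' n" for x k j using that by metis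
    have 2: "x \<in> V' n" if "\<forall>k j. x \<in> V k j" for x n using that by (simp add: V'_def)
    have 3: "V k j \<subseteq> H" for k j using openin_subset[OF V(1)] by simp
    show ?thesis unfolding V(3)
    proof (intro set_eqI iffI)
      fix x assume "x \<in> H \<inter> (\<Inter>n. V' n)"
      then show "x \<in> (\<Inter>k. \<Inter>j. V k j)" using 1 by simp
    next
      fix x assume "x \<in> (\<Inter>k. \<Inter>j. V k j)"
      then have a: "\<forall>k j. x \<in> V k j" by simp
      then show "x \<in> H \<inter> (\<Inter>n. V' n)" using 2[OF a] 3[of 0 0] by blast
    qed
  qed
  ultimately show ?thesis by simp
qed

subsection \<open>A dense vector space of universal functions\<close>

lemma conv_along_mono:
  assumes "conv_along \<nu> f K h" "\<nu>' \<subseteq> \<nu>" "\<And>i. K' i \<subseteq> K i"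
  shows "conv_along \<nu>' f K' h"
proof -
  have KK: "box_prod K' \<subseteq> box_prod K" using assms(3) by (auto simp: box_prod_def)
  show ?thesis
    unfolding conv_along_def
  proof (intro allI impI)
    fix C D and a :: "'r mindex" and b :: "'d mindex" and e :: real
    assume A: "compact C \<and> C \<subseteq> G \<and> compact D \<and> D \<subseteq> W \<and> 0 < e"
    obtain n0 where n0: "\<forall>n\<in>\<nu>. n \<ge> n0 \<longrightarrow>
        (\<forall>w\<in>C. \<forall>z\<in>box_prod K. cmod (mixed_deriv a b (\<lambda>p. tsum n f p
          - h p) (w, z)) \<le> e) \<and>
        (\<forall>w\<in>C. \<forall>z\<in>D. cmod (tsum n f (w, z) - f (w, z)) \<le> e)"
      using assms(1)[unfolded conv_along_def, rule_format, of C D e a b] A by auto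
    show "\<exists>n0. \<forall>n\<in>\<nu>'. n \<ge> n0 \<longrightarrow>
        (\<forall>w\<in>C. \<forall>z\<in>box_prod K'. cmod (mixed_deriv a b (\<lambda>p. tsum n f p
          - h p) (w, z)) \<le> e) \<and>
        (\<forall>w\<in>C. \<forall>z\<in>D. cmod (tsum n f (w, z) - f (w, z)) \<le> e)"
      using n0 assms(2) KK by (intro exI[of _ n0]) (simp add: subset_iff)
  qed
qed

lemma conv_along_zero: "conv_along \<nu> (\<lambda>_. 0) K (\<lambda>_. 0)"
proof -
  have t: "tsum n (\<lambda>_. 0) p = 0" if "p \<in> G \<times> UNIV" for n p
    using tsum_diff[of "\<lambda>_. 0" "\<lambda>_. 0" p n] that by (simp add: holomorphic_several_const)
  have "mixed_deriv a b (\<lambda>p. tsum n (\<lambda>_. 0) p - 0) (w, z) = 0" if "w \<in> G" for a b n w z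
  proof -
    have "mixed_deriv a b (\<lambda>p. tsum n (\<lambda>_. 0) p - 0) (w, z) =
      mixed_deriv a b (\<lambda>_. 0 - 0) (w, z)"
      by (rule mixed_deriv_cong[OF open_GU]) (use that t in auto)
    also have "\<dots> = 0" using that by (subst mixed_deriv_diff[OF _ _ open_GU]) auto
    finally show ?thesis .
  qed
  then show ?thesis unfolding conv_along_def by (auto simp: t subset_iff)
qed

lemma conv_along_lincomb:
  assumes f: "conv_along \<nu> f K h" "f \<in> H" and g: "conv_along \<nu> g K k" "g \<in> H"
    and V: "open V" "box_prod K \<subseteq> V" "holomorphic_several h (G \<times> V)"
      "holomorphic_several k (G \<times> V)"
  shows "conv_along \<nu> (\<lambda>p. c * f p + g p) K (\<lambda>p. c * h p + k p)"
  unfolding conv_along_def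
proof (intro allI impI)
  fix C D and a :: "'r mindex" and b :: "'d mindex" and e :: real
  assume A: "compact C \<and> C \<subseteq> G \<and> compact D \<and> D \<subseteq> W \<and> 0 < e"
  define \<epsilon> where "\<epsilon> = e / (cmod c + 1)"
  have c1: "cmod c + 1 > 0" by (simp add: add_nonneg_pos)
  have \<epsilon>: "\<epsilon> > 0" "cmod c * \<epsilon> + \<epsilon> = e"
  proof -
    show "\<epsilon> > 0" using A c1 by (simp add: \<epsilon>_def)
    have "cmod c * \<epsilon> + \<epsilon> = (cmod c + 1) * \<epsilon>" by (simp add: algebra_simps)
    then show "cmod c * \<epsilon> + \<epsilon> = e" using c1 by (simp add: \<epsilon>_def)
  qed
  obtain n1 where n1: "\<forall>n\<in>\<nu>. n \<ge> n1 \<longrightarrow>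
      (\<forall>w\<in>C. \<forall>z\<in>box_prod K. cmod (mixed_deriv a b (\<lambda>p. tsum n f p -
        h p) (w, z)) \<le> \<epsilon>) \<and>
      (\<forall>w\<in>C. \<forall>z\<in>D. cmod (tsum n f (w, z) - f (w, z)) \<le> \<epsilon>)"
    using f(1)[unfolded conv_along_def, rule_format, of C D \<epsilon> a b] A \<epsilon>(1) by auto
  obtain n2 where n2: "\<forall>n\<in>\<nu>. n \<ge> n2 \<longrightarrow>
      (\<forall>w\<in>C. \<forall>z\<in>box_prod K. cmod (mixed_deriv a b (\<lambda>p. tsum n g p -
        k p) (w, z)) \<le> \<epsilon>) \<and>
      (\<forall>w\<in>C. \<forall>z\<in>D. cmod (tsum n g (w, z) - g (w, z)) \<le> \<epsilon>)"
    using g(1)[unfolded conv_along_def, rule_format, of C D \<epsilon> a b] A \<epsilon>(1) by auto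
  have lin: "cmod (c * x + y) \<le> e" if "cmod x \<le> \<epsilon>" "cmod y \<le> \<epsilon>" for x y
  proof -
    have "cmod (c * x + y) \<le> cmod c * cmod x + cmod y" by (metis norm_mult norm_triangle_ineq)
    also have "\<dots> \<le> cmod c * \<epsilon> + \<epsilon>" by (intro add_mono mult_left_mono that) auto
    finally show ?thesis using \<epsilon>(2) by simp
  qed
  have oGV: "open (G \<times> V)" using open_G V(1) by (auto intro: open_Times)
  have T: "tsum n (\<lambda>p. c * f p + g p) p = c * tsum n f p + tsum n g p"
    if "p \<in> G \<times> UNIV" for n p
    by (rule tsum_lincomb[OF HolD[OF f(2)] HolD[OF g(2)] that])
  have hT: "holomorphic_several (tsum n f) (G \<times> V)" if "f \<in> H" for n f
    by (rule holomorphic_several_subset[OF holomorphic_several_tsum[OF HolD[OF that]]]) auto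
  have D1: "mixed_deriv a b (\<lambda>p. tsum n (\<lambda>p. c * f p + g p) p - (c * h p + k p)) p =
      c * mixed_deriv a b (\<lambda>p. tsum n f p - h p) p + mixed_deriv a b (\<lambda>p. tsum n g p
        - k p) p"
    if p: "p \<in> G \<times> V" for n p
  proof -
    have "mixed_deriv a b (\<lambda>p. tsum n (\<lambda>p. c * f p + g p) p - (c * h p + k p)) p =
        mixed_deriv a b (\<lambda>p. c * (tsum n f p - h p) + (tsum n g p - k p)) p"
      by (rule mixed_deriv_cong[OF oGV p]) (use T in \<open>auto simp: algebra_simps\<close>)
    also have "\<dots> = c * mixed_deriv a b (\<lambda>p. tsum n f p - h p) p + mixed_deriv a b
      (\<lambda>p. tsum n g p - k p) p"
      by (rule mixed_deriv_lincomb[OF _ _ oGV p]) (intro holomorphic_several_diff hT f(2) g(2) V)+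
    finally show ?thesis .
  qed
  show "\<exists>n0. \<forall>n\<in>\<nu>. n \<ge> n0 \<longrightarrow>
      (\<forall>w\<in>C. \<forall>z\<in>box_prod K. cmod (mixed_deriv a b (\<lambda>p. tsum n
        (\<lambda>p. c * f p + g p) p - (c * h p + k p)) (w, z)) \<le> e) \<and>
      (\<forall>w\<in>C. \<forall>z\<in>D. cmod (tsum n (\<lambda>p. c * f p + g p) (w, z) - (c * f
        (w, z) + g (w, z))) \<le> e)"
  proof (intro exI[of _ "max n1 n2"] ballI impI conjI)
    fix n w z assume n: "n \<in> \<nu>" "max n1 n2 \<le> n" and w: "w \<in> C" and z: "z \<in> box_prod K"
    have wz: "(w, z) \<in> G \<times> V" using w z A V(2) by blast
    show "cmod (mixed_deriv a b (\<lambda>p. tsum n (\<lambda>p. c * f p + g p) p - (c * h p + k p))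
      (w, z)) \<le> e"
      unfolding D1[OF wz] using n1 n2 n w z by (intro lin) auto
  next
    fix n w z assume n: "n \<in> \<nu>" "max n1 n2 \<le> n" and w: "w \<in> C" and z: "z \<in> D"
    have wz: "(w, z) \<in> G \<times> UNIV" using w A by blast
    have "tsum n (\<lambda>p. c * f p + g p) (w, z) - (c * f (w, z) + g (w, z)) =
        c * (tsum n f (w, z) - f (w, z)) + (tsum n g (w, z) - g (w, z))"
      unfolding T[OF wz] by (simp add: algebra_simps)
    then show "cmod (tsum n (\<lambda>p. c * f p + g p) (w, z) - (c * f (w, z) + g (w, z))) \<le> e"
      using n1 n2 n w z by (simp only:) (intro lin; auto)
  qed
qed

text \<open>
  The sets \<open>\<sigma> j k\<close> of indices shrink with \<open>j\<close>, so that along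
    \<open>\<sigma> j k\<close> the Taylor sums of
  \<open>Y 0, \<dots>, Y (j - 1)\<close> vanish on the \<open>k\<close>-th compact set, while
    \<open>Y j\<close> is still universal
  with indices from \<open>\<sigma> j k\<close>.
\<close>

lemma universal_sequence:
  fixes F :: "nat \<Rightarrow> 'd \<Rightarrow> complex set"
    and g :: "nat \<Rightarrow> ('r, 'd) cpoint \<Rightarrow> complex"
  assumes \<mu>: "infinite \<mu>" and F: "\<And>k. admissible (F k)"
    and g: "\<And>j. g j \<in> H" and C: "\<And>j. compact (C j)" "\<And>j. C j \<subseteq> G
      \<times> W" and e: "\<And>j. e j > 0"
  shows "\<exists>Y \<sigma>. (\<forall>k. \<sigma> 0 k = \<mu>) \<and>
    (\<forall>j k. Y j \<in> \<U> (\<sigma> j k) \<and>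
     \<sigma> (Suc j) k \<subseteq> \<sigma> j k \<and> conv_along (\<sigma> (Suc j) k) (Y j) (F k)
       (\<lambda>_. 0)) \<and>
     (\<forall>j. \<forall>p\<in>C j. cmod (Y j p - g j p) < e j)"
proof -
  \<comment> \<open>The state at stage \<open>j\<close> consists of the function chosen just before
    and the index sets for stage \<open>j\<close>. The function in the initial state is a dummy,
    hence the shift by \<open>Suc\<close> in the final witness for \<open>Y\<close>.\<close>
  define P where "P j x \<longleftrightarrow> (\<forall>k. infinite (snd x k)) \<and> (j = 0 \<longrightarrow>
    snd x = (\<lambda>_. \<mu>))"
    for j :: nat and x :: "(('r, 'd) cpoint \<Rightarrow> complex) \<times> (nat \<Rightarrow> nat set)"
  define R where "R j x y \<longleftrightarrow> (\<forall>k. fst y \<in> \<U> (snd x k) \<and>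
     snd y k \<subseteq> snd x k \<and> conv_along (snd y k) (fst y) (F k) (\<lambda>_. 0)) \<and>
       (\<forall>p\<in>C j. cmod (fst y p - g j p) < e j)"
    for j and x y :: "(('r, 'd) cpoint \<Rightarrow> complex) \<times> (nat \<Rightarrow> nat set)"
  have "\<exists>X. \<forall>j. P j (X j) \<and> R j (X j) (X (Suc j))"
  proof (rule dependent_nat_choice)
    show "\<exists>x. P 0 x" using \<mu> by (intro exI[of _ "(\<lambda>_. 0, \<lambda>_. \<mu>)"])
      (simp add: P_def)
    fix x j assume "P j x"
    then have inf: "\<And>k. infinite (snd x k)" by (simp add: P_def)
    from Hol_denseD[OF dense_Inter_universal_class[of "snd x", OF inf] g[of j] C(1)[of j] C(2)[of j]
      e[of j]]
    obtain y where y: "y \<in> (\<Inter>k. \<U> (snd x k))" "\<forall>p\<in>C j. cmod (y p - g j p) < e j"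
      by (elim bexE)
    have "\<exists>\<nu>'\<subseteq>snd x k. infinite \<nu>' \<and>
      conv_along \<nu>' y (F k) (\<lambda>_. 0)" for k
    proof -
      have "y \<in> \<U> (snd x k)" using y(1) by blast
      moreover have "admissible (F k) \<and> open UNIV \<and> box_prod (F k) \<subseteq> UNIV \<and>
        holomorphic_several (\<lambda>_. 0) (G \<times> UNIV)"
        using F by (simp add: holomorphic_several_const)
      ultimately show ?thesis unfolding universal_class_iff by blast
    qed
    then obtain \<sigma> where \<sigma>: "\<And>k. \<sigma> k \<subseteq> snd x k" "\<And>k.
      infinite (\<sigma> k)" "\<And>k. conv_along (\<sigma> k) y (F k) (\<lambda>_. 0)"
      by metis
    show "\<exists>x'. P (Suc j) x' \<and> R j x x'"
      using y \<sigma> by (intro exI[of _ "(y, \<sigma>)"]) (auto simp: P_def R_def)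
  qed
  then obtain X where X: "\<And>j. P j (X j)" "\<And>j. R j (X j) (X (Suc j))" by blast
  show ?thesis
    by (intro exI[of _ "\<lambda>j. fst (X (Suc j))"] exI[of _ "\<lambda>j. snd (X j)"])
       (use X(1)[of 0] X(2) in \<open>simp add: P_def R_def\<close>)
qed

text \<open>Index sets can be prepared for countably many compact sets only, so \<open>K\<close> is
  first enlarged to some \<open>F k\<close>. Density holds because every pair of a polynomial and a
  level has a number \<open>j\<close>, and \<open>Y j\<close> is close to that polynomial at that
  level.\<close>

lemma lineable:
  assumes \<mu>: "infinite \<mu>"
  shows "\<exists>E. cfun.subspace E \<and> E \<subseteq> H \<and> Hol_dense (G \<times> W) E \<and>
    E - {0} \<subseteq> \<U> \<mu>"
proof -
  have "admissible (\<lambda>_. {})" by (simp add: admissible_def connected_UNIV)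
  then have "compact_family \<noteq> {}" using compact_family_cofinal by blast
  then have F: "range (from_nat_into compact_family) = compact_family"
    by (rule range_from_nat_into[OF _ countable_compact_family])
  define F where "F = from_nat_into compact_family"
  have adm: "admissible (F k)" for k using F compact_family_admissible unfolding F_def by blast
  \<comment> \<open>The enumeration of all pairs; the level determines both the compact set
    \<open>C j\<close> and the tolerance \<open>e j\<close>.\<close>
  define T where "T j = (from_nat j :: (nat, 'r, 'd) pexp \<times> nat)" for j
  define g where "g j = (\<lambda>p. if p \<in> G \<times> W then peval \<kappa> (fst (T j)) p else
    0)" for j
  have g: "g j \<in> H" for j unfolding g_def by (rule HolI[OF holomorphic_several_peval open_GW])
  define C where "C j = L (snd (T j)) \<times> M (snd (T j))" for j
  define e where "e j = inverse (real (Suc (snd (T j))))" for j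
  have C: "compact (C j)" "C j \<subseteq> G \<times> W" for j
    using L(1,2)[of "snd (T j)"] M(1,2)[of "snd (T j)"] by (auto simp: C_def intro!: compact_Times)
  have e: "e j > 0" for j by (simp add: e_def)
  from universal_sequence[of \<mu> F g C e, OF \<mu> adm g C e] obtain Y \<sigma> where
    \<sigma>0: "\<forall>k. \<sigma> 0 k = \<mu>"
      and Y\<sigma>: "\<forall>j k. Y j \<in> \<U> (\<sigma> j k) \<and>
     \<sigma> (Suc j) k \<subseteq> \<sigma> j k \<and> conv_along (\<sigma> (Suc j) k) (Y j) (F k)
       (\<lambda>_. 0)"
    and Yg: "\<forall>j. \<forall>p\<in>C j. cmod (Y j p - g j p) < e j"
    by (elim exE conjE)
  have Y: "Y j \<in> \<U> (\<sigma> j k)" and \<sigma>: "\<sigma> (Suc j) k \<subseteq> \<sigma> j k"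
    "conv_along (\<sigma> (Suc j) k) (Y j) (F k) (\<lambda>_. 0)" for j k
    using Y\<sigma> by simp_all
  have YH: "Y j \<in> H" for j using Y universal_class_subset by blast
  have \<sigma>\<mu>: "\<sigma> j k \<subseteq> \<mu>" for j k
    by (induction j) (use \<sigma>0 \<sigma>(1) in blast)+
  define S where "S m a = (\<lambda>p. \<Sum>j<m. a j * Y j p)" for m :: nat
    and a :: "nat \<Rightarrow> complex"
  have S_Suc: "S (Suc m) a = (\<lambda>p. a m * Y m p + S m a p)" for m a by (simp add: S_def add.commute)
  have SH: "S m a \<in> H" for m a
  proof (induction m)
    case 0
    then show ?case by (simp add: S_def Hol_def holomorphic_several_const)
  next
    case (Suc m)
    then show ?case unfolding S_Suc by (intro Hol_lincomb YH)
  qed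
  \<comment> \<open>As the index sets decrease in \<open>m\<close>, what is known of
    \<open>S m a\<close> along \<open>\<sigma> m k\<close> persists along
    \<open>\<sigma> (Suc m) k\<close>, where the Taylor sums of \<open>Y m\<close> vanish on
    \<open>F k\<close> as well.\<close>
  have S_conv: "conv_along (\<sigma> m k) (S m a) (F k) (\<lambda>_. 0)" for m k a
  proof (induction m)
    case 0
    then show ?case using conv_along_zero by (simp add: S_def)
  next
    case (Suc m)
    have "conv_along (\<sigma> (Suc m) k) (S m a) (F k) (\<lambda>_. 0)"
      by (rule conv_along_mono[OF Suc \<sigma>(1)]) simp
    from conv_along_lincomb[OF \<sigma>(2) YH this SH, of UNIV "a m"]
    show ?case unfolding S_Suc by (simp add: holomorphic_several_const)
  qed
  define E where "E = {S m a | m a. True}"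
  have S_extend: "\<exists>b. S m a = S n b" if "m \<le> n" for m n a
  proof
    have "(\<Sum>j<n. (if j < m then a j else 0) * Y j p) = (\<Sum>j<m. a j * Y j p)" for p
      by (rule sum.mono_neutral_cong_right) (use that in auto)
    then show "S m a = S n (\<lambda>j. if j < m then a j else 0)" by (simp add: S_def)
  qed
  have "cfun.subspace E"
    unfolding cfun.subspace_def
  proof (intro conjI ballI allI)
    show "0 \<in> E" unfolding E_def by (auto simp: S_def fun_eq_iff intro!: exI[of _ 0])
    fix x y assume "x \<in> E" "y \<in> E"
    then obtain m a n b where "x = S m a" "y = S n b" by (auto simp: E_def)
    then obtain a' b' where ab: "x = S (max m n) a'" "y = S (max m n) b'"
      using S_extend[of m "max m n" a] S_extend[of n "max m n" b] by auto
    have "x + y = S (max m n) (\<lambda>j. a' j + b' j)"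
      unfolding ab by (auto simp: S_def fun_eq_iff sum.distrib[symmetric] distrib_right)
    then show "x + y \<in> E" by (auto simp: E_def)
  next
    fix c x assume "x \<in> E"
    then obtain m a where "x = S m a" by (auto simp: E_def)
    then have "(\<lambda>p. c * x p) = S m (\<lambda>j. c * a j)"
      by (auto simp: S_def sum_distrib_left mult.assoc)
    then show "(\<lambda>p. c * x p) \<in> E" by (auto simp: E_def)
  qed
  moreover have "E \<subseteq> H" using SH by (auto simp: E_def)
  moreover have "Hol_dense (G \<times> W) E"
    unfolding Hol_dense_def
  proof (intro allI impI, elim conjE)
    fix f C and e :: real
    assume f: "f \<in> H" and C: "compact C" "C \<subseteq> G \<times> W" and e: "e > 0"
    have C1: "compact (fst ` C)" "compact (snd ` C)" "fst ` C \<subseteq> G" "snd ` C \<subseteq> W"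
      using C by (auto intro!: compact_continuous_image continuous_intros)
    obtain t where t: "\<forall>p\<in>C. cmod (peval \<kappa> t p - f p) \<le> e / 2"
      using poly_dense[OF f C, of "e/2"] e by auto
    obtain m1 where m1: "\<forall>n\<ge>m1. fst ` C \<subseteq> L n" using L(4)[OF C1(1,3)] by blast
    obtain m2 where m2: "\<forall>n\<ge>m2. snd ` C \<subseteq> M n" using M(4)[OF C1(2,4)] by blast
    obtain m3 where m3: "inverse (real (Suc m3)) < e / 2" using reals_Archimedean[of "e/2"] e by auto
    define s where "s = max m3 (max m1 m2)"
    have "inverse (real (Suc s)) \<le> inverse (real (Suc m3))"
      by (rule le_imp_inverse_le) (auto simp: s_def)
    then have se: "inverse (real (Suc s)) < e / 2" using m3 by linarith
    define j where "j = to_nat (t, s)"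
    have Tj: "T j = (t, s)" by (simp add: T_def j_def)
    have "cmod (Y j p - f p) < e" if p: "p \<in> C" for p
    proof -
      have "m1 \<le> s" "m2 \<le> s" by (simp_all add: s_def)
      then have "fst ` C \<subseteq> L s" "snd ` C \<subseteq> M s" using m1 m2 by blast+
      then have "fst p \<in> L s" "snd p \<in> M s" using p by blast+
      then have "p \<in> L s \<times> M s" by (cases p) simp
      then have "cmod (Y j p - g j p) < inverse (real (Suc s))" using Yg[rule_format, of p j]
        by (simp add: C_def e_def Tj)
      moreover have "g j p = peval \<kappa> t p" using p C(2) by (auto simp: g_def Tj)
      moreover have "cmod (peval \<kappa> t p - f p) \<le> e / 2" using t p by blast
      ultimately show ?thesis
        using norm_triangle_ineq[of "Y j p - g j p" "peval \<kappa> t p - f p"] se by simp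
    qed
    moreover have "Y j \<in> E"
    proof -
      have "(\<Sum>i<Suc j. (if i = j then 1 else 0) * Y i p) = Y j p" for p
        by (simp add: if_distrib[of "\<lambda>c. c * _"] cong: if_cong)
      then have "Y j = S (Suc j) (\<lambda>i. if i = j then 1 else 0)" unfolding S_def by simp
      then show ?thesis unfolding E_def by blast
    qed
    ultimately show "\<exists>g\<in>E. \<forall>p\<in>C. cmod (g p - f p) < e" by blast
  qed
  moreover have "E - {0} \<subseteq> \<U> \<mu>"
  proof
    fix x assume "x \<in> E - {0}"
    then obtain m a where x: "x = S m a" "x \<noteq> 0" by (auto simp: E_def)
    \<comment> \<open>Zero coefficients at the end are stripped; \<open>i\<close> is the position of
      the last nonzero coefficient.\<close>
    have "\<exists>i. a i \<noteq> 0 \<and> x = S (Suc i) a"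
      using x
    proof (induction m)
      case 0
      then show ?case by (simp add: S_def fun_eq_iff)
    next
      case (Suc m)
      show ?case
      proof (cases "a m = 0")
        case True
        then have "x = S m a" using Suc.prems(1) by (simp add: S_Suc)
        then show ?thesis using Suc.IH Suc.prems(2) by blast
      qed (use Suc.prems in blast)
    qed
    then obtain i where i: "a i \<noteq> 0" "x = S (Suc i) a" by blast
    have xH: "x \<in> H" using i(2) SH by simp
    show "x \<in> \<U> \<mu>"
      unfolding universal_class_iff
    proof (intro conjI allI impI)
      fix K V h assume A: "admissible K \<and> open V \<and> box_prod K \<subseteq> V \<and>
        holomorphic_several h (G \<times> V)"
      obtain K' where K': "K' \<in> compact_family" "\<And>j. K j \<subseteq> K' j"
        using compact_family_cofinal A by blast
      obtain k where k: "K' = F k" using K'(1) F unfolding F_def by blast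
      \<comment> \<open>\<open>Y i\<close> is aimed at \<open>h / a i\<close> with indices from
        \<open>\<sigma> i k\<close>. Along these the earlier terms have Taylor sums tending to 0 on
        \<open>K\<close>, so the whole combination tends to \<open>h\<close>.\<close>
      define h' where "h' p = (1 / a i) * h p" for p
      have h': "holomorphic_several h' (G \<times> V)" unfolding h'_def[abs_def] using A
        by (intro holomorphic_several_cmult) blast
      obtain \<nu> where \<nu>: "\<nu> \<subseteq> \<sigma> i k" "infinite \<nu>" "conv_along \<nu>
        (Y i) K h'"
        using Y[of i k] A h' unfolding universal_class_iff by blast
      have "conv_along \<nu> (S i a) K (\<lambda>_. 0)"
        by (rule conv_along_mono[OF S_conv \<nu>(1)]) (use K'(2) k in simp)
      then have "conv_along \<nu> (\<lambda>p. a i * Y i p + S i a p) K (\<lambda>p. a i * h' p + 0)"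
        by (rule conv_along_lincomb[OF \<nu>(3) YH _ SH]) (use A h' in \<open>simp_all add:
          holomorphic_several_const\<close>)
      moreover have "(\<lambda>p. a i * h' p + 0) = h" using i(1) by (simp add: h'_def)
      ultimately have "conv_along \<nu> x K h" using i(2) S_Suc by simp
      then show "\<exists>\<nu>'\<subseteq>\<mu>. infinite \<nu>' \<and> conv_along \<nu>' x K h"
        using \<nu>(1,2) \<sigma>\<mu> by (intro exI[of _ \<nu>]) blast
    qed (rule xH)
  qed
  ultimately show ?thesis by blast
qed

end

theorem theorem4p7:
  fixes G :: "'r::{finite,linorder} \<Rightarrow> complex set"
    and \<Omega> :: "'d::{finite,linorder} \<Rightarrow> complex set"
    and \<zeta>\<^sub>0 :: "'d cspace"
    and N :: "nat \<Rightarrow> 'd mindex"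
    and \<mu> :: "nat set"
  assumes "\<And>i. simply_connected_domain (G i)"
    and "\<And>i. simply_connected_domain (\<Omega> i)"
    and "\<zeta>\<^sub>0 \<in> box_prod \<Omega>"
    and "bij N"
    and "infinite \<mu>"
  shows "gdelta_in (Hol_top (box_prod G \<times> box_prod \<Omega>)) (universal_class N \<mu> (box_prod G) \<Omega> \<zeta>\<^sub>0) \<and>
    Hol_top (box_prod G \<times> box_prod \<Omega>) closure_of (universal_class N \<mu> (box_prod G) \<Omega> \<zeta>\<^sub>0)
      = Hol (box_prod G \<times> box_prod \<Omega>) \<and>
    (\<exists>E. cfun.subspace E \<and> E \<subseteq> Hol (box_prod G \<times> box_prod \<Omega>) \<and>
       Hol_top (box_prod G \<times> box_prod \<Omega>) closure_of E = Hol (box_prod G \<times> box_prod \<Omega>) \<and>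
       E - {0} \<subseteq> universal_class N \<mu> (box_prod G) \<Omega> \<zeta>\<^sub>0)"
proof -
  have o: "open (G i)" "open (\<Omega> j)" for i j
    using assms(1)[of i] assms(2)[of j] by (auto simp: simply_connected_domain_def)
  then have oG: "open (box_prod G)" and oW: "open (box_prod \<Omega>)" by (auto intro!: open_box_prod)
  obtain L where L: "\<And>n. compact (L n)" "\<And>n. L n \<subseteq> box_prod G" "\<And>n. L n
    \<subseteq> L (Suc n)"
      "\<And>C. \<lbrakk>compact C; C \<subseteq> box_prod G\<rbrakk> \<Longrightarrow>
        \<exists>m :: nat. \<forall>n\<ge>m. C \<subseteq> L n"
    using compact_exhaustion[OF oG] by auto
  obtain M where M: "\<And>n. compact (M n)" "\<And>n. M n \<subseteq> box_prod \<Omega>" "\<And>n.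
    M n \<subseteq> M (Suc n)"
      "\<And>C. \<lbrakk>compact C; C \<subseteq> box_prod \<Omega>\<rbrakk> \<Longrightarrow>
        \<exists>m :: nat. \<forall>n\<ge>m. C \<subseteq> M n"
    using compact_exhaustion[OF oW] by auto
  obtain D :: "complex set" where D: "countable D" "\<And>X. \<lbrakk>open X; X \<noteq> {}\<rbrakk> \<Longrightarrow>
    \<exists>d\<in>D. d \<in> X"
    using countable_dense_setE by blast
  have "closure D = UNIV" using D(2) by (force simp: closure_def islimpt_def)
  moreover have "D \<noteq> {}" using D(2)[of UNIV] by auto
  ultimately have \<kappa>: "closure (range (from_nat_into D)) = UNIV"
    using D(1) by (simp add: range_from_nat_into)
  obtain \<Q> :: "complex set set" where \<Q>: "countable \<Q>" "\<And>Q. Q \<in> \<Q> \<Longrightarrow>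
    compact Q \<and> connected (- Q)"
    "\<And>K U. \<lbrakk>compact K; connected (- K); open U; K \<subseteq> U\<rbrakk> \<Longrightarrow>
      \<exists>Q\<in>\<Q>. K \<subseteq> interior Q \<and> Q \<subseteq> U"
    using countable_cofinal_compacts by blast
  interpret universal_setting G \<Omega> \<zeta>\<^sub>0 N L M "from_nat_into D" \<Q>
    by unfold_locales (fact oG oW assms L M \<kappa> \<Q>)+
  \<comment> \<open>The constant family of index sets reduces density of the class for
    \<open>\<mu>\<close> to the statement about countable intersections.\<close>
  have "Hol_dense (box_prod G \<times> box_prod \<Omega>) (universal_class N \<mu> (box_prod G)
    \<Omega> \<zeta>\<^sub>0)"
    using dense_Inter_universal_class[of "\<lambda>_. \<mu>"] assms(5) by simp
  then have "Hol_top (box_prod G \<times> box_prod \<Omega>) closure_of (universal_class N \<mu>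
    (box_prod G) \<Omega> \<zeta>\<^sub>0)
      = Hol (box_prod G \<times> box_prod \<Omega>)"
    by (rule Hol_top_closure_dense[OF universal_class_subset])
  moreover obtain E where E: "cfun.subspace E" "E \<subseteq> Hol (box_prod G \<times> box_prod \<Omega>)"
      "Hol_dense (box_prod G \<times> box_prod \<Omega>) E" "E - {0} \<subseteq> universal_class N
        \<mu> (box_prod G) \<Omega> \<zeta>\<^sub>0"
    using lineable[OF assms(5)] by blast
  ultimately show ?thesis
    using gdelta_universal_class[OF assms(5)] Hol_top_closure_dense[OF E(2,3)]
    by (intro conjI exI[of _ E] E)
qed

end
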